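(* Let $m$ be a positive integer and consider the Cauchy problem $$\begin{cases}\partial_t^m u(t,\mathbf{x})=f\big(t,\mathbf{x},u,\partial_{\mathbf{x}}^{\beta}\partial_t^{j}u\big),\\ \partial_t^k u(t,\mathbf{x})|_{t=0}=\phi_k(\mathbf{x}),\quad k=0,1,\dots,m-1,\end{cases}$$ where $t\in\mathbb{R}$, $\mathbf{x}=(x_i)\in\mathbb{R}^{\infty}$, the unknown $u$ is a real-valued function of $(t,\mathbf{x})$, and $f$ is a (nonlinear) real-valued function of $t$, $\mathbf{x}$, $u$ and all derivatives $\partial_{\mathbf{x}}^{\beta}\partial_t^{j}u$ with $\beta\in\mathbb{N}^{(\mathbb{N})}$, $j<m$, $1\le|\beta|+j\le m$. Let $u_0$ and $\mathbf{w}^0=(w^0_{\beta,j})$ be the values of $u$ and of $\partial_{\mathbf{x}}^{\beta}\partial_t^{j}u$ at $(0,(0))$ determined by the initial conditions. Suppose that $f$ is analytic near $(0,(0),u_0,\mathbf{w}^0)$ with monomial expansion $$f\big(t,\mathbf{x},u,\mathbf{w}\big)=\sum_{\alpha\in\mathbb{N}^{(\mathbb{N})}}C_{\alpha}\big(t,\mathbf{x},u-u_0,\mathbf{w}-\mathbf{w}^0\big)^{\alpha},$$ and that each $\phi_k$ ($0\le k\le m-1$) is analytic near the origin with monomial expansion $\phi_k(\mathbf{x})=\sum_{\alpha\in\mathbb{N}^{(\mathbb{N})}}C_{\alpha,k}\mathbf{x}^{\alpha}$. Put $$F(t,\mathbf{x},u,\mathbf{w})=\sum_{\alpha\in\mathbb{N}^{(\mathbb{N})}}|C_{\alpha}|(t,\mathbf{x},u,\mathbf{w})^{\alpha},\qquad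 \Phi_k(t,\mathbf{x},u,\mathbf{w})=\sum_{\alpha\in\mathbb{N}^{(\mathbb{N})}}|C_{\alpha,k}|\mathbf{x}^{\alpha}.$$ Suppose $1\le p<\infty$ and that the monomial expansions of $\Phi_k$, $0\le k\le m-1$, and of $F$ near the origin are absolutely convergent at a point near $\infty$ in the topology $\mathcal{T}^p$. Let $p'$ be the Hölder conjugate of $p$ ($\frac1p+\frac1{p'}=1$, with $p'=\infty$ if $p=1$). Then the Cauchy problem admits a locally analytic solution (near $(0)$), which is unique in the class of analytic functions under the topology $\mathscr{T}_{p'}$. Furthermore, the solution $u$ is Fréchet differentiable with respect to $\ell^{p'}$ in a neighborhood of $(0)$ in the topology $\mathcal{T}^{p'}$, and the corresponding Fréchet derivative $Du$ is continuous.
   Context: $\mathbb{R}^{\infty}$ is the countable Cartesian product of copies of $\mathbb{R}$, $(0)$ denotes its zero element, and any countable product such as $\mathbb{R}\times\mathbb{R}^{\infty}$ or $\mathbb{R}\times\mathbb{R}^{\infty}\times\mathbb{R}\times\mathbb{R}^{\infty}$ is identified with $\mathbb{R}^{\infty}$; in particular the point $(0,(0))$ of $\mathbb{R}\times\mathbb{R}^\infty$ is also written $(0)$. The variable $\mathbf{w}=(w_{\beta,j})$ is indexed by the countable set of $(\beta,j)$ with $\beta\in\mathbb{N}^{(\mathbb{N})}$, $j<m$, $1\le|\beta|+j\le m$. $\mathbb{N}^{(\mathbb{N})}$ is the set of finitely supported sequences of nonnegative integers. For $\mathbf{x}=(x_i)\in\mathbb{R}^{\infty}$ and $\alpha=(\alpha_i)\in\mathbb{N}^{(\mathbb{N})}$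 with $\alpha_k=0$ for $k>n$, $\mathbf{x}^{\alpha}=x_1^{\alpha_1}\cdots x_n^{\alpha_n}$, $|\alpha|=\sum_i\alpha_i$, and $\partial_{\mathbf{x}}^{\alpha}=\partial_{x_1}^{\alpha_1}\cdots\partial_{x_n}^{\alpha_n}$ (iterated partial derivatives). Analyticity: a real-valued function $f$ on $D\subset\mathbb{R}^{\infty}$ is analytic near $\mathbf{x}_0\in D$ if there are real numbers $c_{\alpha}$ ($\alpha\in\mathbb{N}^{(\mathbb{N})}$) such that $\sum_{\alpha}c_{\alpha}\mathbf{x}^{\alpha}$ converges absolutely for some $\mathbf{x}=(x_i)\in\mathbb{R}^{\infty}$ with all $x_i\ne0$, and for each $\mathbf{h}=(h_i)$ with $|h_i|\le|x_i|$ for all $i$ one has $\mathbf{x}_0+\mathbf{h}\in D$ and $f(\mathbf{x}_0+\mathbf{h})=\sum_{\alpha}c_{\alpha}\mathbf{h}^{\alpha}$ (the monomial expansion of $f$ near $\mathbf{x}_0$). For $0<p<\infty$, the monomial expansion $\sum_\alpha c_\alpha\mathbf{h}^\alpha$ of $f$ near $\mathbf{x}_0$ is called absolutely convergent at a point near $\infty$ in the topology $\mathcal{T}^p$ if there is $\mathbf{x}=(x_i)\in\mathbb{R}^{\infty}$ with all $x_i\neq 0$ and $\sum_{i}\frac{1}{|x_i|^p}<\infty$ such that $f$ is analytic near $\mathbf{x}_0$ with this expansion and $\sum_{\alpha}|c_{\alpha}\mathbf{x}^{\alpha}|<\infty$. Topologies: for $1\le p<\infty$, $B_r^p=\{(x_i)\in\mathbb{R}^{\infty}:(\sum_i|x_i|^p)^{1/p}<r\}$;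 for $0<p<1$, $B_r^p=\{(x_i):\sum_i|x_i|^p<r\}$; $B_r^{\infty}=\{(x_i):\sup_i|x_i|<r\}$. For $0<p\le\infty$, $\mathscr{T}_p$ is the topology on $\mathbb{R}^{\infty}$ with base $\{\mathbf{x}+B_r^p:\mathbf{x}\in\mathbb{R}^{\infty},r>0\}$. $\mathcal{T}^p$ is the topology on $\mathbb{R}^{\infty}\sqcup\{\infty\}$ whose base consists of these sets together with the sets $\{(x_n):x_n\ne0\ \forall n,\ \sum_n|x_n|^{-p}<r\}\sqcup\{\infty\}$, $r>0$ (for $p=\infty$: $\sup_n|x_n|^{-1}<r$); its subspace topology on $\mathbb{R}^{\infty}$ is $\mathscr{T}_p$. Fréchet differentiability: for $p\in[1,\infty]$, a real-valued function $f$ on $U\subset\mathbb{R}^{\infty}$ is Fréchet differentiable with respect to $\ell^p$ in a neighborhood of $\mathbf{x}\in U$ in the topology $\mathscr{T}_p$ if there is $r\in(0,1)$ with $\mathbf{x}+B_r^p\subset U$ such that $g(\cdot)=f(\mathbf{x}+\cdot)$ is Fréchet differentiable on $B_r^p$, viewed as an open ball of the Banach space $\ell^p$.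
   Formalization: The formal theorem also assumes that the monomial expansions of f and each φ_k represent these functions on the whole polydisc of a point near ∞ in 𝒯^p, not merely on some polydisc; without this no analytic solution need exist. *)

theory Defs
  imports "HOL-Analysis.Analysis" "HOL-Library.Poly_Mapping"
begin

section \<open>Countable products of the real line\<close>

text \<open>
  All countable products of copies of \<open>\<real>\<close> that occur are indexed by their own natural index sets
  \<open>I\<close> instead of being renumbered by \<open>\<nat>\<close>; none of the notions below depends on an enumeration.
  A point of \<open>\<real>\<^sup>I\<close> is a function on the index type that vanishes off \<open>I\<close>, so that vector addition
  is pointwise addition.
\<close>

definition Rprod :: "'i set \<Rightarrow> ('i \<Rightarrow> real) set" where
  "Rprod I = {x. \<forall>i. i \<notin> I \<longrightarrow> x i = 0}"

definition multi_indices :: "'i set \<Rightarrow> ('i \<Rightarrow>\<^sub>0 nat) set" where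
  "multi_indices I = {\<alpha>. Poly_Mapping.keys \<alpha> \<subseteq> I}"

definition mdeg :: "('i \<Rightarrow>\<^sub>0 nat) \<Rightarrow> nat" where
  "mdeg \<alpha> = (\<Sum>i\<in>Poly_Mapping.keys \<alpha>. Poly_Mapping.lookup \<alpha> i)"

definition mpow :: "('i \<Rightarrow> real) \<Rightarrow> ('i \<Rightarrow>\<^sub>0 nat) \<Rightarrow> real" where
  "mpow x \<alpha> = (\<Prod>i\<in>Poly_Mapping.keys \<alpha>. x i ^ Poly_Mapping.lookup \<alpha> i)"


section \<open>Monomial expansions and analyticity\<close>

definition monomial_conv :: "'i set \<Rightarrow> (('i \<Rightarrow>\<^sub>0 nat) \<Rightarrow> real) \<Rightarrow> ('i \<Rightarrow> real) \<Rightarrow> bool" where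
  "monomial_conv I c h \<longleftrightarrow> (\<lambda>\<alpha>. \<bar>c \<alpha> * mpow h \<alpha>\<bar>) summable_on multi_indices I"

definition monomial_sum :: "'i set \<Rightarrow> (('i \<Rightarrow>\<^sub>0 nat) \<Rightarrow> real) \<Rightarrow> ('i \<Rightarrow> real) \<Rightarrow> real" where
  "monomial_sum I c h = (\<Sum>\<^sub>\<infinity>\<alpha>\<in>multi_indices I. c \<alpha> * mpow h \<alpha>)"

text \<open>
  \<open>f\<close>, a function on \<open>D\<close>, is analytic near \<open>x\<^sub>0\<close> with coefficients \<open>c\<close>, and the point \<open>\<rho>\<close> is a witness
  for this: \<open>\<rho>\<close> is the point of absolute convergence and the radius of the polydisc on which the
  expansion represents \<open>f\<close>.
\<close>
definition analytic_near_at ::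
  "'i set \<Rightarrow> ('i \<Rightarrow> real) set \<Rightarrow> (('i \<Rightarrow> real) \<Rightarrow> real) \<Rightarrow> ('i \<Rightarrow> real)
    \<Rightarrow> (('i \<Rightarrow>\<^sub>0 nat) \<Rightarrow> real) \<Rightarrow> ('i \<Rightarrow> real) \<Rightarrow> bool" where
  "analytic_near_at I D f x\<^sub>0 c \<rho> \<longleftrightarrow>
     D \<subseteq> Rprod I \<and> x\<^sub>0 \<in> D \<and> \<rho> \<in> Rprod I \<and> (\<forall>i\<in>I. \<rho> i \<noteq> 0) \<and> monomial_conv I c \<rho> \<and>
     (\<forall>h\<in>Rprod I. (\<forall>i\<in>I. \<bar>h i\<bar> \<le> \<bar>\<rho> i\<bar>) \<longrightarrow>
        (\<lambda>i. x\<^sub>0 i + h i) \<in> D \<and> f (\<lambda>i. x\<^sub>0 i + h i) = monomial_sum I c h)"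

definition analytic_near_with ::
  "'i set \<Rightarrow> ('i \<Rightarrow> real) set \<Rightarrow> (('i \<Rightarrow> real) \<Rightarrow> real) \<Rightarrow> ('i \<Rightarrow> real)
    \<Rightarrow> (('i \<Rightarrow>\<^sub>0 nat) \<Rightarrow> real) \<Rightarrow> bool" where
  "analytic_near_with I D f x\<^sub>0 c \<longleftrightarrow> (\<exists>\<rho>. analytic_near_at I D f x\<^sub>0 c \<rho>)"

text \<open>
  The monomial expansion \<open>c\<close> of \<open>f\<close> near \<open>x\<^sub>0\<close> is absolutely convergent at a point near infinity in
  the topology \<open>\<T>\<^sup>p\<close>. The point near infinity is also the radius of the polydisc on which
  the expansion represents \<open>f\<close>.
\<close>
definition abs_conv_near_infinity ::
  "real \<Rightarrow> 'i set \<Rightarrow> ('i \<Rightarrow> real) set \<Rightarrow> (('i \<Rightarrow> real) \<Rightarrow> real) \<Rightarrow> ('i \<Rightarrow> real)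
    \<Rightarrow> (('i \<Rightarrow>\<^sub>0 nat) \<Rightarrow> real) \<Rightarrow> bool" where
  "abs_conv_near_infinity p I D f x\<^sub>0 c \<longleftrightarrow>
     (\<exists>\<rho>. (\<lambda>i. 1 / \<bar>\<rho> i\<bar> powr p) summable_on I \<and> analytic_near_at I D f x\<^sub>0 c \<rho>)"


section \<open>The topologies \<open>\<T>\<^sub>q\<close> and Frechet differentiability with respect to \<open>\<ell>\<^sup>q\<close>\<close>

text \<open>The exponent \<open>q\<close> ranges over \<open>[1, \<infinity>]\<close>.\<close>

definition lq_space :: "ennreal \<Rightarrow> 'i set \<Rightarrow> ('i \<Rightarrow> real) set" where
  "lq_space q I = {x \<in> Rprod I.
     if q = \<infinity> then bdd_above ((\<lambda>i. \<bar>x i\<bar>) ` I)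
     else (\<lambda>i. \<bar>x i\<bar> powr enn2real q) summable_on I}"

definition lq_norm :: "ennreal \<Rightarrow> 'i set \<Rightarrow> ('i \<Rightarrow> real) \<Rightarrow> real" where
  "lq_norm q I x =
     (if q = \<infinity> then (SUP i\<in>I. \<bar>x i\<bar>)
      else (\<Sum>\<^sub>\<infinity>i\<in>I. \<bar>x i\<bar> powr enn2real q) powr (1 / enn2real q))"

definition lq_ball :: "ennreal \<Rightarrow> 'i set \<Rightarrow> real \<Rightarrow> ('i \<Rightarrow> real) set" where
  "lq_ball q I r = {x \<in> lq_space q I. lq_norm q I x < r}"

text \<open>
  The generating sets form a base. On all of \<open>\<real>\<^sup>I\<close> this is not a vector space topology:
  the cosets of \<open>\<ell>\<^sup>q\<close> are open.
\<close>
definition lq_topology :: "ennreal \<Rightarrow> 'i set \<Rightarrow> ('i \<Rightarrow> real) topology" where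
  "lq_topology q I = topology_generated_by
     {(\<lambda>h i. x i + h i) ` lq_ball q I r | x r. x \<in> Rprod I \<and> r > 0}"

text \<open>
  The class of analytic functions under the topology \<open>\<T>\<^sub>q\<close>: the monomial expansion near \<open>x\<^sub>0\<close>
  converges absolutely and represents \<open>f\<close> on a \<open>\<T>\<^sub>q\<close>-neighborhood of \<open>x\<^sub>0\<close>. (The
  polydisc in the definition of analyticity need not contain such a neighborhood, since its radii
  may tend to 0.)
\<close>
definition analytic_near_under ::
  "ennreal \<Rightarrow> 'i set \<Rightarrow> ('i \<Rightarrow> real) set \<Rightarrow> (('i \<Rightarrow> real) \<Rightarrow> real) \<Rightarrow> ('i \<Rightarrow> real) \<Rightarrow> bool" where
  "analytic_near_under q I D f x\<^sub>0 \<longleftrightarrow>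
     (\<exists>c. analytic_near_with I D f x\<^sub>0 c \<and>
       (\<exists>W. openin (lq_topology q I) W \<and> x\<^sub>0 \<in> W \<and> W \<subseteq> D \<and>
         (\<forall>x\<in>W. monomial_conv I c (\<lambda>i. x i - x\<^sub>0 i) \<and>
                 f x = monomial_sum I c (\<lambda>i. x i - x\<^sub>0 i))))"

definition lq_functional :: "ennreal \<Rightarrow> 'i set \<Rightarrow> (('i \<Rightarrow> real) \<Rightarrow> real) \<Rightarrow> bool" where
  "lq_functional q I L \<longleftrightarrow>
     (\<forall>h\<in>lq_space q I. \<forall>k\<in>lq_space q I. L (\<lambda>i. h i + k i) = L h + L k) \<and>
     (\<forall>a. \<forall>h\<in>lq_space q I. L (\<lambda>i. a * h i) = a * L h) \<and>
     (\<exists>K. \<forall>h\<in>lq_space q I. \<bar>L h\<bar> \<le> K * lq_norm q I h)"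

definition has_lq_derivative ::
  "ennreal \<Rightarrow> 'i set \<Rightarrow> (('i \<Rightarrow> real) \<Rightarrow> real) \<Rightarrow> (('i \<Rightarrow> real) \<Rightarrow> real) \<Rightarrow> ('i \<Rightarrow> real) \<Rightarrow> bool" where
  "has_lq_derivative q I g L y \<longleftrightarrow> lq_functional q I L \<and>
     (\<forall>\<epsilon>>0. \<exists>\<delta>>0. \<forall>h\<in>lq_space q I. lq_norm q I h < \<delta> \<longrightarrow>
        \<bar>g (\<lambda>i. y i + h i) - g y - L h\<bar> \<le> \<epsilon> * lq_norm q I h)"

text \<open>Continuity of \<open>y \<mapsto> Dg y\<close> from the \<open>\<ell>\<^sup>q\<close>-ball to the dual space with the operator norm.\<close>
definition lq_derivative_continuous ::
  "ennreal \<Rightarrow> 'i set \<Rightarrow> real \<Rightarrow> (('i \<Rightarrow> real) \<Rightarrow> ('i \<Rightarrow> real) \<Rightarrow> real) \<Rightarrow> bool" where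
  "lq_derivative_continuous q I r Dg \<longleftrightarrow>
     (\<forall>y\<in>lq_ball q I r. \<forall>\<epsilon>>0. \<exists>\<delta>>0. \<forall>z\<in>lq_ball q I r.
        lq_norm q I (\<lambda>i. z i - y i) < \<delta> \<longrightarrow>
        (\<forall>h\<in>lq_space q I. \<bar>Dg z h - Dg y h\<bar> \<le> \<epsilon> * lq_norm q I h))"

definition frechet_C1_near ::
  "ennreal \<Rightarrow> 'i set \<Rightarrow> ('i \<Rightarrow> real) set \<Rightarrow> (('i \<Rightarrow> real) \<Rightarrow> real) \<Rightarrow> ('i \<Rightarrow> real) \<Rightarrow> bool" where
  "frechet_C1_near q I U f x \<longleftrightarrow>
     (\<exists>r Dg. 0 < r \<and> r < 1 \<and> (\<lambda>h i. x i + h i) ` lq_ball q I r \<subseteq> U \<and>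
        (\<forall>y\<in>lq_ball q I r. has_lq_derivative q I (\<lambda>h. f (\<lambda>i. x i + h i)) (Dg y) y) \<and>
        lq_derivative_continuous q I r Dg)"


section \<open>Iterated partial derivatives\<close>

definition pderiv_at :: "'i \<Rightarrow> (('i \<Rightarrow> real) \<Rightarrow> real) \<Rightarrow> ('i \<Rightarrow> real) \<Rightarrow> real" where
  "pderiv_at i g = (\<lambda>x. deriv (\<lambda>s. g (x(i := s))) (x i))"

text \<open>The head of the list is the derivative that is applied last.\<close>
fun iter_pderiv :: "'i list \<Rightarrow> (('i \<Rightarrow> real) \<Rightarrow> real) \<Rightarrow> ('i \<Rightarrow> real) \<Rightarrow> real" where
  "iter_pderiv [] g = g"
| "iter_pderiv (i # is) g = pderiv_at i (iter_pderiv is g)"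

fun iter_pderiv_exists :: "('i \<Rightarrow> real) set \<Rightarrow> 'i list \<Rightarrow> (('i \<Rightarrow> real) \<Rightarrow> real) \<Rightarrow> bool" where
  "iter_pderiv_exists S [] g \<longleftrightarrow> True"
| "iter_pderiv_exists S (i # is) g \<longleftrightarrow> iter_pderiv_exists S is g \<and>
     (\<forall>x\<in>S. (\<lambda>s. iter_pderiv is g (x(i := s))) field_differentiable at (x i))"

text \<open>\<open>\<partial>\<^sup>\<beta> = \<partial>\<^sub>1 \<dots> \<partial>\<^sub>1 \<partial>\<^sub>2 \<dots> \<partial>\<^sub>2 \<dots>\<close> as a list of coordinates.\<close>
definition mlist :: "(nat \<Rightarrow>\<^sub>0 nat) \<Rightarrow> nat list" where
  "mlist \<beta> = concat (map (\<lambda>i. replicate (Poly_Mapping.lookup \<beta> i) i)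
                       (sorted_list_of_set (Poly_Mapping.keys \<beta>)))"


section \<open>The Cauchy problem\<close>

text \<open>Coordinates of \<open>(t, x) \<in> \<real> \<times> \<real>\<^sup>\<infinity>\<close>, and of \<open>(t, x, u, w) \<in> \<real> \<times> \<real>\<^sup>\<infinity> \<times> \<real> \<times> \<real>\<^sup>\<infinity>\<close>.\<close>

datatype tx_index = Time | Space nat

datatype jet_index = Indep tx_index | Unknown | Jet "nat \<Rightarrow>\<^sub>0 nat" nat

definition jet_orders :: "nat \<Rightarrow> ((nat \<Rightarrow>\<^sub>0 nat) \<times> nat) set" where
  "jet_orders m = {(\<beta>, j). j < m \<and> 1 \<le> mdeg \<beta> + j \<and> mdeg \<beta> + j \<le> m}"

definition jet_indices :: "nat \<Rightarrow> jet_index set" where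
  "jet_indices m = range Indep \<union> {Unknown} \<union> {Jet \<beta> j | \<beta> j. (\<beta>, j) \<in> jet_orders m}"

definition tx_point :: "real \<Rightarrow> (nat \<Rightarrow> real) \<Rightarrow> tx_index \<Rightarrow> real" where
  "tx_point t x = (\<lambda>v. case v of Time \<Rightarrow> t | Space i \<Rightarrow> x i)"

text \<open>The derivative \<open>\<partial>\<^sub>x\<^sup>\<beta> \<partial>\<^sub>t\<^sup>j\<close>.\<close>
definition tx_derivs :: "(nat \<Rightarrow>\<^sub>0 nat) \<Rightarrow> nat \<Rightarrow> tx_index list" where
  "tx_derivs \<beta> j = map Space (mlist \<beta>) @ replicate j Time"

definition jet :: "nat \<Rightarrow> ((tx_index \<Rightarrow> real) \<Rightarrow> real) \<Rightarrow> (tx_index \<Rightarrow> real) \<Rightarrow> jet_index \<Rightarrow> real" where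
  "jet m u y = (\<lambda>i. case i of
      Indep v \<Rightarrow> y v
    | Unknown \<Rightarrow> u y
    | Jet \<beta> j \<Rightarrow> if (\<beta>, j) \<in> jet_orders m then iter_pderiv (tx_derivs \<beta> j) u y else 0)"

text \<open>
  The point \<open>(0, (0), u\<^sub>0, w\<^sup>0)\<close>. As \<open>\<partial>\<^sub>t\<^sup>j u = \<phi>\<^sub>j\<close> at \<open>t = 0\<close>, the initial conditions
  determine \<open>u\<^sub>0 = \<phi>\<^sub>0 (0)\<close> and \<open>w\<^sup>0\<^sub>\<beta>\<^sub>j = \<partial>\<^sup>\<beta> \<phi>\<^sub>j (0)\<close>.
\<close>
definition initial_jet :: "nat \<Rightarrow> (nat \<Rightarrow> (nat \<Rightarrow> real) \<Rightarrow> real) \<Rightarrow> jet_index \<Rightarrow> real" where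
  "initial_jet m \<phi> = (\<lambda>i. case i of
      Indep v \<Rightarrow> 0
    | Unknown \<Rightarrow> \<phi> 0 (\<lambda>_. 0)
    | Jet \<beta> j \<Rightarrow> if (\<beta>, j) \<in> jet_orders m then iter_pderiv (mlist \<beta>) (\<phi> j) (\<lambda>_. 0) else 0)"

text \<open>
  \<open>u\<close> solves the Cauchy problem on \<open>S\<close>, for a right-hand side \<open>f\<close> with domain \<open>D\<close> and initial data
  \<open>\<phi> k\<close> with domain \<open>E k\<close>. Membership in the domains makes both equations meaningful.
\<close>
definition cauchy_solution_on ::
  "nat \<Rightarrow> (jet_index \<Rightarrow> real) set \<Rightarrow> ((jet_index \<Rightarrow> real) \<Rightarrow> real)
    \<Rightarrow> (nat \<Rightarrow> (nat \<Rightarrow> real) set) \<Rightarrow> (nat \<Rightarrow> (nat \<Rightarrow> real) \<Rightarrow> real)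
    \<Rightarrow> (tx_index \<Rightarrow> real) set \<Rightarrow> ((tx_index \<Rightarrow> real) \<Rightarrow> real) \<Rightarrow> bool" where
  "cauchy_solution_on m D f E \<phi> S u \<longleftrightarrow>
     iter_pderiv_exists S (replicate m Time) u \<and>
     (\<forall>(\<beta>, j)\<in>jet_orders m. iter_pderiv_exists S (tx_derivs \<beta> j) u) \<and>
     (\<forall>y\<in>S. jet m u y \<in> D \<and> iter_pderiv (replicate m Time) u y = f (jet m u y)) \<and>
     (\<forall>k<m. \<forall>x. tx_point 0 x \<in> S \<longrightarrow>
        x \<in> E k \<and> iter_pderiv (replicate k Time) u (tx_point 0 x) = \<phi> k x)"


section \<open>The majorants \<open>F\<close> and \<open>\<Phi>\<^sub>k\<close>\<close>

text \<open>Both are functions of \<open>(t, x, u, w)\<close>, on the set where the defining series converges absolutely.\<close>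

definition F_major :: "nat \<Rightarrow> ((jet_index \<Rightarrow>\<^sub>0 nat) \<Rightarrow> real) \<Rightarrow> (jet_index \<Rightarrow> real) \<Rightarrow> real" where
  "F_major m C z = monomial_sum (jet_indices m) (\<lambda>\<alpha>. \<bar>C \<alpha>\<bar>) z"

definition F_domain :: "nat \<Rightarrow> ((jet_index \<Rightarrow>\<^sub>0 nat) \<Rightarrow> real) \<Rightarrow> (jet_index \<Rightarrow> real) set" where
  "F_domain m C = {z \<in> Rprod (jet_indices m). monomial_conv (jet_indices m) (\<lambda>\<alpha>. \<bar>C \<alpha>\<bar>) z}"

definition space_index :: "nat \<Rightarrow> jet_index" where
  "space_index i = Indep (Space i)"

definition Phi_major :: "((nat \<Rightarrow>\<^sub>0 nat) \<Rightarrow> real) \<Rightarrow> (jet_index \<Rightarrow> real) \<Rightarrow> real" where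
  "Phi_major c z = monomial_sum UNIV (\<lambda>\<alpha>. \<bar>c \<alpha>\<bar>) (\<lambda>i. z (space_index i))"

definition Phi_domain :: "nat \<Rightarrow> ((nat \<Rightarrow>\<^sub>0 nat) \<Rightarrow> real) \<Rightarrow> (jet_index \<Rightarrow> real) set" where
  "Phi_domain m c = {z \<in> Rprod (jet_indices m).
     monomial_conv UNIV (\<lambda>\<alpha>. \<bar>c \<alpha>\<bar>) (\<lambda>i. z (space_index i))}"

text \<open>
  Coefficients of the expansion of \<open>\<Phi>\<^sub>k\<close> in all the variables \<open>(t, x, u, w)\<close>: a monomial that
  involves a variable other than the \<open>x\<^sub>i\<close> has coefficient 0.
\<close>
definition Phi_coeff :: "((nat \<Rightarrow>\<^sub>0 nat) \<Rightarrow> real) \<Rightarrow> (jet_index \<Rightarrow>\<^sub>0 nat) \<Rightarrow> real" where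
  "Phi_coeff c \<gamma> = (if Poly_Mapping.keys \<gamma> \<subseteq> range space_index
                     then \<bar>c (Poly_Mapping.map_key space_index \<gamma>)\<bar> else 0)"

end

theory Submission
  imports Defs
begin

text \<open>
  Give the time variable the weight \<open>1 / \<epsilon>\<close> and the variable \<open>x\<^sub>i\<close> a weight \<open>a\<^sub>i\<close> that dominates the
  inverse radii of convergence, with \<open>a \<in> \<ell>\<^sup>p\<close>; write \<open>\<kappa>\<close> for these weights. The norm
  \<open>\<Sum>\<^sub>\<alpha> |c\<^sub>\<alpha>| (\<alpha>! / |\<alpha>|!) r\<^sup>|\<^sup>\<alpha>\<^sup>| \<kappa>\<^sup>-\<^sup>\<alpha>\<close> of a monomial series is submultiplicative, and it bounds the
  series where \<open>\<Sum> \<kappa>\<^sub>v |y\<^sub>v| \<le> r\<close>, which by Hoelder's inequality contains a ball of \<open>\<ell>\<^sup>q\<close>. The factor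
  \<open>\<alpha>! / |\<alpha>|!\<close> makes \<open>\<partial>\<^sub>x\<^sup>\<beta> \<partial>\<^sub>t\<^sup>j\<close> composed with the \<open>m\<close>-fold time integral an operator of norm \<open>O(\<epsilon>)\<close>,
  uniformly in \<open>|\<beta>| + j \<le> m\<close>, \<open>j < m\<close>. So for small \<open>r\<close> and \<open>\<epsilon>\<close> the map that sends \<open>w = \<partial>\<^sub>t\<^sup>m u\<close> to the
  right-hand side maps a ball to itself, and its iterates become stationary in each order of \<open>t\<close>.

  Two series that agree up to order \<open>t\<^sup>n\<close> have jets, and hence right-hand sides, that agree up to order
  \<open>t\<^sup>n\<^sup>-\<^sup>m\<^sup>+\<^sup>1\<close>, uniformly in all jet coordinates. This gives both the convergence of the iterates and
  the uniqueness. The Taylor remainders of a monomial are bounded by the same monomial at a larger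
  point, so absolute convergence on a ball implies continuous differentiability there.
\<close>


section \<open>Multi-indices\<close>

text \<open>Bounding derivatives by Cauchy's inequalities would cost radius in every iteration step.
  Dividing by |\<alpha>|! avoids this: the estimate then depends on the total degree, which the
  \<open>m\<close>-fold integral raises by \<open>m\<close> and
  \<open>\<partial>_x^\<beta> \<partial>_t^j\<close> lowers by at most \<open>m\<close>, so one norm
  serves before and after. As \<open>j < m\<close>, at least one integration in \<open>t\<close> is
  left over, and its weight is the factor \<epsilon>. The Cauchy data give no such factor; they are
  small because the constant terms of their jets, which form the initial jet, are subtracted, and
  what remains has degree at least 1 and carries a factor \<open>r\<close>. The right-hand side
  depends on infinitely many jet variables, so one threshold has to serve all of them: p-summability
  of the inverse radii bounds every radius from below by a common \<mu>, and the unknown and its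
  derivatives, less their values at the origin, are kept below \<mu> / 2. Half of the polydisc is
  left free for a Lipschitz estimate. The norm supplies boundedness only; convergence and uniqueness
  come from counting orders in \<open>t\<close>, one being gained in each step.\<close>

abbreviation unit_index :: "'i \<Rightarrow> 'i \<Rightarrow>\<^sub>0 nat" where
  "unit_index i \<equiv> Poly_Mapping.single i 1"

definition mfact :: "('i \<Rightarrow>\<^sub>0 nat) \<Rightarrow> real" where
  "mfact \<alpha> = (\<Prod>i\<in>Poly_Mapping.keys \<alpha>. fact (Poly_Mapping.lookup \<alpha> i))"

text \<open>Induction on the degree. Adding one factor at a time replaces an enumeration of the
  coordinates; most identities and estimates for monomials are proved this way.\<close>

lemma multi_index_induct [case_names zero add]:
  fixes \<alpha> :: "'i \<Rightarrow>\<^sub>0 nat"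
  assumes zero: "P 0" and add: "\<And>\<alpha> i. P \<alpha> \<Longrightarrow> P (\<alpha> + unit_index i)"
  shows "P \<alpha>"
proof (induction "mdeg \<alpha>" arbitrary: \<alpha>)
  case 0
  have "Poly_Mapping.lookup \<alpha> i = 0" for i
    using 0 by (cases "i \<in> Poly_Mapping.keys \<alpha>") (auto simp: mdeg_def in_keys_iff)
  then have "\<alpha> = 0" by (intro poly_mapping_eqI) auto
  then show ?case using zero by simp
next
  case (Suc n)
  then have "\<exists>i. i \<in> Poly_Mapping.keys \<alpha>"
    by (metis Zero_not_Suc ex_in_conv mdeg_def sum.empty)
  then obtain i where i: "i \<in> Poly_Mapping.keys \<alpha>" by auto
  define \<beta> where "\<beta> = \<alpha> - unit_index i"
  have \<alpha>: "\<alpha> = \<beta> + unit_index i"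
    using i by (intro poly_mapping_eqI)
      (auto simp: \<beta>_def lookup_add lookup_minus lookup_single when_def in_keys_iff)
  have l: "Poly_Mapping.lookup \<alpha> j = Poly_Mapping.lookup \<beta> j + (if j = i then 1 else 0)" for j
    by (auto simp: \<alpha> lookup_add lookup_single when_def)
  have fin: "finite (Poly_Mapping.keys \<alpha>)" by simp
  have "mdeg \<beta> = (\<Sum>j\<in>Poly_Mapping.keys \<alpha>. Poly_Mapping.lookup \<beta> j)"
    unfolding mdeg_def
    by (rule sum.mono_neutral_left) (auto simp: in_keys_iff l split: if_splits)
  moreover have "mdeg \<alpha> = (\<Sum>j\<in>Poly_Mapping.keys \<alpha>. Poly_Mapping.lookup \<beta> j) + 1"
    unfolding mdeg_def l by (subst sum.distrib) (use i in auto)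
  ultimately have "n = mdeg \<beta>" using Suc by simp
  then show ?case using Suc add \<alpha> by metis
qed

lemma mdeg_superset:
  "finite S \<Longrightarrow> Poly_Mapping.keys \<alpha> \<subseteq> S \<Longrightarrow> mdeg \<alpha> = (\<Sum>i\<in>S. Poly_Mapping.lookup \<alpha> i)"
  unfolding mdeg_def by (rule sum.mono_neutral_left) (auto simp: in_keys_iff)

lemma mpow_superset:
  "finite S \<Longrightarrow> Poly_Mapping.keys \<alpha> \<subseteq> S \<Longrightarrow> mpow x \<alpha> = (\<Prod>i\<in>S. x i ^ Poly_Mapping.lookup \<alpha> i)"
  unfolding mpow_def by (rule prod.mono_neutral_left) (auto simp: in_keys_iff)

lemma mfact_superset:
  "finite S \<Longrightarrow> Poly_Mapping.keys \<alpha> \<subseteq> S \<Longrightarrow> mfact \<alpha> = (\<Prod>i\<in>S. fact (Poly_Mapping.lookup \<alpha> i))"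
  unfolding mfact_def by (rule prod.mono_neutral_left) (auto simp: in_keys_iff)

lemma keys_add_nat:
  fixes \<alpha> \<beta> :: "'i \<Rightarrow>\<^sub>0 nat"
  shows "Poly_Mapping.keys (\<alpha> + \<beta>) = Poly_Mapping.keys \<alpha> \<union> Poly_Mapping.keys \<beta>"
proof (rule set_eqI)
  fix i
  have "Poly_Mapping.lookup (\<alpha> + \<beta>) i = 0 \<longleftrightarrow>
      Poly_Mapping.lookup \<alpha> i = 0 \<and> Poly_Mapping.lookup \<beta> i = 0"
    by (simp add: lookup_add)
  then show "i \<in> Poly_Mapping.keys (\<alpha> + \<beta>)
      \<longleftrightarrow> i \<in> Poly_Mapping.keys \<alpha> \<union> Poly_Mapping.keys \<beta>"
    by (simp add: in_keys_iff)
qed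

lemma mdeg_zero [simp]: "mdeg 0 = 0" by (simp add: mdeg_def)
lemma mpow_zero [simp]: "mpow x 0 = 1" by (simp add: mpow_def)
lemma mfact_zero [simp]: "mfact 0 = 1" by (simp add: mfact_def)

lemma mdeg_add: "mdeg (\<alpha> + \<beta>) = mdeg \<alpha> + mdeg \<beta>"
proof -
  let ?S = "Poly_Mapping.keys \<alpha> \<union> Poly_Mapping.keys \<beta>"
  have "mdeg (\<alpha> + \<beta>) = (\<Sum>i\<in>?S. Poly_Mapping.lookup (\<alpha> + \<beta>) i)"
    by (rule mdeg_superset) (auto simp: keys_add_nat)
  also have "\<dots> = (\<Sum>i\<in>?S. Poly_Mapping.lookup \<alpha> i) + (\<Sum>i\<in>?S. Poly_Mapping.lookup \<beta> i)"
    by (simp add: lookup_add sum.distrib)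
  also have "\<dots> = mdeg \<alpha> + mdeg \<beta>"
    by (subst (1 2) mdeg_superset[where S="?S"]) auto
  finally show ?thesis .
qed

lemma mpow_add: "mpow x (\<alpha> + \<beta>) = mpow x \<alpha> * mpow x \<beta>"
proof -
  let ?S = "Poly_Mapping.keys \<alpha> \<union> Poly_Mapping.keys \<beta>"
  have "mpow x (\<alpha> + \<beta>) = (\<Prod>i\<in>?S. x i ^ Poly_Mapping.lookup (\<alpha> + \<beta>) i)"
    by (rule mpow_superset) (auto simp: keys_add_nat)
  also have "\<dots> = (\<Prod>i\<in>?S. x i ^ Poly_Mapping.lookup \<alpha> i) * (\<Prod>i\<in>?S. x i ^ Poly_Mapping.lookup \<beta> i)"
    by (simp add: lookup_add power_add prod.distrib)
  also have "\<dots> = mpow x \<alpha> * mpow x \<beta>"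
    by (subst (1 2) mpow_superset[where S="?S"]) auto
  finally show ?thesis .
qed

lemma mdeg_single [simp]: "mdeg (Poly_Mapping.single i n) = n"
  by (cases "n = 0") (auto simp: mdeg_def)

lemma mpow_single [simp]: "mpow x (Poly_Mapping.single i n) = x i ^ n"
  by (cases "n = 0") (auto simp: mpow_def)

lemma mfact_single [simp]: "mfact (Poly_Mapping.single i n) = fact n"
  by (cases "n = 0") (auto simp: mfact_def)

lemma mfact_pos [simp]: "0 < mfact \<alpha>"
  by (auto simp: mfact_def intro: prod_pos)

lemma mfact_nonneg [simp]: "0 \<le> mfact \<alpha>"
  using mfact_pos[of \<alpha>] by linarith

lemma mfact_nonzero [simp]: "mfact \<alpha> \<noteq> 0"
  using mfact_pos[of \<alpha>] by linarith

lemma mfact_add_unit: "mfact (\<alpha> + unit_index i) = (real (Poly_Mapping.lookup \<alpha> i) + 1) * mfact \<alpha>"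
proof -
  let ?S = "insert i (Poly_Mapping.keys \<alpha>)" and ?T = "Poly_Mapping.keys \<alpha> - {i}"
  have eq: "mfact \<beta> = fact (Poly_Mapping.lookup \<beta> i) * (\<Prod>j\<in>?T. fact (Poly_Mapping.lookup \<beta> j))"
    if "Poly_Mapping.keys \<beta> \<subseteq> ?S" for \<beta>
    using that by (subst mfact_superset[where S="?S"]) (auto simp: prod.insert_remove)
  have "(\<Prod>j\<in>?T. fact (Poly_Mapping.lookup (\<alpha> + unit_index i) j))
      = (\<Prod>j\<in>?T. fact (Poly_Mapping.lookup \<alpha> j) :: real)"
    by (rule prod.cong) (auto simp: lookup_add lookup_single when_def)
  then show ?thesis
    using eq[OF subset_insertI] eq[of "\<alpha> + unit_index i"]
    by (simp add: keys_add_nat lookup_add insert_commute subset_insertI algebra_simps)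
qed

lemma mdeg_eq_0_iff: "mdeg \<alpha> = 0 \<longleftrightarrow> \<alpha> = 0"
proof
  assume "mdeg \<alpha> = 0"
  then have "Poly_Mapping.lookup \<alpha> i = 0" for i
    by (cases "i \<in> Poly_Mapping.keys \<alpha>") (auto simp: mdeg_def in_keys_iff)
  then show "\<alpha> = 0" by (intro poly_mapping_eqI) simp
qed simp

lemma keys_eq_empty_nat: "Poly_Mapping.keys (\<alpha> :: 'i \<Rightarrow>\<^sub>0 nat) = {} \<longleftrightarrow> \<alpha> = 0"
  by (metis mdeg_eq_0_iff mdeg_def sum.empty keys_zero)

lemma mpow_at_zero: "mpow (\<lambda>_. 0) \<alpha> = (if \<alpha> = 0 then 1 else 0)"
proof (cases "\<alpha> = 0")
  case False
  then obtain i where i: "i \<in> Poly_Mapping.keys \<alpha>"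
    by (metis all_not_in_conv keys_eq_empty_nat)
  then have "\<exists>i\<in>Poly_Mapping.keys \<alpha>. (0::real) ^ Poly_Mapping.lookup \<alpha> i = 0"
    by (intro bexI[of _ i]) (auto simp: in_keys_iff power_0_left)
  then show ?thesis using False unfolding mpow_def by (simp add: prod_zero)
qed simp

lemma abs_mpow: "\<bar>mpow x \<alpha>\<bar> = mpow (\<lambda>i. \<bar>x i\<bar>) \<alpha>"
  by (simp add: mpow_def abs_prod power_abs)

lemma mpow_nonneg: "(\<And>i. 0 \<le> x i) \<Longrightarrow> 0 \<le> mpow x \<alpha>"
  by (auto simp: mpow_def intro!: prod_nonneg)

lemma mpow_pos: "(\<And>i. 0 < x i) \<Longrightarrow> 0 < mpow x \<alpha>"
  by (auto simp: mpow_def intro!: prod_pos)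

lemma mpow_mono: "(\<And>i. 0 \<le> x i) \<Longrightarrow> (\<And>i. x i \<le> y i) \<Longrightarrow> mpow x \<alpha> \<le> mpow y \<alpha>"
  by (auto simp: mpow_def intro!: prod_mono power_mono)

lemma mpow_mono_on:
  "(\<And>i. i \<in> Poly_Mapping.keys \<alpha> \<Longrightarrow> 0 \<le> x i \<and> x i \<le> y i) \<Longrightarrow> mpow x \<alpha> \<le> mpow y \<alpha>"
  by (auto simp: mpow_def intro!: prod_mono power_mono)

lemma mpow_cong: "(\<And>i. i \<in> Poly_Mapping.keys \<alpha> \<Longrightarrow> x i = y i) \<Longrightarrow> mpow x \<alpha> = mpow y \<alpha>"
  by (auto simp: mpow_def intro!: prod.cong)

lemma mpow_mult: "mpow (\<lambda>i. x i * y i) \<alpha> = mpow x \<alpha> * mpow y \<alpha>"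
  by (simp add: mpow_def power_mult_distrib prod.distrib)

lemma mpow_const: "mpow (\<lambda>_. s) \<alpha> = s ^ mdeg \<alpha>"
  by (simp add: mpow_def mdeg_def power_sum)

lemma mpow_scale: "mpow (\<lambda>i. s * x i) \<alpha> = s ^ mdeg \<alpha> * mpow x \<alpha>"
  using mpow_mult[of "\<lambda>_. s" x \<alpha>] by (simp add: mpow_const)

lemma mpow_inverse: "mpow (\<lambda>i. inverse (x i)) \<alpha> = inverse (mpow x \<alpha>)"
  using prod_inversef[of "\<lambda>i. x i ^ Poly_Mapping.lookup \<alpha> i" "Poly_Mapping.keys \<alpha>"]
  by (simp add: mpow_def o_def power_inverse)

section \<open>Binomial and multinomial inequalities\<close>

lemma binomial_mult_le: "(a choose c) * (b choose d) \<le> (a + b) choose (c + d)"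
proof -
  have "(a choose c) * (b choose (c + d - c)) \<le> (\<Sum>k\<le>c + d. (a choose k) * (b choose (c + d - k)))"
    by (rule member_le_sum) auto
  then show ?thesis by (simp add: vandermonde)
qed

lemma prod_binomial_le:
  fixes f g :: "'i \<Rightarrow> nat"
  assumes "finite S"
  shows "(\<Prod>i\<in>S. (f i + g i) choose f i) \<le> (sum f S + sum g S) choose sum f S"
  using assms
proof induction
  case (insert x S)
  have "(\<Prod>i\<in>insert x S. (f i + g i) choose f i)
      \<le> ((f x + g x) choose f x) * ((sum f S + sum g S) choose sum f S)"
    using insert by simp
  also have "\<dots> \<le> ((f x + g x) + (sum f S + sum g S)) choose (f x + sum f S)"
    by (rule binomial_mult_le)
  finally show ?case using insert by (simp add: algebra_simps)
qed simp

text \<open>The number of words with letter counts \<open>\<alpha>\<close> is supermultiplicative in \<open>\<alpha>\<close>.\<close>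
lemma mfact_add_le:
  "mfact (\<alpha> + \<beta>) * fact (mdeg \<alpha>) * fact (mdeg \<beta>) \<le> mfact \<alpha> * mfact \<beta> * fact (mdeg (\<alpha> + \<beta>))"
proof -
  let ?S = "Poly_Mapping.keys \<alpha> \<union> Poly_Mapping.keys \<beta>"
  let ?a = "Poly_Mapping.lookup \<alpha>" and ?b = "Poly_Mapping.lookup \<beta>"
  have bin: "real ((m + n) choose m) = fact (m + n) / (fact m * fact n)" for m n
    by (simp add: binomial_fact)
  \<comment> \<open>The quotient of factorials is a product of binomial coefficients, one for each
    coordinate; choosing separately in each coordinate is a special way of choosing from the
    total.\<close>
  have "mfact (\<alpha> + \<beta>) / (mfact \<alpha> * mfact \<beta>) = (\<Prod>i\<in>?S. real ((?a i + ?b i) choose ?a i))"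
    by (subst (1 2 3) mfact_superset[where S="?S"])
      (auto simp: keys_add_nat bin lookup_add prod_dividef prod.distrib)
  also have "\<dots> \<le> real ((sum ?a ?S + sum ?b ?S) choose sum ?a ?S)"
    unfolding of_nat_prod[symmetric] of_nat_le_iff by (rule prod_binomial_le) simp
  also have "\<dots> = fact (mdeg (\<alpha> + \<beta>)) / (fact (mdeg \<alpha>) * fact (mdeg \<beta>))"
    unfolding bin mdeg_add by (subst (1 2 3 4) mdeg_superset[where S="?S"]) auto
  finally show ?thesis by (simp add: field_simps)
qed

text \<open>A single term of the binomial expansion of \<open>(s + t) ^ (a + b)\<close>, divided by
  \<open>fact (a + b)\<close>.\<close>

lemma power_fact_mult_le:
  fixes s t :: real
  assumes "0 \<le> s" "0 \<le> t"
  shows "s ^ a / fact a * (t ^ b / fact b) \<le> (s + t) ^ (a + b) / fact (a + b)"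
proof -
  have "real ((a + b) choose a) * s ^ a * t ^ (a + b - a)
      \<le> (\<Sum>k\<le>a + b. real ((a + b) choose k) * s ^ k * t ^ (a + b - k))"
    by (rule member_le_sum) (use assms in auto)
  also have "\<dots> = (s + t) ^ (a + b)" by (simp add: binomial_ring)
  finally show ?thesis by (simp add: binomial_fact field_simps)
qed

text \<open>One term of the multinomial theorem.\<close>
lemma mpow_fact_le:
  assumes t: "\<And>i. 0 \<le> t i" and s: "\<And>S. finite S \<Longrightarrow> sum t S \<le> s"
  shows "fact (mdeg \<alpha>) * mpow t \<alpha> \<le> mfact \<alpha> * s ^ mdeg \<alpha>"
proof -
  let ?a = "Poly_Mapping.lookup \<alpha>"
  have *: "(\<Prod>i\<in>S. t i ^ ?a i / fact (?a i)) \<le> sum t S ^ sum ?a S / fact (sum ?a S)"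
    if "finite S" for S
    using that
  proof induction
    case (insert x S)
    have "(\<Prod>i\<in>insert x S. t i ^ ?a i / fact (?a i))
        \<le> t x ^ ?a x / fact (?a x) * (sum t S ^ sum ?a S / fact (sum ?a S))"
      unfolding prod.insert[OF insert.hyps]
      by (rule mult_left_mono[OF insert.IH]) (simp add: t)
    also have "\<dots> \<le> (t x + sum t S) ^ (?a x + sum ?a S) / fact (?a x + sum ?a S)"
      by (rule power_fact_mult_le) (simp_all add: t sum_nonneg)
    finally show ?case
      unfolding sum.insert[OF insert.hyps] .
  qed simp
  have "mpow t \<alpha> / mfact \<alpha> = (\<Prod>i\<in>Poly_Mapping.keys \<alpha>. t i ^ ?a i / fact (?a i))"
    by (simp add: mpow_def mfact_def prod_dividef)
  also have "\<dots> \<le> sum t (Poly_Mapping.keys \<alpha>) ^ mdeg \<alpha> / fact (mdeg \<alpha>)"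
    unfolding mdeg_def by (rule *) simp
  also have "\<dots> \<le> s ^ mdeg \<alpha> / fact (mdeg \<alpha>)"
    using t s by (intro divide_right_mono power_mono) (auto intro: sum_nonneg)
  finally show ?thesis by (simp add: field_simps)
qed

text \<open>The quotient of the two sides is a multinomial coefficient, hence at least 1.\<close>

lemma mfact_le: "mfact \<alpha> \<le> fact (mdeg \<alpha>)"
proof -
  have *: "(\<Prod>i\<in>S. fact (f i)) \<le> (fact (sum f S) :: real)" if "finite S" for S and f :: "'a \<Rightarrow> nat"
    using that
  proof induction
    case (insert x S)
    have "(\<Prod>i\<in>insert x S. fact (f i)) \<le> (fact (f x) * fact (sum f S) :: real)"
      using insert by simp
    also have "\<dots> \<le> fact (f x + sum f S)"
    proof -
      have "fact (f x) * fact (sum f S) \<le> (fact (f x + sum f S) :: nat)"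
        by (intro dvd_imp_le fact_fact_dvd_fact) auto
      then show ?thesis by (metis (mono_tags) of_nat_fact of_nat_le_iff of_nat_mult)
    qed
    finally show ?case using insert by simp
  qed simp
  show ?thesis unfolding mfact_def mdeg_def by (rule *) simp
qed

section \<open>Bounded families of nonnegative numbers\<close>

text \<open>For nonnegative \<open>f\<close> this is summability together with
  \<open>infsum f A \<le> K\<close>. Finite partial sums let a bound pass through comparison and
  reindexing without a separate proof of summability.\<close>

definition sums_bounded :: "('a \<Rightarrow> real) \<Rightarrow> 'a set \<Rightarrow> real \<Rightarrow> bool" where
  "sums_bounded f A K \<longleftrightarrow> (\<forall>S\<subseteq>A. finite S \<longrightarrow> sum f S \<le> K)"

lemma sums_boundedI: "(\<And>S. S \<subseteq> A \<Longrightarrow> finite S \<Longrightarrow> sum f S \<le> K) \<Longrightarrow> sums_bounded f A K"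
  by (auto simp: sums_bounded_def)

lemma sums_boundedD: "sums_bounded f A K \<Longrightarrow> S \<subseteq> A \<Longrightarrow> finite S \<Longrightarrow> sum f S \<le> K"
  by (auto simp: sums_bounded_def)

lemma sums_bounded_nonneg: "sums_bounded f A K \<Longrightarrow> 0 \<le> K"
  using sums_boundedD[of f A K "{}"] by simp

lemma sums_bounded_mono: "sums_bounded f A K \<Longrightarrow> K \<le> L \<Longrightarrow> sums_bounded f A L"
  unfolding sums_bounded_def by (meson order_trans)

lemma sums_bounded_member: "sums_bounded f A K \<Longrightarrow> x \<in> A \<Longrightarrow> f x \<le> K"
  using sums_boundedD[of f A K "{x}"] by simp

lemma sums_bounded_summable:
  assumes "sums_bounded f A K" "\<And>x. x \<in> A \<Longrightarrow> 0 \<le> f x"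
  shows "f summable_on A"
proof (rule nonneg_bdd_above_summable_on)
  show "bdd_above (sum f ` {S. S \<subseteq> A \<and> finite S})"
    by (rule bdd_aboveI[where M=K]) (use assms in \<open>auto simp: sums_bounded_def\<close>)
qed (use assms in auto)

lemma sums_bounded_infsum:
  assumes "sums_bounded f A K" "\<And>x. x \<in> A \<Longrightarrow> 0 \<le> f x"
  shows "infsum f A \<le> K"
proof (rule infsum_le_finite_sums)
  show "f summable_on A" using assms by (rule sums_bounded_summable)
qed (use assms in \<open>auto simp: sums_bounded_def\<close>)

lemma summable_sums_bounded:
  fixes f :: "'a \<Rightarrow> real"
  assumes "f summable_on A" "\<And>x. x \<in> A \<Longrightarrow> 0 \<le> f x" "infsum f A \<le> K"
  shows "sums_bounded f A K"
proof (rule sums_boundedI)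
  fix S assume "S \<subseteq> A" "finite S"
  then have "sum f S \<le> infsum f A" using assms by (intro finite_sum_le_infsum) auto
  then show "sum f S \<le> K" using assms(3) by simp
qed

text \<open>Made for shifts of exponents: the terms of \<open>g\<close> are compared with those of
  \<open>f\<close> at shifted places, and each place of \<open>f\<close> is used once because the
  shift is injective where it matters.\<close>

lemma sums_bounded_comparison:
  assumes f: "sums_bounded f B K" and f0: "\<And>x. x \<in> B \<Longrightarrow> 0 \<le> f x"
    and inj: "inj_on \<pi> A'" and sub: "A' \<subseteq> A" and out: "\<And>x. x \<in> A - A' \<Longrightarrow> g x \<le> 0"
    and le: "\<And>x. x \<in> A' \<Longrightarrow> \<pi> x \<in> B \<and> g x \<le> L * f (\<pi> x)" and L: "0 \<le> L"
  shows "sums_bounded g A (L * K)"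
proof (rule sums_boundedI)
  fix S assume S: "S \<subseteq> A" "finite S"
  have "sum g S = sum g (S \<inter> A') + sum g (S - A')"
    using S by (metis sum.Int_Diff)
  also have "sum g (S - A') \<le> 0"
    using S out by (intro sum_nonpos) auto
  also have "sum g (S \<inter> A') \<le> (\<Sum>x\<in>S \<inter> A'. L * f (\<pi> x))"
    using le by (intro sum_mono) auto
  also have "\<dots> = L * sum f (\<pi> ` (S \<inter> A'))"
    using inj by (subst sum.reindex) (auto simp: sum_distrib_left inj_on_def)
  also have "\<dots> \<le> L * K"
    using L S le by (intro mult_left_mono sums_boundedD[OF f]) auto
  finally show "sum g S \<le> L * K" by simp
qed

lemma sums_bounded_le:
  assumes "sums_bounded f A K" "\<And>x. x \<in> A \<Longrightarrow> g x \<le> f x"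
  shows "sums_bounded g A K"
proof (rule sums_boundedI)
  fix S assume S: "S \<subseteq> A" "finite S"
  have "sum g S \<le> sum f S" using S assms(2) by (intro sum_mono) auto
  also have "\<dots> \<le> K" using assms(1) S by (rule sums_boundedD)
  finally show "sum g S \<le> K" .
qed

lemma sums_bounded_scale:
  assumes "sums_bounded f A K" "\<And>x. x \<in> A \<Longrightarrow> g x \<le> L * f x" "0 \<le> L"
  shows "sums_bounded g A (L * K)"
proof (rule sums_boundedI)
  fix S assume S: "S \<subseteq> A" "finite S"
  have "sum g S \<le> (\<Sum>x\<in>S. L * f x)" using S assms by (intro sum_mono) auto
  also have "\<dots> = L * sum f S" by (simp add: sum_distrib_left)
  also have "\<dots> \<le> L * K" using assms S by (intro mult_left_mono sums_boundedD) auto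
  finally show "sum g S \<le> L * K" .
qed

lemma sums_bounded_add:
  assumes "sums_bounded f A K" "sums_bounded g A L"
  shows "sums_bounded (\<lambda>x. f x + g x) A (K + L)"
proof (rule sums_boundedI)
  fix S assume S: "S \<subseteq> A" "finite S"
  then have "sum f S \<le> K" "sum g S \<le> L" using assms by (auto intro: sums_boundedD)
  then show "(\<Sum>x\<in>S. f x + g x) \<le> K + L" by (simp add: sum.distrib)
qed

lemma sums_bounded_abs_infsum:
  fixes f :: "'a \<Rightarrow> real"
  assumes "sums_bounded (\<lambda>x. \<bar>f x\<bar>) A K"
  shows "f summable_on A" "\<bar>infsum f A\<bar> \<le> K"
proof -
  have s: "(\<lambda>x. \<bar>f x\<bar>) summable_on A" using assms by (rule sums_bounded_summable) auto
  then show "f summable_on A"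
    using summable_on_iff_abs_summable_on_real[of f A] by simp
  have "\<bar>infsum f A\<bar> \<le> infsum (\<lambda>x. \<bar>f x\<bar>) A"
    using norm_infsum_bound[of f A] s by simp
  also have "\<dots> \<le> K" using assms by (rule sums_bounded_infsum) auto
  finally show "\<bar>infsum f A\<bar> \<le> K" .
qed


section \<open>The spaces \<open>\<ell>\<^sup>q\<close>\<close>

text \<open>For \<open>1 \<le> q\<close> and \<open>0 \<le> r\<close> this means membership in the
  space together with norm at most \<open>r\<close>. Only coordinates or finite sums occur, so it
  passes to smaller vectors and to pointwise limits.\<close>

definition lq_le :: "ennreal \<Rightarrow> ('i \<Rightarrow> real) \<Rightarrow> real \<Rightarrow> bool" where
  "lq_le q x r \<longleftrightarrow>
     (if q = \<infinity> then \<forall>i. \<bar>x i\<bar> \<le> r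
      else \<forall>S. finite S \<longrightarrow> (\<Sum>i\<in>S. \<bar>x i\<bar> powr enn2real q) \<le> r powr enn2real q)"

lemma enn2real_ge_1: "1 \<le> q \<Longrightarrow> q \<noteq> \<infinity> \<Longrightarrow> 1 \<le> enn2real q"
  by (metis enn2real_1 enn2real_mono ennreal_neq_top infinity_ennreal_def top.not_eq_extremum)

lemma lq_le_iff:
  assumes q: "1 \<le> q" and r: "0 \<le> r"
  shows "x \<in> lq_space q UNIV \<and> lq_norm q UNIV x \<le> r \<longleftrightarrow> lq_le q x r"
proof (cases "q = \<infinity>")
  case True
  show ?thesis
  proof
    assume "x \<in> lq_space q UNIV \<and> lq_norm q UNIV x \<le> r"
    then have b: "bdd_above (range (\<lambda>i. \<bar>x i\<bar>))" and n: "(SUP i. \<bar>x i\<bar>) \<le> r"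
      using True by (auto simp: lq_space_def lq_norm_def)
    have "\<bar>x i\<bar> \<le> r" for i
      using cSUP_upper[OF _ b, of i] n by simp
    then show "lq_le q x r" using True by (simp add: lq_le_def)
  next
    assume "lq_le q x r"
    then have le: "\<And>i. \<bar>x i\<bar> \<le> r" using True by (simp add: lq_le_def)
    then have "bdd_above (range (\<lambda>i. \<bar>x i\<bar>))" by (intro bdd_aboveI[where M=r]) auto
    moreover have "(SUP i. \<bar>x i\<bar>) \<le> r" using le by (intro cSUP_least) auto
    ultimately show "x \<in> lq_space q UNIV \<and> lq_norm q UNIV x \<le> r"
      using True by (simp add: lq_space_def lq_norm_def Rprod_def)
  qed
next
  case False
  define e where "e = enn2real q"
  have e: "1 \<le> e" unfolding e_def using q False by (rule enn2real_ge_1)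
  show ?thesis
  proof
    assume "x \<in> lq_space q UNIV \<and> lq_norm q UNIV x \<le> r"
    then have s: "(\<lambda>i. \<bar>x i\<bar> powr e) summable_on UNIV"
      and n: "(\<Sum>\<^sub>\<infinity>i. \<bar>x i\<bar> powr e) powr (1 / e) \<le> r"
      using False by (auto simp: lq_space_def lq_norm_def e_def)
    have nn: "0 \<le> (\<Sum>\<^sub>\<infinity>i. \<bar>x i\<bar> powr e)" by (rule infsum_nonneg) auto
    have "((\<Sum>\<^sub>\<infinity>i. \<bar>x i\<bar> powr e) powr (1 / e)) powr e \<le> r powr e"
      using n e by (intro powr_mono2) auto
    then have le: "(\<Sum>\<^sub>\<infinity>i. \<bar>x i\<bar> powr e) \<le> r powr e"
      using e nn by (simp add: powr_powr)
    have "sums_bounded (\<lambda>i. \<bar>x i\<bar> powr e) UNIV (r powr e)"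
      using s _ le by (rule summable_sums_bounded) auto
    then show "lq_le q x r"
      using False by (simp add: lq_le_def sums_bounded_def e_def)
  next
    assume "lq_le q x r"
    then have b: "sums_bounded (\<lambda>i. \<bar>x i\<bar> powr e) UNIV (r powr e)"
      using False by (simp add: lq_le_def sums_bounded_def e_def)
    have s: "(\<lambda>i. \<bar>x i\<bar> powr e) summable_on UNIV"
      using b by (rule sums_bounded_summable) auto
    have le: "(\<Sum>\<^sub>\<infinity>i. \<bar>x i\<bar> powr e) \<le> r powr e"
      using b by (rule sums_bounded_infsum) auto
    have nn: "0 \<le> (\<Sum>\<^sub>\<infinity>i. \<bar>x i\<bar> powr e)" by (rule infsum_nonneg) auto
    have "(\<Sum>\<^sub>\<infinity>i. \<bar>x i\<bar> powr e) powr (1 / e) \<le> (r powr e) powr (1 / e)"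
      using le nn e by (intro powr_mono2) auto
    also have "\<dots> = r" using e r by (simp add: powr_powr)
    finally show "x \<in> lq_space q UNIV \<and> lq_norm q UNIV x \<le> r"
      using False s by (simp add: lq_space_def lq_norm_def Rprod_def e_def)
  qed
qed

lemma lq_norm_nonneg:
  assumes "x \<in> lq_space q UNIV" shows "0 \<le> lq_norm q UNIV x"
proof (cases "q = \<infinity>")
  case True
  then have b: "bdd_above (range (\<lambda>i. \<bar>x i\<bar>))" using assms by (auto simp: lq_space_def)
  have "0 \<le> \<bar>x undefined\<bar>" by simp
  also have "\<dots> \<le> (SUP i. \<bar>x i\<bar>)" by (rule cSUP_upper[OF _ b]) simp
  finally show ?thesis using True by (simp add: lq_norm_def)
qed (simp add: lq_norm_def)

lemma lq_le_norm:
  assumes "1 \<le> q" "x \<in> lq_space q UNIV" shows "lq_le q x (lq_norm q UNIV x)"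
  using lq_le_iff[OF assms(1) lq_norm_nonneg[OF assms(2)], of x] assms(2) by simp

lemma lq_le_mono: 
  assumes "lq_le q x r" "r \<le> s" "0 \<le> r" shows "lq_le q x s"
proof (cases "q = \<infinity>")
  case False
  have "r powr enn2real q \<le> s powr enn2real q" using assms by (intro powr_mono2) auto
  then show ?thesis using assms(1) False by (auto simp: lq_le_def intro: order_trans)
next
  case True
  then show ?thesis using assms unfolding lq_le_def by (auto intro: order_trans)
qed

lemma lq_le_zero: "0 \<le> r \<Longrightarrow> lq_le q (\<lambda>_. 0) r"
  by (simp add: lq_le_def)

lemma lq_le_solid:
  assumes "lq_le q x r" "\<And>i. \<bar>y i\<bar> \<le> \<bar>x i\<bar>" shows "lq_le q y r"
proof (cases "q = \<infinity>")
  case True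
  then show ?thesis using assms by (auto simp: lq_le_def intro: order_trans)
next
  case False
  have "(\<Sum>i\<in>S. \<bar>y i\<bar> powr enn2real q) \<le> (\<Sum>i\<in>S. \<bar>x i\<bar> powr enn2real q)" for S
    using assms(2) by (intro sum_mono powr_mono2) auto
  then show ?thesis using assms(1) False by (auto simp: lq_le_def intro: order_trans)
qed

lemma lq_le_scale:
  assumes "lq_le q x r" "0 \<le> r" shows "lq_le q (\<lambda>i. a * x i) (\<bar>a\<bar> * r)"
  using assms
  by (auto simp: lq_le_def abs_mult powr_mult sum_distrib_left[symmetric] intro!: mult_left_mono)

text \<open>When an argument vanishes, the claim reduces to \<open>s powr e \<le> s\<close> on the
  unit interval; for positive arguments it is the convexity of the power function.\<close>

lemma convex_powr:
  fixes u v l e :: real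
  assumes e: "1 \<le> e" and u: "0 \<le> u" and v: "0 \<le> v" and l: "0 \<le> l" "l \<le> 1"
  shows "(l * u + (1 - l) * v) powr e \<le> l * u powr e + (1 - l) * v powr e"
proof -
  have small: "s powr e \<le> s" if "0 \<le> s" "s \<le> 1" for s :: real
    using powr_mono'[of 1 e s] that e by (cases "s = 0") auto
  consider "u = 0" | "v = 0" | "0 < u" "0 < v" using u v by linarith
  then show ?thesis
  proof cases
    case 1
    then show ?thesis
      using small[of "1 - l"] l v by (simp add: powr_mult mult_right_mono)
  next
    case 2
    then show ?thesis
      using small[of l] l u by (simp add: powr_mult mult_right_mono)
  next
    case 3
    then show ?thesis
      using powr_convex[OF e] l unfolding convex_on_def
      by (metis (no_types, lifting) add_diff_cancel_left' diff_add_cancel diff_ge_0_iff_ge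
          greaterThan_iff real_scaleR_def)
  qed
qed

text \<open>Minkowski's inequality. After division by \<open>r + s\<close>, the sum |x i| + |y i| is
  the convex combination of |x i| / r and |y i| / s with weights r / (r + s) and s / (r + s), to
  which convexity of the power function applies.\<close>

lemma lq_le_add_pos:
  assumes q: "1 \<le> q" and x: "lq_le q x r" and y: "lq_le q y s" and r: "0 < r" and s: "0 < s"
  shows "lq_le q (\<lambda>i. x i + y i) (r + s)"
proof (cases "q = \<infinity>")
  case True
  then show ?thesis using x y
    by (auto simp: lq_le_def) (meson abs_triangle_ineq add_mono order_trans)
next
  case False
  define e where "e = enn2real q"
  have e: "1 \<le> e" unfolding e_def using q False by (rule enn2real_ge_1)
  define l where "l = r / (r + s)"
  have l: "0 \<le> l" "l \<le> 1" "1 - l = s / (r + s)" using r s by (auto simp: l_def field_simps)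
  have pt: "\<bar>a + b\<bar> powr e \<le> (r + s) powr e * (l * (\<bar>a\<bar> powr e / r powr e) + (1 - l) * (\<bar>b\<bar> powr e / s powr e))"
    for a b :: real
  proof -
    have "\<bar>a + b\<bar> powr e \<le> (\<bar>a\<bar> + \<bar>b\<bar>) powr e" using e by (intro powr_mono2) auto
    also have "\<bar>a\<bar> + \<bar>b\<bar> = (r + s) * (l * (\<bar>a\<bar> / r) + (1 - l) * (\<bar>b\<bar> / s))"
    proof -
      have "(r + s) * l = r" "(r + s) * (1 - l) = s"
        unfolding l(3) using r s by (auto simp: l_def)
      then have "(r + s) * (l * (\<bar>a\<bar> / r) + (1 - l) * (\<bar>b\<bar> / s)) = r * (\<bar>a\<bar> / r) + s * (\<bar>b\<bar> / s)"
        by (metis distrib_left mult.assoc)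
      then show ?thesis using r s by simp
    qed
    also have "\<dots> powr e = (r + s) powr e * (l * (\<bar>a\<bar> / r) + (1 - l) * (\<bar>b\<bar> / s)) powr e"
      using r s l by (intro powr_mult)
    also have "\<dots> \<le> (r + s) powr e * (l * (\<bar>a\<bar> / r) powr e + (1 - l) * (\<bar>b\<bar> / s) powr e)"
      using r s l e by (intro mult_left_mono convex_powr) auto
    also have "\<dots> = (r + s) powr e * (l * (\<bar>a\<bar> powr e / r powr e) + (1 - l) * (\<bar>b\<bar> powr e / s powr e))"
      using r s by (simp add: powr_divide)
    finally show ?thesis .
  qed
  have "(\<Sum>i\<in>S. \<bar>x i + y i\<bar> powr e) \<le> (r + s) powr e" if S: "finite S" for S
  proof -
    have X: "(\<Sum>i\<in>S. \<bar>x i\<bar> powr e) / r powr e \<le> 1" and Y: "(\<Sum>i\<in>S. \<bar>y i\<bar> powr e) / s powr e \<le> 1"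
      using x y S False r s by (auto simp: lq_le_def e_def divide_le_eq)
    have "(\<Sum>i\<in>S. \<bar>x i + y i\<bar> powr e)
        \<le> (\<Sum>i\<in>S. (r + s) powr e * (l * (\<bar>x i\<bar> powr e / r powr e) + (1 - l) * (\<bar>y i\<bar> powr e / s powr e)))"
      by (intro sum_mono pt)
    also have "\<dots> = (r + s) powr e * (l * ((\<Sum>i\<in>S. \<bar>x i\<bar> powr e) / r powr e)
        + (1 - l) * ((\<Sum>i\<in>S. \<bar>y i\<bar> powr e) / s powr e))"
      by (simp only: sum_distrib_left sum.distrib sum_divide_distrib distrib_left)
    also have "\<dots> \<le> (r + s) powr e * (l * 1 + (1 - l) * 1)"
      using X Y l by (intro mult_left_mono add_mono) auto
    finally show ?thesis by simp
  qed
  then show ?thesis using False by (simp add: lq_le_def e_def)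
qed

lemma lq_memI: "1 \<le> q \<Longrightarrow> 0 \<le> r \<Longrightarrow> lq_le q x r \<Longrightarrow> x \<in> lq_space q UNIV"
  using lq_le_iff by blast

lemma lq_norm_leI: "1 \<le> q \<Longrightarrow> 0 \<le> r \<Longrightarrow> lq_le q x r \<Longrightarrow> lq_norm q UNIV x \<le> r"
  using lq_le_iff by blast

lemma lq_space_zero: "1 \<le> q \<Longrightarrow> (\<lambda>_. 0) \<in> lq_space q UNIV"
  using lq_memI[OF _ order_refl lq_le_zero[OF order_refl]] by blast

lemma lq_norm_zero: "1 \<le> q \<Longrightarrow> lq_norm q UNIV (\<lambda>_. 0) = 0"
  by (rule antisym[OF lq_norm_leI[OF _ order_refl lq_le_zero[OF order_refl]]
        lq_norm_nonneg[OF lq_space_zero]])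

lemma lq_add:
  assumes q: "1 \<le> q" and x: "x \<in> lq_space q UNIV" and y: "y \<in> lq_space q UNIV"
  shows "(\<lambda>i. x i + y i) \<in> lq_space q UNIV"
    and "lq_norm q UNIV (\<lambda>i. x i + y i) \<le> lq_norm q UNIV x + lq_norm q UNIV y"
proof -
  let ?r = "lq_norm q UNIV x" and ?s = "lq_norm q UNIV y"
  have nn: "0 \<le> ?r" "0 \<le> ?s" using x y by (auto intro: lq_norm_nonneg)
  \<comment> \<open>The norms may vanish, whereas \<open>lq_le_add_pos\<close> divides by its radii;
    both are enlarged by \<epsilon>, which then tends to 0.\<close>
  have *: "lq_le q (\<lambda>i. x i + y i) ((?r + \<epsilon>) + (?s + \<epsilon>))" if "0 < \<epsilon>" for \<epsilon>
    using that nn by (intro lq_le_add_pos q lq_le_mono[OF lq_le_norm[OF q x]]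
        lq_le_mono[OF lq_le_norm[OF q y]]) auto
  show "(\<lambda>i. x i + y i) \<in> lq_space q UNIV"
    using nn by (intro lq_memI[OF q _ *[of 1]]) auto
  show "lq_norm q UNIV (\<lambda>i. x i + y i) \<le> ?r + ?s"
  proof (rule field_le_epsilon)
    fix \<epsilon> :: real assume "0 < \<epsilon>"
    then show "lq_norm q UNIV (\<lambda>i. x i + y i) \<le> ?r + ?s + \<epsilon>"
      using lq_norm_leI[OF q _ *[of "\<epsilon> / 2"]] nn by simp
  qed
qed

lemma lq_scale:
  assumes q: "1 \<le> q" and x: "x \<in> lq_space q UNIV"
  shows "(\<lambda>i. a * x i) \<in> lq_space q UNIV"
    and "lq_norm q UNIV (\<lambda>i. a * x i) \<le> \<bar>a\<bar> * lq_norm q UNIV x"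
proof -
  have *: "lq_le q (\<lambda>i. a * x i) (\<bar>a\<bar> * lq_norm q UNIV x)"
    by (intro lq_le_scale lq_le_norm q x lq_norm_nonneg)
  show "(\<lambda>i. a * x i) \<in> lq_space q UNIV"
    "lq_norm q UNIV (\<lambda>i. a * x i) \<le> \<bar>a\<bar> * lq_norm q UNIV x"
    using lq_norm_nonneg[OF x] by (auto intro!: lq_memI[OF q _ *] lq_norm_leI[OF q _ *])
qed

lemma lq_solid:
  assumes q: "1 \<le> q" and x: "x \<in> lq_space q UNIV" and le: "\<And>i. \<bar>y i\<bar> \<le> \<bar>x i\<bar>"
  shows "y \<in> lq_space q UNIV" and "lq_norm q UNIV y \<le> lq_norm q UNIV x"
proof -
  have *: "lq_le q y (lq_norm q UNIV x)"
    by (rule lq_le_solid[OF lq_le_norm[OF q x] le])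
  show "y \<in> lq_space q UNIV" "lq_norm q UNIV y \<le> lq_norm q UNIV x"
    using lq_norm_nonneg[OF x] by (auto intro!: lq_memI[OF q _ *] lq_norm_leI[OF q _ *])
qed

lemma lq_diff:
  assumes q: "1 \<le> q" and x: "x \<in> lq_space q UNIV" and y: "y \<in> lq_space q UNIV"
  shows "(\<lambda>i. x i - y i) \<in> lq_space q UNIV"
  using lq_add(1)[OF q x lq_scale(1)[OF q y, of "-1"]] by simp

lemma lq_unit:
  assumes q: "1 \<le> q"
  shows "(\<lambda>j. if j = i then a else 0) \<in> lq_space q UNIV" (is "?x \<in> _")
    and "lq_norm q UNIV (\<lambda>j. if j = i then a else 0) \<le> \<bar>a\<bar>"
proof -
  have *: "lq_le q ?x \<bar>a\<bar>"
  proof (cases "q = \<infinity>")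
    case False
    have "(\<Sum>j\<in>S. \<bar>?x j\<bar> powr enn2real q) \<le> \<bar>a\<bar> powr enn2real q" if "finite S" for S
    proof -
      have "(\<Sum>j\<in>S. \<bar>?x j\<bar> powr enn2real q) = (\<Sum>j\<in>S. if j = i then \<bar>a\<bar> powr enn2real q else 0)"
        by (intro sum.cong) auto
      then show ?thesis using that by (simp add: sum.delta)
    qed
    then show ?thesis using False by (simp add: lq_le_def)
  qed (simp add: lq_le_def)
  show "?x \<in> lq_space q UNIV" "lq_norm q UNIV ?x \<le> \<bar>a\<bar>"
    by (auto intro!: lq_memI[OF q _ *] lq_norm_leI[OF q _ *])
qed

lemma lq_le_coord:
  assumes q: "1 \<le> q" and r: "0 \<le> r" and x: "lq_le q x r" shows "\<bar>x i\<bar> \<le> r"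
proof (cases "q = \<infinity>")
  case False
  define e where "e = enn2real q"
  have e: "1 \<le> e" unfolding e_def using q False by (rule enn2real_ge_1)
  have "\<bar>x i\<bar> powr e \<le> r powr e"
    using x False spec[of _ "{i}"] by (auto simp: lq_le_def e_def)
  then show ?thesis using powr_less_mono2[of e r "\<bar>x i\<bar>"] e r by fastforce
qed (use x in \<open>simp add: lq_le_def\<close>)

lemma lq_coord_le_norm:
  "1 \<le> q \<Longrightarrow> x \<in> lq_space q UNIV \<Longrightarrow> \<bar>x i\<bar> \<le> lq_norm q UNIV x"
  by (rule lq_le_coord[OF _ lq_norm_nonneg lq_le_norm])

text \<open>Lower semicontinuity of the norm under coordinatewise convergence: each coordinate or
  finite partial sum passes to the limit. This stands in for completeness of the space.\<close>

lemma lq_le_limit: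
  assumes q: "1 \<le> q" and lim: "\<And>i. (\<lambda>n. X n i) \<longlonglongrightarrow> x i" and le: "\<And>n. lq_le q (X n) r"
  shows "lq_le q x r"
proof (cases "q = \<infinity>")
  case True
  have "\<bar>x i\<bar> \<le> r" for i
    by (rule LIMSEQ_le_const2[OF tendsto_rabs[OF lim]])
      (use le True in \<open>auto simp: lq_le_def\<close>)
  then show ?thesis using True by (simp add: lq_le_def)
next
  case False
  have "(\<Sum>i\<in>S. \<bar>x i\<bar> powr enn2real q) \<le> r powr enn2real q" if S: "finite S" for S
  proof (rule LIMSEQ_le_const2)
    show "(\<lambda>n. \<Sum>i\<in>S. \<bar>X n i\<bar> powr enn2real q) \<longlonglongrightarrow> (\<Sum>i\<in>S. \<bar>x i\<bar> powr enn2real q)"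
    proof (intro tendsto_sum)
      fix i
      have "(\<lambda>n. \<bar>X n i\<bar>) \<longlonglongrightarrow> \<bar>x i\<bar>" by (rule tendsto_rabs[OF lim])
      then show "(\<lambda>n. \<bar>X n i\<bar> powr enn2real q) \<longlonglongrightarrow> \<bar>x i\<bar> powr enn2real q"
        using enn2real_ge_1[OF q False] by (intro tendsto_powr2) (auto intro!: always_eventually)
    qed
    show "\<exists>N. \<forall>n\<ge>N. (\<Sum>i\<in>S. \<bar>X n i\<bar> powr enn2real q) \<le> r powr enn2real q"
      using le False S by (auto simp: lq_le_def)
  qed
  then show ?thesis using False by (simp add: lq_le_def)
qed

text \<open>In \<open>ennreal\<close> one has \<open>1 / \<infinity> = 0\<close> and
  \<open>1 / 0 = \<infinity>\<close>, so the single equation includes the pair \<open>p = 1\<close>,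
  \<open>q = \<infinity>\<close> and rules out \<open>q = 0\<close>.\<close>

lemma conjugate_exponent:
  assumes p: "1 \<le> p" and conj: "1 / ennreal p + 1 / q = 1"
  shows "p = 1 \<and> q = \<infinity> \<or> q \<noteq> \<infinity> \<and> 1 < p \<and> 1 < enn2real q \<and> 1 / p + 1 / enn2real q = 1"
proof (cases q)
  case (real r)
  have inv: "1 / ennreal s = ennreal (1 / s)" if "0 < s" for s
    using divide_ennreal[of 1 s] that by simp
  have "r \<noteq> 0"
  proof
    assume "r = 0"
    then have "1 / q = \<infinity>" using real by simp
    then show False using conj by simp
  qed
  then have r: "0 < r" using real by simp
  have "ennreal (1 / p + 1 / r) = 1"
    using conj real r p by (simp add: inv ennreal_plus)
  then have sum: "1 / p + 1 / r = 1"
    by (rule ennreal_eq_1[THEN iffD1])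
  have "0 < 1 / p" "0 < 1 / r" using p r by auto
  then have "1 / r < 1" "1 / p < 1" using sum by linarith+
  then have "1 < r" "1 < p" using p r by (auto simp: divide_less_eq)
  then show ?thesis using sum real by simp
next
  case top
  then have "ennreal (1 / p) = 1"
    using conj p divide_ennreal[of 1 p] by simp
  then show ?thesis using top p by (simp add: ennreal_eq_1)
qed

lemma conjugate_ge_1:
  assumes "1 \<le> p" "1 / ennreal p + 1 / q = 1" shows "1 \<le> q"
proof (cases q)
  case (real r)
  then show ?thesis using conjugate_exponent[OF assms] by (simp add: ennreal_1[symmetric] del: ennreal_1)
qed simp

text \<open>Young's inequality for \<open>a\<close> and for \<open>x\<close> divided by its norm
  gives the constant \<open>A / p + 1 / e\<close>, at most \<open>A + 1\<close>. The constant later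
  determines only the radius of a ball. The cases where Young's inequality or the normalisation
  breaks down, \<open>q = \<infinity>\<close> and \<open>x\<close> of norm 0, are direct.\<close>

lemma lq_holder:
  fixes a :: "'i \<Rightarrow> real"
  assumes p: "1 \<le> p" and conj: "1 / ennreal p + 1 / q = 1"
    and a: "sums_bounded (\<lambda>i. \<bar>a i\<bar> powr p) UNIV A"
  shows "\<exists>K>0. \<forall>x\<in>lq_space q UNIV. sums_bounded (\<lambda>i. \<bar>a i\<bar> * \<bar>x i\<bar>) UNIV (K * lq_norm q UNIV x)"
proof (intro exI conjI ballI sums_boundedI)
  have A: "0 \<le> A" using a by (rule sums_bounded_nonneg)
  then show "0 < A + 1" by simp
  fix x :: "'i \<Rightarrow> real" and S :: "'i set"
  assume x: "x \<in> lq_space q UNIV" and S: "finite S"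
  define N where "N = lq_norm q UNIV x"
  have q: "1 \<le> q" using conjugate_ge_1[OF p conj] .
  have N: "0 \<le> N" unfolding N_def using x by (rule lq_norm_nonneg)
  have coord: "\<bar>x i\<bar> \<le> N" for i unfolding N_def using q x by (rule lq_coord_le_norm)
  have aS: "(\<Sum>i\<in>S. \<bar>a i\<bar> powr p) \<le> A" using sums_boundedD[OF a _ S] by simp
  show "(\<Sum>i\<in>S. \<bar>a i\<bar> * \<bar>x i\<bar>) \<le> (A + 1) * lq_norm q UNIV x"
    unfolding N_def[symmetric]
  proof (cases "N = 0 \<or> q = \<infinity>")
    case True
    then have "N = 0 \<or> p = 1" using conjugate_exponent[OF p conj] by auto
    then show "(\<Sum>i\<in>S. \<bar>a i\<bar> * \<bar>x i\<bar>) \<le> (A + 1) * N"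
    proof
      assume "N = 0"
      then show ?thesis using coord by simp
    next
      assume "p = 1"
      have "(\<Sum>i\<in>S. \<bar>a i\<bar> * \<bar>x i\<bar>) \<le> (\<Sum>i\<in>S. \<bar>a i\<bar> * N)"
        by (intro sum_mono mult_left_mono coord) auto
      also have "\<dots> = (\<Sum>i\<in>S. \<bar>a i\<bar>) * N" by (simp add: sum_distrib_right)
      also have "\<dots> \<le> (A + 1) * N"
        using aS \<open>p = 1\<close> N by (intro mult_right_mono) auto
      finally show ?thesis .
    qed
  next
    case False
    define e where "e = enn2real q"
    have e: "1 < p" "1 < e" "1 / p + 1 / e = 1"
      using conjugate_exponent[OF p conj] False by (auto simp: e_def)
    have N: "0 < N" using False N by simp
    have xS: "(\<Sum>i\<in>S. \<bar>x i\<bar> powr e) / N powr e \<le> 1"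
      using lq_le_norm[OF q x] S False N by (auto simp: lq_le_def e_def N_def divide_le_eq)
    have "(\<Sum>i\<in>S. \<bar>a i\<bar> * \<bar>x i\<bar>) = N * (\<Sum>i\<in>S. \<bar>a i\<bar> * (\<bar>x i\<bar> / N))"
      using N by (simp add: sum_distrib_left)
    also have "\<dots> \<le> N * (\<Sum>i\<in>S. \<bar>a i\<bar> powr p / p + (\<bar>x i\<bar> / N) powr e / e)"
      using N e by (intro mult_left_mono sum_mono Youngs_inequality) auto
    also have "\<dots> = N * ((\<Sum>i\<in>S. \<bar>a i\<bar> powr p) / p + (\<Sum>i\<in>S. \<bar>x i\<bar> powr e) / N powr e / e)"
      using N by (simp add: sum.distrib sum_divide_distrib powr_divide)
    also have "\<dots> \<le> N * (A / p + 1 / e)"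
      using N e aS xS by (intro mult_left_mono add_mono divide_right_mono) auto
    also have "\<dots> \<le> N * (A + 1)"
    proof (intro mult_left_mono add_mono)
      show "A / p \<le> A" using A e(1) by (simp add: divide_le_eq mult_le_cancel_left1)
    qed (use N e in \<open>auto simp: divide_le_eq\<close>)
    finally show "(\<Sum>i\<in>S. \<bar>a i\<bar> * \<bar>x i\<bar>) \<le> (A + 1) * N" by (simp add: mult.commute)
  qed
qed

subsection \<open>The topology\<close>

lemma lq_ball_iff: "x \<in> lq_ball q I R \<longleftrightarrow> x \<in> lq_space q I \<and> lq_norm q I x < R"
  by (simp add: lq_ball_def)

lemma lq_ball_mono: "R \<le> R' \<Longrightarrow> x \<in> lq_ball q I R \<Longrightarrow> x \<in> lq_ball q I R'"
  by (auto simp: lq_ball_def)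

lemma lq_ball_zero: "1 \<le> q \<Longrightarrow> 0 < R \<Longrightarrow> (\<lambda>_. 0) \<in> lq_ball q UNIV R"
  by (simp add: lq_ball_iff lq_space_zero lq_norm_zero)

lemma lq_ball_solid:
  "1 \<le> q \<Longrightarrow> x \<in> lq_ball q UNIV R \<Longrightarrow> (\<And>i. \<bar>y i\<bar> \<le> \<bar>x i\<bar>) \<Longrightarrow> y \<in> lq_ball q UNIV R"
  using lq_solid[of q x y] by (auto simp: lq_ball_iff)

lemma lq_ball_scale:
  assumes "1 \<le> q" "x \<in> lq_ball q UNIV R" "0 < a"
  shows "(\<lambda>i. a * x i) \<in> lq_ball q UNIV (a * R)"
  using lq_scale[of q x a] assms
  by (auto simp: lq_ball_iff) (meson le_less_trans mult_strict_left_mono)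

lemma lq_ball_upd:
  assumes q: "1 \<le> q" and x: "x \<in> lq_space q UNIV"
  shows "x(i := s) \<in> lq_space q UNIV"
    and "lq_norm q UNIV (x(i := s)) \<le> lq_norm q UNIV x + \<bar>s - x i\<bar>"
proof -
  have eq: "x(i := s) = (\<lambda>j. x j + (if j = i then s - x i else 0))" by auto
  show "x(i := s) \<in> lq_space q UNIV" "lq_norm q UNIV (x(i := s)) \<le> lq_norm q UNIV x + \<bar>s - x i\<bar>"
    unfolding eq using lq_add[OF q x lq_unit(1)[OF q, of i "s - x i"]] lq_unit(2)[OF q, of i "s - x i"]
    by auto
qed

lemma lq_ball_upd_eventually:
  assumes q: "1 \<le> q" and x: "x \<in> lq_ball q UNIV R"
  shows "\<forall>\<^sub>F s in nhds (x i). x(i := s) \<in> lq_ball q UNIV R"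
proof -
  have "\<forall>\<^sub>F s in nhds (x i). dist s (x i) < R - lq_norm q UNIV x"
    using x by (intro eventually_nhds_metric[THEN iffD2] exI[of _ "R - lq_norm q UNIV x"])
      (auto simp: lq_ball_iff)
  then show ?thesis
  proof eventually_elim
    case (elim s)
    then show ?case using lq_ball_upd[OF q, of x i s] x by (auto simp: lq_ball_iff dist_real_def)
  qed
qed

lemma openin_lq_ball:
  assumes "0 < R" shows "openin (lq_topology q UNIV) (lq_ball q UNIV R)"
proof -
  have "lq_ball q UNIV R = (\<lambda>h i. (0::real) + h i) ` lq_ball q UNIV R" by simp
  then have "lq_ball q UNIV R \<in> {(\<lambda>h i. x i + h i) ` lq_ball q UNIV r | x r. x \<in> Rprod UNIV \<and> r > 0}"
    using assms by (intro CollectI exI[of _ "\<lambda>_. 0"] exI[of _ R]) (auto simp: Rprod_def)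
  then show ?thesis
    unfolding lq_topology_def openin_topology_generated_by_iff by (rule generate_topology_on.Basis)
qed

text \<open>By induction over the generation of the topology; inside a generating ball the radius
  left around a point is \<open>r - lq_norm q UNIV h\<close>, by the triangle inequality.\<close>

lemma openin_lq_topology_ball:
  fixes W :: "('i \<Rightarrow> real) set"
  assumes q: "1 \<le> q" and W: "openin (lq_topology q UNIV) W" and y: "y \<in> W"
  shows "\<exists>r>0. \<forall>h\<in>lq_ball q UNIV r. (\<lambda>i. y i + h i) \<in> W"
proof -
  have "generate_topology_on {(\<lambda>h i. x i + h i) ` lq_ball q UNIV r | x r. x \<in> Rprod UNIV \<and> r > 0} W"
    using W by (simp add: lq_topology_def openin_topology_generated_by_iff)
  then show ?thesis using y
  proof (induction arbitrary: y)
    case (Int a b)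
    from Int.prems have "y \<in> a" "y \<in> b" by auto
    from Int.IH(1)[OF this(1)] Int.IH(2)[OF this(2)]
    obtain r s where r: "r > 0" "\<forall>h\<in>lq_ball q UNIV r. (\<lambda>i. y i + h i) \<in> a"
      and s: "s > 0" "\<forall>h\<in>lq_ball q UNIV s. (\<lambda>i. y i + h i) \<in> b" by blast
    have "(\<lambda>i. y i + h i) \<in> a \<inter> b" if "h \<in> lq_ball q UNIV (min r s)" for h
      using r(2) s(2) lq_ball_mono[OF _ that, of r] lq_ball_mono[OF _ that, of s] by simp
    then show ?case using r s by (intro exI[of _ "min r s"]) auto
  next
    case (UN K)
    from UN.prems obtain k where k: "k \<in> K" "y \<in> k" by auto
    from UN.IH[OF this] k(1) show ?case by blast
  next
    case (Basis s)
    then obtain x r h where s: "s = (\<lambda>h i. x i + h i) ` lq_ball q UNIV r"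
      and h: "h \<in> lq_ball q UNIV r" and yx: "y = (\<lambda>i. x i + h i)" by auto
    show ?case
    proof (intro exI[of _ "r - lq_norm q UNIV h"] conjI ballI)
      show "0 < r - lq_norm q UNIV h" using h by (simp add: lq_ball_iff)
      fix k :: "'i \<Rightarrow> real" assume k: "k \<in> lq_ball q UNIV (r - lq_norm q UNIV h)"
      have "(\<lambda>i. h i + k i) \<in> lq_ball q UNIV r"
        using lq_add[OF q, of h k] h k by (auto simp: lq_ball_iff)
      then show "(\<lambda>i. y i + k i) \<in> s"
        unfolding s by (rule rev_image_eqI) (simp add: yx add.assoc)
    qed
  qed auto
qed


section \<open>Monomials along a line\<close>

text \<open>The derivative of the monomial at \<open>y\<close> in direction \<open>h\<close>. Once
  the product rule \<open>dpow_add_unit\<close> is established, it is handled through this recursion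
  alone.\<close>

definition dpow :: "('i \<Rightarrow> real) \<Rightarrow> ('i \<Rightarrow> real) \<Rightarrow> ('i \<Rightarrow>\<^sub>0 nat) \<Rightarrow> real" where
  "dpow y h \<alpha> = deriv (\<lambda>\<tau>. mpow (\<lambda>i. y i + \<tau> * h i) \<alpha>) 0"

lemma mpow_line_differentiable: "(\<lambda>\<tau>. mpow (\<lambda>i. y i + \<tau> * h i) \<alpha>) field_differentiable at 0"
  by (induction \<alpha> rule: multi_index_induct) (auto simp: mpow_add intro!: derivative_intros)

lemma dpow_zero [simp]: "dpow y h 0 = 0"
  by (simp add: dpow_def)

lemma dpow_add_unit: "dpow y h (\<alpha> + unit_index i) = y i * dpow y h \<alpha> + h i * mpow y \<alpha>"
proof -
  have "((\<lambda>\<tau>. mpow (\<lambda>j. y j + \<tau> * h j) \<alpha>) has_field_derivative dpow y h \<alpha>) (at 0)"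
    unfolding dpow_def using mpow_line_differentiable field_differentiable_derivI by blast
  then have "((\<lambda>\<tau>. mpow (\<lambda>j. y j + \<tau> * h j) \<alpha> * (y i + \<tau> * h i)) has_field_derivative
      mpow y \<alpha> * h i + dpow y h \<alpha> * y i) (at 0)"
    by (auto intro!: derivative_eq_intros)
  then show ?thesis
    unfolding dpow_def[of y h "\<alpha> + unit_index i"] by (subst DERIV_imp_deriv) (auto simp: mpow_add algebra_simps)
qed

lemma dpow_add_dir: "dpow y (\<lambda>i. h i + k i) \<alpha> = dpow y h \<alpha> + dpow y k \<alpha>"
  by (induction \<alpha> rule: multi_index_induct) (auto simp: dpow_add_unit[unfolded One_nat_def] algebra_simps)

lemma dpow_scale_dir: "dpow y (\<lambda>i. a * h i) \<alpha> = a * dpow y h \<alpha>"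
  by (induction \<alpha> rule: multi_index_induct) (auto simp: dpow_add_unit[unfolded One_nat_def] algebra_simps)

lemma add_diff_unit:
  assumes "Poly_Mapping.lookup \<alpha> i > 0"
  shows "(\<alpha> - unit_index i) + unit_index i = (\<alpha> :: 'i \<Rightarrow>\<^sub>0 nat)"
  using assms by (intro poly_mapping_eqI) (auto simp: lookup_add lookup_minus lookup_single when_def)

text \<open>If the exponent of \<open>i\<close> is 0, the truncated subtraction does no harm because
  the factor in front vanishes.\<close>

lemma dpow_unit_dir:
  "dpow y (\<lambda>j. if j = i then 1 else 0) \<alpha> = real (Poly_Mapping.lookup \<alpha> i) * mpow y (\<alpha> - unit_index i)"
proof (induction \<alpha> rule: multi_index_induct)
  case (add \<alpha> j)
  let ?n = "Poly_Mapping.lookup \<alpha> i"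
  show ?case
  proof (cases "j = i")
    case True
    have "real ?n * (y i * mpow y (\<alpha> - unit_index i)) = real ?n * mpow y \<alpha>"
    proof (cases "?n = 0")
      case False
      then show ?thesis
        using mpow_add[of y "\<alpha> - unit_index i" "unit_index i"] add_diff_unit[of \<alpha> i]
        by (simp add: mult.commute)
    qed simp
    then show ?thesis using True by (simp only: dpow_add_unit add.IH)
        (simp add: lookup_add algebra_simps)
  next
    case False
    have "real ?n * (y j * mpow y (\<alpha> - unit_index i)) = real ?n * mpow y (\<alpha> + unit_index j - unit_index i)"
    proof (cases "?n = 0")
      case n: False
      have "\<alpha> + unit_index j - unit_index i = \<alpha> - unit_index i + unit_index j"
        using n False by (intro poly_mapping_eqI) (auto simp: lookup_add lookup_minus lookup_single when_def)
      then show ?thesis by (simp add: mpow_add mult.commute)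
    qed simp
    then show ?thesis using False by (simp only: dpow_add_unit add.IH)
        (simp add: lookup_add lookup_single when_def algebra_simps)
  qed
qed simp

text \<open>
  The remainder estimates hold with the majorant \<open>mpow Y \<alpha>\<close> for every \<open>\<alpha>\<close>, because they are
  preserved when a factor is added to the monomial.
\<close>

lemma mpow_diff_le:
  assumes h: "\<And>i. \<bar>z i - y i\<bar> \<le> s * H i" and Y: "\<And>i. \<bar>y i\<bar> + H i \<le> Y i"
    and s: "0 \<le> s" "s \<le> 1" and H: "\<And>i. 0 \<le> H i"
  shows "\<bar>mpow z \<alpha> - mpow y \<alpha>\<bar> \<le> s * mpow Y \<alpha>"
proof (induction \<alpha> rule: multi_index_induct)
  case (add \<alpha> i)
  have zY: "\<bar>z j\<bar> \<le> Y j" for j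
  proof -
    have "s * H j \<le> H j" using s H[of j] by (simp add: mult_left_le_one_le)
    then show ?thesis using h[of j] Y[of j] by linarith
  qed
  have Q: "\<bar>mpow z \<alpha>\<bar> \<le> mpow Y \<alpha>" unfolding abs_mpow by (rule mpow_mono) (use zY in auto)
  have "mpow z (\<alpha> + unit_index i) - mpow y (\<alpha> + unit_index i)
      = y i * (mpow z \<alpha> - mpow y \<alpha>) + (z i - y i) * mpow z \<alpha>"
    by (simp add: mpow_add algebra_simps)
  then have "\<bar>mpow z (\<alpha> + unit_index i) - mpow y (\<alpha> + unit_index i)\<bar>
      \<le> \<bar>y i\<bar> * \<bar>mpow z \<alpha> - mpow y \<alpha>\<bar> + \<bar>z i - y i\<bar> * \<bar>mpow z \<alpha>\<bar>"
    unfolding abs_mult[symmetric] by linarith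
  also have "\<dots> \<le> \<bar>y i\<bar> * (s * mpow Y \<alpha>) + (s * H i) * mpow Y \<alpha>"
    using add h[of i] Q s H[of i] by (intro add_mono mult_mono) auto
  also have "\<dots> = (\<bar>y i\<bar> + H i) * (s * mpow Y \<alpha>)" by (simp add: algebra_simps)
  also have "\<dots> \<le> Y i * (s * mpow Y \<alpha>)"
    using Y[of i] s Q by (intro mult_right_mono) auto
  finally show ?case by (simp add: mpow_add algebra_simps)
qed (use s in simp)

lemma dpow_le:
  assumes h: "\<And>i. \<bar>h i\<bar> \<le> \<sigma> * H i" and Y: "\<And>i. \<bar>y i\<bar> + H i \<le> Y i"
    and s: "0 \<le> \<sigma>" and H: "\<And>i. 0 \<le> H i"
  shows "\<bar>dpow y h \<alpha>\<bar> \<le> \<sigma> * mpow Y \<alpha>"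
proof (induction \<alpha> rule: multi_index_induct)
  case (add \<alpha> i)
  have "\<bar>y j\<bar> \<le> Y j" for j using Y[of j] H[of j] by linarith
  then have Q: "\<bar>mpow y \<alpha>\<bar> \<le> mpow Y \<alpha>" unfolding abs_mpow by (intro mpow_mono) auto
  have "\<bar>dpow y h (\<alpha> + unit_index i)\<bar> \<le> \<bar>y i\<bar> * \<bar>dpow y h \<alpha>\<bar> + \<bar>h i\<bar> * \<bar>mpow y \<alpha>\<bar>"
    unfolding dpow_add_unit abs_mult[symmetric] by (rule abs_triangle_ineq)
  also have "\<dots> \<le> \<bar>y i\<bar> * (\<sigma> * mpow Y \<alpha>) + (\<sigma> * H i) * mpow Y \<alpha>"
    using add h[of i] Q s H[of i] by (intro add_mono mult_mono) auto
  also have "\<dots> = (\<bar>y i\<bar> + H i) * (\<sigma> * mpow Y \<alpha>)" by (simp add: algebra_simps)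
  also have "\<dots> \<le> Y i * (\<sigma> * mpow Y \<alpha>)"
    using Y[of i] s Q by (intro mult_right_mono) auto
  finally show ?case by (simp add: mpow_add algebra_simps)
qed (use s in simp)

lemma mpow_taylor_le:
  assumes h: "\<And>i. \<bar>h i\<bar> \<le> s * H i" and Y: "\<And>i. \<bar>y i\<bar> + H i \<le> Y i"
    and s: "0 \<le> s" "s \<le> 1" and H: "\<And>i. 0 \<le> H i"
  shows "\<bar>mpow (\<lambda>i. y i + h i) \<alpha> - mpow y \<alpha> - dpow y h \<alpha>\<bar> \<le> s\<^sup>2 * mpow Y \<alpha>"
proof (induction \<alpha> rule: multi_index_induct)
  case (add \<alpha> i)
  let ?z = "\<lambda>i. y i + h i"
  have D: "\<bar>mpow ?z \<alpha> - mpow y \<alpha>\<bar> \<le> s * mpow Y \<alpha>"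
    using h by (intro mpow_diff_le[OF _ Y s H]) simp
  have Q: "0 \<le> mpow Y \<alpha>" by (rule mpow_nonneg) (use Y H in \<open>smt (verit)\<close>)
  have "mpow ?z (\<alpha> + unit_index i) - mpow y (\<alpha> + unit_index i) - dpow y h (\<alpha> + unit_index i)
      = y i * (mpow ?z \<alpha> - mpow y \<alpha> - dpow y h \<alpha>) + h i * (mpow ?z \<alpha> - mpow y \<alpha>)"
    unfolding dpow_add_unit by (simp add: mpow_add algebra_simps)
  then have "\<bar>mpow ?z (\<alpha> + unit_index i) - mpow y (\<alpha> + unit_index i) - dpow y h (\<alpha> + unit_index i)\<bar>
      \<le> \<bar>y i\<bar> * \<bar>mpow ?z \<alpha> - mpow y \<alpha> - dpow y h \<alpha>\<bar> + \<bar>h i\<bar> * \<bar>mpow ?z \<alpha> - mpow y \<alpha>\<bar>"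
    unfolding abs_mult[symmetric] by linarith
  \<comment> \<open>The second summand gains one \<open>s\<close> from \<open>h i\<close> and
    another from the first-order estimate \<open>D\<close>; so both are quadratic in
    \<open>s\<close>, and \<open>\<bar>y i\<bar> + H i \<le> Y i\<close> closes the
    induction.\<close>
  also have "\<dots> \<le> \<bar>y i\<bar> * (s\<^sup>2 * mpow Y \<alpha>) + (s * H i) * (s * mpow Y \<alpha>)"
    using add h[of i] D s H[of i] by (intro add_mono mult_mono) auto
  also have "\<dots> = (\<bar>y i\<bar> + H i) * (s\<^sup>2 * mpow Y \<alpha>)" by (simp add: algebra_simps power2_eq_square)
  also have "\<dots> \<le> Y i * (s\<^sup>2 * mpow Y \<alpha>)"
    using Y[of i] s Q by (intro mult_right_mono) auto
  finally show ?case by (simp add: mpow_add algebra_simps)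
qed simp

lemma dpow_diff_le:
  assumes z: "\<And>i. \<bar>z i - y i\<bar> \<le> s * K i" and h: "\<And>i. \<bar>h i\<bar> \<le> \<sigma> * H i"
    and Y: "\<And>i. \<bar>y i\<bar> + K i + H i \<le> Y i"
    and s: "0 \<le> s" "s \<le> 1" and \<sigma>: "0 \<le> \<sigma>" and K: "\<And>i. 0 \<le> K i" and H: "\<And>i. 0 \<le> H i"
  shows "\<bar>dpow z h \<alpha> - dpow y h \<alpha>\<bar> \<le> s * \<sigma> * mpow Y \<alpha>"
proof (induction \<alpha> rule: multi_index_induct)
  case (add \<alpha> i)
  have Y': "\<bar>y j\<bar> + K j \<le> Y j" for j using Y[of j] H[of j] by linarith
  have D: "\<bar>mpow z \<alpha> - mpow y \<alpha>\<bar> \<le> s * mpow Y \<alpha>" by (rule mpow_diff_le[OF z Y' s K])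
  have zY: "\<bar>z j\<bar> + H j \<le> Y j" for j
  proof -
    have "s * K j \<le> K j" using s K[of j] by (simp add: mult_left_le_one_le)
    then show ?thesis using z[of j] Y[of j] by linarith
  qed
  have E: "\<bar>dpow z h \<alpha>\<bar> \<le> \<sigma> * mpow Y \<alpha>" by (rule dpow_le[OF h zY \<sigma> H])
  have Q: "0 \<le> mpow Y \<alpha>" by (rule mpow_nonneg) (use Y H K in \<open>smt (verit)\<close>)
  have "dpow z h (\<alpha> + unit_index i) - dpow y h (\<alpha> + unit_index i)
      = y i * (dpow z h \<alpha> - dpow y h \<alpha>) + (z i - y i) * dpow z h \<alpha> + h i * (mpow z \<alpha> - mpow y \<alpha>)"
    unfolding dpow_add_unit by (simp add: algebra_simps)
  then have "\<bar>dpow z h (\<alpha> + unit_index i) - dpow y h (\<alpha> + unit_index i)\<bar>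
      \<le> \<bar>y i\<bar> * \<bar>dpow z h \<alpha> - dpow y h \<alpha>\<bar> + \<bar>z i - y i\<bar> * \<bar>dpow z h \<alpha>\<bar> + \<bar>h i\<bar> * \<bar>mpow z \<alpha> - mpow y \<alpha>\<bar>"
    unfolding abs_mult[symmetric] by linarith
  also have "\<dots> \<le> \<bar>y i\<bar> * (s * \<sigma> * mpow Y \<alpha>) + (s * K i) * (\<sigma> * mpow Y \<alpha>) + (\<sigma> * H i) * (s * mpow Y \<alpha>)"
    using add z[of i] h[of i] D E s \<sigma> H[of i] K[of i] by (intro add_mono mult_mono) auto
  also have "\<dots> = (\<bar>y i\<bar> + K i + H i) * (s * \<sigma> * mpow Y \<alpha>)" by (simp add: algebra_simps)
  also have "\<dots> \<le> Y i * (s * \<sigma> * mpow Y \<alpha>)"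
    using Y[of i] s \<sigma> Q by (intro mult_right_mono) auto
  finally show ?case by (simp add: mpow_add algebra_simps)
qed (use s \<sigma> in simp)

section \<open>Monomial series on balls of \<open>\<ell>\<^sup>q\<close>\<close>

abbreviation msum :: "(('i \<Rightarrow>\<^sub>0 nat) \<Rightarrow> real) \<Rightarrow> ('i \<Rightarrow> real) \<Rightarrow> real" where
  "msum \<equiv> monomial_sum UNIV"

lemma multi_indices_UNIV [simp]: "multi_indices UNIV = UNIV"
  by (simp add: multi_indices_def)

definition ball_bounded :: "ennreal \<Rightarrow> (('i \<Rightarrow>\<^sub>0 nat) \<Rightarrow> real) \<Rightarrow> real \<Rightarrow> real \<Rightarrow> bool" where
  "ball_bounded q c R K \<longleftrightarrow> (\<forall>y\<in>lq_ball q UNIV R. sums_bounded (\<lambda>\<alpha>. \<bar>c \<alpha> * mpow y \<alpha>\<bar>) UNIV K)"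

text \<open>Bounds are required on strictly smaller balls only, so that differentiation, which costs
  an arbitrarily small part of the radius, preserves the property with the same
  \<open>R\<close>.\<close>

definition ball_convergent :: "ennreal \<Rightarrow> (('i \<Rightarrow>\<^sub>0 nat) \<Rightarrow> real) \<Rightarrow> real \<Rightarrow> bool" where
  "ball_convergent q c R \<longleftrightarrow> (\<forall>R'<R. \<exists>K. ball_bounded q c R' K)"

lemma ball_boundedD: "ball_bounded q c R K \<Longrightarrow> y \<in> lq_ball q UNIV R \<Longrightarrow> sums_bounded (\<lambda>\<alpha>. \<bar>c \<alpha> * mpow y \<alpha>\<bar>) UNIV K"
  by (simp add: ball_bounded_def)

lemma ball_bounded_mono: "ball_bounded q c R K \<Longrightarrow> R' \<le> R \<Longrightarrow> ball_bounded q c R' K"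
  by (auto simp: ball_bounded_def intro: lq_ball_mono)

lemma ball_bounded_convergent: "ball_bounded q c R K \<Longrightarrow> ball_convergent q c R"
  by (auto simp: ball_convergent_def intro: ball_bounded_mono less_imp_le)

lemma ball_convergent_mono: "ball_convergent q c R \<Longrightarrow> R' \<le> R \<Longrightarrow> ball_convergent q c R'"
  by (auto simp: ball_convergent_def)

lemma ball_convergentE:
  assumes "ball_convergent q c R" "y \<in> lq_ball q UNIV R"
  obtains R' K where "R' < R" "y \<in> lq_ball q UNIV R'" "ball_bounded q c R' K"
proof -
  obtain R' where R': "lq_norm q UNIV y < R'" "R' < R"
    using assms(2) dense[of "lq_norm q UNIV y" R] by (auto simp: lq_ball_iff)
  then obtain K where "ball_bounded q c R' K" using assms(1) by (auto simp: ball_convergent_def)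
  then show ?thesis using that[OF R'(2)] R' assms(2) by (auto simp: lq_ball_iff)
qed

lemma ball_convergent_conv:
  assumes "ball_convergent q c R" "y \<in> lq_ball q UNIV R"
  shows "monomial_conv UNIV c y" and "(\<lambda>\<alpha>. c \<alpha> * mpow y \<alpha>) summable_on UNIV"
proof -
  obtain R' K where "y \<in> lq_ball q UNIV R'" "ball_bounded q c R' K"
    using assms by (rule ball_convergentE)
  then have b: "sums_bounded (\<lambda>\<alpha>. \<bar>c \<alpha> * mpow y \<alpha>\<bar>) UNIV K" by (rule ball_boundedD[rotated])
  then show "monomial_conv UNIV c y"
    unfolding monomial_conv_def multi_indices_UNIV by (rule sums_bounded_summable) auto
  show "(\<lambda>\<alpha>. c \<alpha> * mpow y \<alpha>) summable_on UNIV" using b by (rule sums_bounded_abs_infsum)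
qed

lemma ball_bounded_msum:
  assumes "ball_bounded q c R K" "y \<in> lq_ball q UNIV R"
  shows "\<bar>msum c y\<bar> \<le> K"
  using sums_bounded_abs_infsum(2)[OF ball_boundedD[OF assms]] by (simp add: monomial_sum_def)

lemma ball_bounded_le:
  assumes "ball_bounded q c R K" "\<And>\<alpha>. \<bar>c' \<alpha>\<bar> \<le> \<bar>c \<alpha>\<bar>" shows "ball_bounded q c' R K"
  unfolding ball_bounded_def
proof
  fix y :: "'a \<Rightarrow> real" assume "y \<in> lq_ball q UNIV R"
  then show "sums_bounded (\<lambda>\<alpha>. \<bar>c' \<alpha> * mpow y \<alpha>\<bar>) UNIV K"
    by (rule sums_bounded_le[OF ball_boundedD[OF assms(1)]])
      (use assms(2) in \<open>auto simp: abs_mult intro: mult_right_mono\<close>)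
qed

lemma ball_convergent_le:
  assumes "ball_convergent q c R" "\<And>\<alpha>. \<bar>c' \<alpha>\<bar> \<le> \<bar>c \<alpha>\<bar>" shows "ball_convergent q c' R"
  using assms ball_bounded_le unfolding ball_convergent_def by metis

lemma ball_bounded_diff:
  assumes "ball_bounded q c R K" "ball_bounded q d R L"
  shows "ball_bounded q (\<lambda>\<alpha>. c \<alpha> - d \<alpha>) R (K + L)"
  unfolding ball_bounded_def
proof
  fix y :: "'a \<Rightarrow> real" assume y: "y \<in> lq_ball q UNIV R"
  show "sums_bounded (\<lambda>\<alpha>. \<bar>(c \<alpha> - d \<alpha>) * mpow y \<alpha>\<bar>) UNIV (K + L)"
    by (rule sums_bounded_le[OF sums_bounded_add[OF ball_boundedD[OF assms(1) y] ball_boundedD[OF assms(2) y]]])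
      (simp add: left_diff_distrib abs_triangle_ineq4)
qed

lemma ball_convergent_diff:
  assumes "ball_convergent q c R" "ball_convergent q d R"
  shows "ball_convergent q (\<lambda>\<alpha>. c \<alpha> - d \<alpha>) R"
  using assms ball_bounded_diff unfolding ball_convergent_def by metis

lemma msum_diff:
  assumes "ball_convergent q c R" "ball_convergent q d R" "y \<in> lq_ball q UNIV R"
  shows "msum (\<lambda>\<alpha>. c \<alpha> - d \<alpha>) y = msum c y - msum d y"
  using infsum_add[OF ball_convergent_conv(2)[OF assms(1,3)]
      summable_on_uminus[THEN iffD2, OF ball_convergent_conv(2)[OF assms(2,3)]]]
  by (simp add: monomial_sum_def left_diff_distrib infsum_uminus)

lemma msum_at_zero: "msum c (\<lambda>_. 0) = c 0"
proof -
  have "msum c (\<lambda>_. 0) = (\<Sum>\<^sub>\<infinity>\<alpha>\<in>{0}. c \<alpha> * mpow (\<lambda>_. 0) \<alpha>)"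
    unfolding monomial_sum_def by (rule infsum_cong_neutral) (auto simp: mpow_at_zero)
  then show ?thesis by simp
qed

text \<open>Without a constant term every monomial has degree at least 1 and gains at least one
  factor \<open>l\<close> when its argument is scaled by \<open>l\<close>.\<close>

lemma ball_bounded_shrink:
  assumes q: "1 \<le> q" and c: "ball_bounded q c R K" and c0: "c 0 = 0" and l: "0 < l" "l \<le> 1"
  shows "ball_bounded q c (l * R) (l * K)"
  unfolding ball_bounded_def
proof
  fix y :: "'a \<Rightarrow> real" assume y: "y \<in> lq_ball q UNIV (l * R)"
  define z where "z = (\<lambda>i. (1 / l) * y i)"
  have z: "z \<in> lq_ball q UNIV R"
    unfolding z_def using lq_ball_scale[OF q y, of "1 / l"] l by simp
  have "\<bar>c \<alpha> * mpow y \<alpha>\<bar> \<le> l * \<bar>c \<alpha> * mpow z \<alpha>\<bar>" for \<alpha>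
  proof (cases "\<alpha> = 0")
    case False
    then have "0 < mdeg \<alpha>" using mdeg_eq_0_iff by auto
    then have "l ^ mdeg \<alpha> \<le> l ^ 1" using l by (intro power_decreasing) auto
    moreover have "mpow y \<alpha> = l ^ mdeg \<alpha> * mpow z \<alpha>"
      unfolding mpow_scale[symmetric] using l by (intro mpow_cong) (simp add: z_def)
    ultimately have "\<bar>mpow y \<alpha>\<bar> \<le> l * \<bar>mpow z \<alpha>\<bar>"
      using l by (simp add: abs_mult mult_right_mono)
    then show ?thesis using mult_left_mono[of _ _ "\<bar>c \<alpha>\<bar>"]
      by (fastforce simp: abs_mult mult.left_commute)
  qed (simp add: c0)
  then show "sums_bounded (\<lambda>\<alpha>. \<bar>c \<alpha> * mpow y \<alpha>\<bar>) UNIV (l * K)"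
    using l by (intro sums_bounded_scale[OF ball_boundedD[OF c z]]) auto
qed

text \<open>
  If the series were unbounded on every small ball, it would diverge at the sum of suitably chosen
  points of small norm, by monotonicity of the majorant.
\<close>
lemma convergent_imp_ball_bounded:
  fixes c :: "('i \<Rightarrow>\<^sub>0 nat) \<Rightarrow> real"
  assumes q: "1 \<le> q" and R: "0 < R" and conv: "\<And>y. y \<in> lq_ball q UNIV R \<Longrightarrow> monomial_conv UNIV c y"
  shows "\<exists>R'>0. \<exists>K. ball_bounded q c R' K"
proof (rule ccontr)
  assume *: "\<not> ?thesis"
  \<comment> \<open>These radii sum to \<open>R / 2\<close>, so the coordinatewise sum of the points
    chosen below still lies in the ball of radius \<open>R\<close>.\<close>
  define e where "e = (\<lambda>n::nat. R / 2 * (1 / 2) ^ Suc n)"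
  have e: "0 < e n" for n using R by (simp add: e_def)
  have "\<not> ball_bounded q c (e n) (real n)" for n using * e by blast
  then have "\<exists>y. y \<in> lq_ball q UNIV (e n) \<and> \<not> sums_bounded (\<lambda>\<alpha>. \<bar>c \<alpha> * mpow y \<alpha>\<bar>) UNIV (real n)" for n
    unfolding ball_bounded_def by blast
  then obtain Y where Y: "\<And>n. Y n \<in> lq_ball q UNIV (e n)"
    and un: "\<And>n. \<not> sums_bounded (\<lambda>\<alpha>. \<bar>c \<alpha> * mpow (Y n) \<alpha>\<bar>) UNIV (real n)" by metis
  have Yn: "\<bar>Y n i\<bar> \<le> e n" for n i
    using lq_coord_le_norm[OF q, of "Y n" i] Y[of n] by (auto simp: lq_ball_iff)
  have es: "e sums (R / 2)"
    using sums_mult[OF power_half_series, of "R / 2"] by (simp add: e_def)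
  have sm: "summable (\<lambda>n. \<bar>Y n i\<bar>)" for i
    by (rule summable_comparison_test'[OF sums_summable[OF es], where N=0]) (use Yn in auto)
  define y where "y = (\<lambda>i. suminf (\<lambda>n. \<bar>Y n i\<bar>))"
  have part: "lq_le q (\<lambda>i. \<Sum>k<n. \<bar>Y k i\<bar>) (sum e {..<n})" for n
  proof (induction n)
    case 0 show ?case by (simp add: lq_le_zero)
  next
    case (Suc n)
    have nn: "0 \<le> sum e {..<n}" using e by (intro sum_nonneg) (auto intro: less_imp_le)
    have Yab: "(\<lambda>i. \<bar>Y n i\<bar>) \<in> lq_space q UNIV" "lq_norm q UNIV (\<lambda>i. \<bar>Y n i\<bar>) \<le> e n"
      using lq_solid[OF q, of "Y n" "\<lambda>i. \<bar>Y n i\<bar>"] Y[of n] by (auto simp: lq_ball_iff)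
    have S: "(\<lambda>i. \<Sum>k<n. \<bar>Y k i\<bar>) \<in> lq_space q UNIV" "lq_norm q UNIV (\<lambda>i. \<Sum>k<n. \<bar>Y k i\<bar>) \<le> sum e {..<n}"
      using Suc lq_le_iff[OF q nn] by blast+
    have "(\<lambda>i. (\<Sum>k<n. \<bar>Y k i\<bar>) + \<bar>Y n i\<bar>) \<in> lq_space q UNIV
        \<and> lq_norm q UNIV (\<lambda>i. (\<Sum>k<n. \<bar>Y k i\<bar>) + \<bar>Y n i\<bar>) \<le> sum e {..<n} + e n"
      using lq_add[OF q S(1) Yab(1)] S(2) Yab(2) by auto
    moreover have "0 \<le> sum e {..<n} + e n" using nn e[of n] by simp
    ultimately have "lq_le q (\<lambda>i. (\<Sum>k<n. \<bar>Y k i\<bar>) + \<bar>Y n i\<bar>) (sum e {..<n} + e n)"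
      by (simp only: lq_le_iff[OF q])
    then show ?case by simp
  qed
  have part': "lq_le q (\<lambda>i. \<Sum>k<n. \<bar>Y k i\<bar>) (R / 2)" for n
  proof (rule lq_le_mono[OF part])
    show "sum e {..<n} \<le> R / 2"
      using sum_le_suminf[OF sums_summable[OF es], of "{..<n}"] e sums_unique[OF es]
      by (auto intro: less_imp_le)
    show "0 \<le> sum e {..<n}" using e by (intro sum_nonneg) (auto intro: less_imp_le)
  qed
  have "lq_le q y (R / 2)"
    by (rule lq_le_limit[OF q _ part']) (use summable_LIMSEQ[OF sm] in \<open>simp add: y_def\<close>)
  then have "y \<in> lq_space q UNIV" "lq_norm q UNIV y \<le> R / 2"
    using lq_memI[OF q, of "R / 2"] lq_norm_leI[OF q, of "R / 2"] R by auto
  then have "y \<in> lq_ball q UNIV R" using R by (simp add: lq_ball_iff)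
  then have s: "(\<lambda>\<alpha>. \<bar>c \<alpha> * mpow y \<alpha>\<bar>) summable_on UNIV"
    using conv by (simp add: monomial_conv_def)
  define K where "K = (\<Sum>\<^sub>\<infinity>\<alpha>. \<bar>c \<alpha> * mpow y \<alpha>\<bar>)"
  have yb: "sums_bounded (\<lambda>\<alpha>. \<bar>c \<alpha> * mpow y \<alpha>\<bar>) UNIV K"
    using s by (rule summable_sums_bounded) (auto simp: K_def)
  \<comment> \<open>Since \<open>y\<close> dominates every \<open>Y n\<close> coordinatewise,
    \<open>K\<close> bounds the series at \<open>Y n\<close> for all \<open>n\<close>; for large
    \<open>n\<close> this contradicts the choice of \<open>Y n\<close>.\<close>
  obtain n :: nat where n: "K \<le> real n" using real_arch_simple by blast
  have "\<bar>Y n i\<bar> \<le> y i" for i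
    unfolding y_def using sum_le_suminf[OF sm, of "{n}" i] by simp
  then have "mpow (\<lambda>i. \<bar>Y n i\<bar>) \<alpha> \<le> mpow (\<lambda>i. \<bar>y i\<bar>) \<alpha>" for \<alpha>
    by (intro mpow_mono) (auto intro: order_trans[OF _ abs_ge_self])
  then have "sums_bounded (\<lambda>\<alpha>. \<bar>c \<alpha> * mpow (Y n) \<alpha>\<bar>) UNIV K"
    by (intro sums_bounded_le[OF yb]) (auto simp: abs_mult abs_mpow intro: mult_left_mono)
  then show False using un[of n] n sums_bounded_mono by blast
qed


section \<open>Derivatives of monomial series\<close>

definition dsum :: "(('i \<Rightarrow>\<^sub>0 nat) \<Rightarrow> real) \<Rightarrow> ('i \<Rightarrow> real) \<Rightarrow> ('i \<Rightarrow> real) \<Rightarrow> real" where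
  "dsum c y h = (\<Sum>\<^sub>\<infinity>\<alpha>. c \<alpha> * dpow y h \<alpha>)"

text \<open>Splits \<open>h\<close> into a small scalar and a nonnegative direction of norm at most
  \<rho>, the shape in which the monomial estimates take their increments. The zero vector is
  separate because of the normalisation.\<close>

lemma lq_direction:
  assumes q: "1 \<le> q" and h: "h \<in> lq_space q UNIV" and \<rho>: "0 < \<rho>"
  obtains H where "H \<in> lq_space q UNIV" "lq_norm q UNIV H \<le> \<rho>" "\<And>i. 0 \<le> H i"
    "\<And>i. \<bar>h i\<bar> \<le> (lq_norm q UNIV h / \<rho>) * H i"
proof -
  define N where "N = lq_norm q UNIV h"
  have N: "0 \<le> N" unfolding N_def using h by (rule lq_norm_nonneg)
  have hab: "(\<lambda>i. \<bar>h i\<bar>) \<in> lq_space q UNIV" "lq_norm q UNIV (\<lambda>i. \<bar>h i\<bar>) \<le> N"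
    unfolding N_def using lq_solid[OF q h, of "\<lambda>i. \<bar>h i\<bar>"] by auto
  show ?thesis
  proof (cases "N = 0")
    case True
    then have "\<bar>h i\<bar> \<le> 0" for i using lq_coord_le_norm[OF q h, of i] by (simp add: N_def)
    then show ?thesis
      using \<rho> by (intro that[of "\<lambda>_. 0"] lq_space_zero[OF q]) (auto simp: lq_norm_zero[OF q])
  next
    case False
    show ?thesis
    proof (rule that[of "\<lambda>i. (\<rho> / N) * \<bar>h i\<bar>"])
      show "(\<lambda>i. (\<rho> / N) * \<bar>h i\<bar>) \<in> lq_space q UNIV" by (rule lq_scale(1)[OF q hab(1)])
      have "lq_norm q UNIV (\<lambda>i. (\<rho> / N) * \<bar>h i\<bar>) \<le> \<bar>\<rho> / N\<bar> * lq_norm q UNIV (\<lambda>i. \<bar>h i\<bar>)"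
        by (rule lq_scale(2)[OF q hab(1)])
      also have "\<dots> \<le> \<bar>\<rho> / N\<bar> * N" using hab(2) by (intro mult_left_mono) auto
      also have "\<dots> = \<rho>" using False N \<rho> by simp
      finally show "lq_norm q UNIV (\<lambda>i. (\<rho> / N) * \<bar>h i\<bar>) \<le> \<rho>" .
    qed (use False N \<rho> in \<open>auto simp: N_def[symmetric]\<close>)
  qed
qed

lemma sums_bounded_mpow_scale:
  assumes c: "ball_bounded q c R K" and Y: "Y \<in> lq_ball q UNIV R"
    and le: "\<And>\<alpha>. \<bar>g \<alpha>\<bar> \<le> L * mpow Y \<alpha>" and L: "0 \<le> L"
  shows "sums_bounded (\<lambda>\<alpha>. \<bar>c \<alpha> * g \<alpha>\<bar>) UNIV (L * K)"
proof (rule sums_bounded_scale[OF ball_boundedD[OF c Y] _ L])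
  fix \<alpha>
  have "\<bar>g \<alpha>\<bar> \<le> L * \<bar>mpow Y \<alpha>\<bar>" using le[of \<alpha>] L by (meson abs_ge_self mult_left_mono order_trans)
  then show "\<bar>c \<alpha> * g \<alpha>\<bar> \<le> L * \<bar>c \<alpha> * mpow Y \<alpha>\<bar>"
    using mult_left_mono[of _ _ "\<bar>c \<alpha>\<bar>"] by (fastforce simp: abs_mult mult.left_commute)
qed

lemma lq_abs_add_ball:
  assumes q: "1 \<le> q" and y: "y \<in> lq_space q UNIV" and H: "H \<in> lq_space q UNIV"
    and "lq_norm q UNIV y + lq_norm q UNIV H < R" and H0: "\<And>i. 0 \<le> H i"
  shows "(\<lambda>i. \<bar>y i\<bar> + H i) \<in> lq_ball q UNIV R"
  using lq_add[OF q, of "\<lambda>i. \<bar>y i\<bar>" H] lq_solid[OF q y, of "\<lambda>i. \<bar>y i\<bar>"] assms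
  by (auto simp: lq_ball_iff)

lemma dsum_bounded:
  assumes q: "1 \<le> q" and c: "ball_bounded q c R K" and y: "y \<in> lq_space q UNIV"
    and \<rho>: "0 < \<rho>" and R: "lq_norm q UNIV y + \<rho> < R" and h: "h \<in> lq_space q UNIV"
  shows "(\<lambda>\<alpha>. c \<alpha> * dpow y h \<alpha>) summable_on UNIV"
    and "\<bar>dsum c y h\<bar> \<le> K / \<rho> * lq_norm q UNIV h"
proof -
  obtain H where H: "H \<in> lq_space q UNIV" "lq_norm q UNIV H \<le> \<rho>" "\<And>i. 0 \<le> H i"
    "\<And>i. \<bar>h i\<bar> \<le> (lq_norm q UNIV h / \<rho>) * H i" by (rule lq_direction[OF q h \<rho>]) blast
  have Y: "(\<lambda>i. \<bar>y i\<bar> + H i) \<in> lq_ball q UNIV R"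
    using H R by (intro lq_abs_add_ball[OF q y]) auto
  have s: "0 \<le> lq_norm q UNIV h / \<rho>" using lq_norm_nonneg[OF h] \<rho> by simp
  have b: "sums_bounded (\<lambda>\<alpha>. \<bar>c \<alpha> * dpow y h \<alpha>\<bar>) UNIV (lq_norm q UNIV h / \<rho> * K)"
    by (rule sums_bounded_mpow_scale[OF c Y dpow_le[OF H(4) _ s H(3)] s]) simp
  show "(\<lambda>\<alpha>. c \<alpha> * dpow y h \<alpha>) summable_on UNIV" using b by (rule sums_bounded_abs_infsum)
  show "\<bar>dsum c y h\<bar> \<le> K / \<rho> * lq_norm q UNIV h"
    using sums_bounded_abs_infsum(2)[OF b] by (simp add: dsum_def mult.commute)
qed

text \<open>The monomial remainders are summed against the series at |y| + H, whose norm is still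
  below \<open>R\<close>; the available room \<rho> enters as the denominator.\<close>

lemma msum_taylor:
  assumes q: "1 \<le> q" and c: "ball_bounded q c R K" and y: "y \<in> lq_space q UNIV"
    and \<rho>: "0 < \<rho>" and R: "lq_norm q UNIV y + \<rho> < R" and h: "h \<in> lq_space q UNIV" "lq_norm q UNIV h \<le> \<rho>"
  shows "\<bar>msum c (\<lambda>i. y i + h i) - msum c y - dsum c y h\<bar> \<le> K / \<rho>\<^sup>2 * (lq_norm q UNIV h)\<^sup>2"
proof -
  obtain H where H: "H \<in> lq_space q UNIV" "lq_norm q UNIV H \<le> \<rho>" "\<And>i. 0 \<le> H i"
    "\<And>i. \<bar>h i\<bar> \<le> (lq_norm q UNIV h / \<rho>) * H i" by (rule lq_direction[OF q h(1) \<rho>]) blast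
  define s where "s = lq_norm q UNIV h / \<rho>"
  have Y: "(\<lambda>i. \<bar>y i\<bar> + H i) \<in> lq_ball q UNIV R"
    using H R by (intro lq_abs_add_ball[OF q y]) auto
  have s: "0 \<le> s" "s \<le> 1" using lq_norm_nonneg[OF h(1)] h(2) \<rho> by (auto simp: s_def)
  have b: "sums_bounded (\<lambda>\<alpha>. \<bar>c \<alpha> * (mpow (\<lambda>i. y i + h i) \<alpha> - mpow y \<alpha> - dpow y h \<alpha>)\<bar>) UNIV (s\<^sup>2 * K)"
    by (rule sums_bounded_mpow_scale[OF c Y mpow_taylor_le[OF H(4)[folded s_def] _ s H(3)]]) auto
  have yb: "y \<in> lq_ball q UNIV R" using y R \<rho> by (simp add: lq_ball_iff)
  have zb: "(\<lambda>i. y i + h i) \<in> lq_ball q UNIV R"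
    using lq_add[OF q y h(1)] h(2) R by (simp add: lq_ball_iff)
  note sm = ball_convergent_conv(2)[OF ball_bounded_convergent[OF c]]
  have "((\<lambda>\<alpha>. c \<alpha> * mpow (\<lambda>i. y i + h i) \<alpha> + - (c \<alpha> * mpow y \<alpha>) + - (c \<alpha> * dpow y h \<alpha>))
     has_sum (msum c (\<lambda>i. y i + h i) + - msum c y + - dsum c y h)) UNIV"
    unfolding monomial_sum_def multi_indices_UNIV dsum_def
    by (intro has_sum_add has_sum_uminus[THEN iffD2] has_sum_infsum sm zb yb)
      (use has_sum_infsum[OF sm[OF yb]] has_sum_infsum[OF dsum_bounded(1)[OF q c y \<rho> R h(1)]] in
        \<open>simp_all\<close>)
  then have "msum c (\<lambda>i. y i + h i) - msum c y - dsum c y h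
      = (\<Sum>\<^sub>\<infinity>\<alpha>. c \<alpha> * (mpow (\<lambda>i. y i + h i) \<alpha> - mpow y \<alpha> - dpow y h \<alpha>))"
    by (subst infsumI[symmetric]) (auto simp: algebra_simps)
  then show ?thesis
    using sums_bounded_abs_infsum(2)[OF b] by (simp add: s_def power_divide mult.commute)
qed

text \<open>Half of the room \<open>2 * \<rho>\<close> is spent on the increment
  \<open>z - y\<close>, the other half on the direction \<open>h\<close>.\<close>

lemma dsum_lipschitz:
  assumes q: "1 \<le> q" and c: "ball_bounded q c R K" and y: "y \<in> lq_space q UNIV" and z: "z \<in> lq_space q UNIV"
    and \<rho>: "0 < \<rho>" and R: "lq_norm q UNIV y + 2 * \<rho> < R"
    and h: "h \<in> lq_space q UNIV" and zy: "lq_norm q UNIV (\<lambda>i. z i - y i) \<le> \<rho>"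
  shows "\<bar>dsum c z h - dsum c y h\<bar> \<le> K / \<rho>\<^sup>2 * lq_norm q UNIV (\<lambda>i. z i - y i) * lq_norm q UNIV h"
proof -
  define s where "s = lq_norm q UNIV (\<lambda>i. z i - y i) / \<rho>"
  define \<sigma> where "\<sigma> = lq_norm q UNIV h / \<rho>"
  have d: "(\<lambda>i. z i - y i) \<in> lq_space q UNIV" using lq_diff[OF q z y] .
  obtain H where H: "H \<in> lq_space q UNIV" "lq_norm q UNIV H \<le> \<rho>" "\<And>i. 0 \<le> H i"
    "\<And>i. \<bar>h i\<bar> \<le> \<sigma> * H i" unfolding \<sigma>_def by (rule lq_direction[OF q h(1) \<rho>]) blast
  obtain G where G: "G \<in> lq_space q UNIV" "lq_norm q UNIV G \<le> \<rho>" "\<And>i. 0 \<le> G i"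
    "\<And>i. \<bar>z i - y i\<bar> \<le> s * G i" unfolding s_def by (rule lq_direction[OF q d \<rho>]) blast
  have Y: "(\<lambda>i. \<bar>y i\<bar> + (G i + H i)) \<in> lq_ball q UNIV R"
  proof (rule lq_abs_add_ball[OF q y])
    show "(\<lambda>i. G i + H i) \<in> lq_space q UNIV" using lq_add[OF q G(1) H(1)] by simp
    show "lq_norm q UNIV y + lq_norm q UNIV (\<lambda>i. G i + H i) < R"
      using lq_add(2)[OF q G(1) H(1)] G(2) H(2) R by simp
  qed (use G H in simp)
  have s: "0 \<le> s" "s \<le> 1" "0 \<le> \<sigma>"
    using lq_norm_nonneg[OF d] lq_norm_nonneg[OF h] zy \<rho> by (auto simp: s_def \<sigma>_def)
  have b: "sums_bounded (\<lambda>\<alpha>. \<bar>c \<alpha> * (dpow z h \<alpha> - dpow y h \<alpha>)\<bar>) UNIV (s * \<sigma> * K)"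
    by (rule sums_bounded_mpow_scale[OF c Y dpow_diff_le[OF G(4) H(4) _ s G(3) H(3)]]) (use s in auto)
  have "lq_norm q UNIV z \<le> lq_norm q UNIV y + \<rho>"
    using lq_add(2)[OF q y d] zy by simp
  then have zR: "lq_norm q UNIV z + \<rho> < R" and yR: "lq_norm q UNIV y + \<rho> < R" using R \<rho> by auto
  note sz = dsum_bounded(1)[OF q c z \<rho> zR h] and sy = dsum_bounded(1)[OF q c y \<rho> yR h]
  have "((\<lambda>\<alpha>. c \<alpha> * dpow z h \<alpha> + - (c \<alpha> * dpow y h \<alpha>)) has_sum (dsum c z h + - dsum c y h)) UNIV"
    unfolding dsum_def using has_sum_infsum[OF sz] has_sum_infsum[OF sy]
    by (intro has_sum_add) (simp_all add: has_sum_uminus)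
  then have "dsum c z h - dsum c y h = (\<Sum>\<^sub>\<infinity>\<alpha>. c \<alpha> * (dpow z h \<alpha> - dpow y h \<alpha>))"
    by (subst infsumI[symmetric]) (auto simp: algebra_simps)
  then show ?thesis
    using sums_bounded_abs_infsum(2)[OF b] by (simp add: s_def \<sigma>_def power2_eq_square mult_ac)
qed

lemma dsum_functional:
  fixes c :: "('i \<Rightarrow>\<^sub>0 nat) \<Rightarrow> real"
  assumes q: "1 \<le> q" and c: "ball_convergent q c R" and y: "y \<in> lq_ball q UNIV R"
  shows "lq_functional q UNIV (dsum c y)"
proof -
  obtain R' K where R': "y \<in> lq_ball q UNIV R'" and K: "ball_bounded q c R' K"
    using c y by (rule ball_convergentE)
  define \<rho> where "\<rho> = (R' - lq_norm q UNIV y) / 2"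
  have \<rho>: "0 < \<rho>" "lq_norm q UNIV y + \<rho> < R'" and ys: "y \<in> lq_space q UNIV"
    using R' by (auto simp: \<rho>_def lq_ball_iff field_simps)
  note b = dsum_bounded[OF q K ys \<rho>]
  show ?thesis
    unfolding lq_functional_def
  proof (intro conjI ballI allI)
    fix h k :: "'i \<Rightarrow> real" assume "h \<in> lq_space q UNIV" "k \<in> lq_space q UNIV"
    then show "dsum c y (\<lambda>i. h i + k i) = dsum c y h + dsum c y k"
      unfolding dsum_def dpow_add_dir by (simp add: distrib_left infsum_add b(1))
  next
    fix a :: real and h :: "'i \<Rightarrow> real"
    show "dsum c y (\<lambda>i. a * h i) = a * dsum c y h"
      unfolding dsum_def dpow_scale_dir by (simp add: mult.left_commute[of _ a] infsum_cmult_right')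
  next
    show "\<exists>K. \<forall>h\<in>lq_space q UNIV. \<bar>dsum c y h\<bar> \<le> K * lq_norm q UNIV h"
      using b(2) by blast
  qed
qed

lemma msum_has_lq_derivative:
  fixes c :: "('i \<Rightarrow>\<^sub>0 nat) \<Rightarrow> real"
  assumes q: "1 \<le> q" and c: "ball_convergent q c R" and y: "y \<in> lq_ball q UNIV R"
    and g: "\<And>z. z \<in> lq_ball q UNIV R \<Longrightarrow> g z = msum c z"
  shows "has_lq_derivative q UNIV g (dsum c y) y"
  unfolding has_lq_derivative_def
proof (intro conjI allI impI)
  show "lq_functional q UNIV (dsum c y)" by (rule dsum_functional[OF q c y])
  fix \<epsilon> :: real assume \<epsilon>: "0 < \<epsilon>"
  obtain R' K where RR: "R' < R" and R': "y \<in> lq_ball q UNIV R'" and K: "ball_bounded q c R' K"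
    using c y by (rule ball_convergentE)
  have K0: "0 \<le> K" using sums_bounded_nonneg[OF ball_boundedD[OF K R']] .
  define \<rho> where "\<rho> = (R' - lq_norm q UNIV y) / 2"
  have \<rho>: "0 < \<rho>" "lq_norm q UNIV y + \<rho> < R'" and ys: "y \<in> lq_space q UNIV"
    using R' by (auto simp: \<rho>_def lq_ball_iff field_simps)
  show "\<exists>\<delta>>0. \<forall>h\<in>lq_space q UNIV. lq_norm q UNIV h < \<delta> \<longrightarrow>
        \<bar>g (\<lambda>i. y i + h i) - g y - dsum c y h\<bar> \<le> \<epsilon> * lq_norm q UNIV h"
  \<comment> \<open>Chosen so that \<open>K / \<rho>\<^sup>2\<close> times the norm of
    \<open>h\<close> is at most \<epsilon>; \<open>K + 1\<close> instead of \<open>K\<close> avoids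
    a zero denominator.\<close>
  proof (intro exI[of _ "min \<rho> (\<epsilon> * \<rho>\<^sup>2 / (K + 1))"] conjI ballI impI)
    show "0 < min \<rho> (\<epsilon> * \<rho>\<^sup>2 / (K + 1))" using \<rho> \<epsilon> K0 by simp
    fix h :: "'i \<Rightarrow> real" assume h: "h \<in> lq_space q UNIV" and "lq_norm q UNIV h < min \<rho> (\<epsilon> * \<rho>\<^sup>2 / (K + 1))"
    then have h\<rho>: "lq_norm q UNIV h \<le> \<rho>" and h\<epsilon>: "lq_norm q UNIV h \<le> \<epsilon> * \<rho>\<^sup>2 / (K + 1)" by auto
    have nn: "0 \<le> lq_norm q UNIV h" using h by (rule lq_norm_nonneg)
    have "y \<in> lq_ball q UNIV R" "(\<lambda>i. y i + h i) \<in> lq_ball q UNIV R"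
      using lq_add[OF q ys h] h\<rho> \<rho> RR ys by (auto simp: lq_ball_iff)
    then have "\<bar>g (\<lambda>i. y i + h i) - g y - dsum c y h\<bar> \<le> K / \<rho>\<^sup>2 * (lq_norm q UNIV h)\<^sup>2"
      using msum_taylor[OF q K ys \<rho> h h\<rho>] g by simp
    also have "\<dots> = K / \<rho>\<^sup>2 * lq_norm q UNIV h * lq_norm q UNIV h" by (simp add: power2_eq_square)
    also have "\<dots> \<le> \<epsilon> * lq_norm q UNIV h"
    proof (rule mult_right_mono[OF _ nn])
      have "K / \<rho>\<^sup>2 * lq_norm q UNIV h \<le> K / \<rho>\<^sup>2 * (\<epsilon> * \<rho>\<^sup>2 / (K + 1))"
        using h\<epsilon> K0 \<rho> by (intro mult_left_mono) auto
      also have "\<dots> = \<epsilon> * (K / (K + 1))" using \<rho> by (simp add: field_simps)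
      also have "\<dots> \<le> \<epsilon>" using K0 \<epsilon> by (intro mult_right_le_one_le) auto
      finally show "K / \<rho>\<^sup>2 * lq_norm q UNIV h \<le> \<epsilon>" .
    qed
    finally show "\<bar>g (\<lambda>i. y i + h i) - g y - dsum c y h\<bar> \<le> \<epsilon> * lq_norm q UNIV h" .
  qed
qed

lemma dsum_derivative_continuous:
  fixes c :: "('i \<Rightarrow>\<^sub>0 nat) \<Rightarrow> real"
  assumes q: "1 \<le> q" and c: "ball_convergent q c R"
  shows "lq_derivative_continuous q UNIV R (dsum c)"
  unfolding lq_derivative_continuous_def
proof (intro ballI allI impI)
  fix y :: "'i \<Rightarrow> real" and \<epsilon> :: real assume y: "y \<in> lq_ball q UNIV R" and \<epsilon>: "0 < \<epsilon>"
  obtain R' K where RR: "R' < R" and R': "y \<in> lq_ball q UNIV R'" and K: "ball_bounded q c R' K"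
    using c y by (rule ball_convergentE)
  have K0: "0 \<le> K" using sums_bounded_nonneg[OF ball_boundedD[OF K R']] .
  define \<rho> where "\<rho> = (R' - lq_norm q UNIV y) / 3"
  have \<rho>: "0 < \<rho>" "lq_norm q UNIV y + 2 * \<rho> < R'" and ys: "y \<in> lq_space q UNIV"
    using R' by (auto simp: \<rho>_def lq_ball_iff field_simps)
  show "\<exists>\<delta>>0. \<forall>z\<in>lq_ball q UNIV R. lq_norm q UNIV (\<lambda>i. z i - y i) < \<delta> \<longrightarrow>
        (\<forall>h\<in>lq_space q UNIV. \<bar>dsum c z h - dsum c y h\<bar> \<le> \<epsilon> * lq_norm q UNIV h)"
  proof (intro exI[of _ "min \<rho> (\<epsilon> * \<rho>\<^sup>2 / (K + 1))"] conjI ballI impI)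
    show "0 < min \<rho> (\<epsilon> * \<rho>\<^sup>2 / (K + 1))" using \<rho> \<epsilon> K0 by simp
    fix z h :: "'i \<Rightarrow> real" assume z: "z \<in> lq_ball q UNIV R" and h: "h \<in> lq_space q UNIV"
      and n: "lq_norm q UNIV (\<lambda>i. z i - y i) < min \<rho> (\<epsilon> * \<rho>\<^sup>2 / (K + 1))"
    have zs: "z \<in> lq_space q UNIV" using z by (simp add: lq_ball_iff)
    have nn: "0 \<le> lq_norm q UNIV h" using h by (rule lq_norm_nonneg)
    have "\<bar>dsum c z h - dsum c y h\<bar> \<le> K / \<rho>\<^sup>2 * lq_norm q UNIV (\<lambda>i. z i - y i) * lq_norm q UNIV h"
      using n by (intro dsum_lipschitz[OF q K ys zs \<rho> h]) auto
    also have "\<dots> \<le> \<epsilon> * lq_norm q UNIV h"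
    proof (rule mult_right_mono[OF _ nn])
      have "K / \<rho>\<^sup>2 * lq_norm q UNIV (\<lambda>i. z i - y i) \<le> K / \<rho>\<^sup>2 * (\<epsilon> * \<rho>\<^sup>2 / (K + 1))"
        using n K0 \<rho> by (intro mult_left_mono) auto
      also have "\<dots> = \<epsilon> * (K / (K + 1))" using \<rho> by (simp add: field_simps)
      also have "\<dots> \<le> \<epsilon>" using K0 \<epsilon> by (intro mult_right_le_one_le) auto
      finally show "K / \<rho>\<^sup>2 * lq_norm q UNIV (\<lambda>i. z i - y i) \<le> \<epsilon>" .
    qed
    finally show "\<bar>dsum c z h - dsum c y h\<bar> \<le> \<epsilon> * lq_norm q UNIV h" .
  qed
qed

lemma msum_frechet_C1:
  fixes c :: "('i \<Rightarrow>\<^sub>0 nat) \<Rightarrow> real"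
  assumes q: "1 \<le> q" and c: "ball_convergent q c R" and R: "0 < R"
    and U: "lq_ball q UNIV R \<subseteq> U" and g: "\<And>z. z \<in> lq_ball q UNIV R \<Longrightarrow> g z = msum c z"
  shows "frechet_C1_near q UNIV U g (\<lambda>_. 0)"
proof -
  \<comment> \<open>A radius below 1 is demanded by \<open>frechet_C1_near\<close>.\<close>
  define r where "r = min R (1 / 2)"
  have r: "0 < r" "r < 1" "r \<le> R" using R by (auto simp: r_def)
  have c': "ball_convergent q c r" using c r(3) by (rule ball_convergent_mono)
  have sub: "z \<in> lq_ball q UNIV r \<Longrightarrow> z \<in> lq_ball q UNIV R" for z using r(3) by (rule lq_ball_mono)
  show ?thesis
    unfolding frechet_C1_near_def
  proof (intro exI[of _ r] exI[of _ "dsum c"] conjI ballI)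
    show "(\<lambda>h i. 0 + h i) ` lq_ball q UNIV r \<subseteq> U" using sub U by auto
    fix y :: "'i \<Rightarrow> real" assume y: "y \<in> lq_ball q UNIV r"
    show "has_lq_derivative q UNIV (\<lambda>h. g (\<lambda>i. 0 + h i)) (dsum c y) y"
      using msum_has_lq_derivative[OF q c' y g[OF sub]] by simp
  qed (use r dsum_derivative_continuous[OF q c'] in auto)
qed


section \<open>Partial derivatives and the identity theorem\<close>

definition dcoef :: "'i \<Rightarrow> (('i \<Rightarrow>\<^sub>0 nat) \<Rightarrow> real) \<Rightarrow> ('i \<Rightarrow>\<^sub>0 nat) \<Rightarrow> real" where
  "dcoef i c \<alpha> = (real (Poly_Mapping.lookup \<alpha> i) + 1) * c (\<alpha> + unit_index i)"

fun dcoefs :: "'i list \<Rightarrow> (('i \<Rightarrow>\<^sub>0 nat) \<Rightarrow> real) \<Rightarrow> ('i \<Rightarrow>\<^sub>0 nat) \<Rightarrow> real" where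
  "dcoefs [] c = c"
| "dcoefs (i # is) c = dcoef i (dcoefs is c)"

definition list_index :: "'i list \<Rightarrow> ('i \<Rightarrow>\<^sub>0 nat)" where
  "list_index is = (\<Sum>i\<leftarrow>is. unit_index i)"

lemma list_index_simps [simp]:
  "list_index [] = 0" "list_index (i # is) = unit_index i + list_index is"
  "list_index (is @ js) = list_index is + list_index js"
  by (simp_all add: list_index_def)

lemma list_index_replicate [simp]: "list_index (replicate n i) = Poly_Mapping.single i n"
  by (induction n) (simp_all add: single_add[symmetric])

lemma mdeg_list_index [simp]: "mdeg (list_index is) = length is"
  by (induction "is") (simp_all add: mdeg_add)

lemma list_index_surj: "\<exists>is. list_index is = \<alpha>"
proof (induction \<alpha> rule: multi_index_induct)
  case (add \<alpha> i)
  then obtain "is" where "list_index is = \<alpha>" by blast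
  then have "list_index (i # is) = \<alpha> + unit_index i" by (simp add: add.commute)
  then show ?case by blast
qed (metis list_index_simps(1))

text \<open>The factors of the single derivatives telescope through \<open>mfact_add_unit\<close>.
  In particular the order of differentiation does not affect the coefficients.\<close>

lemma dcoefs_eq: "dcoefs is c \<alpha> = mfact (\<alpha> + list_index is) / mfact \<alpha> * c (\<alpha> + list_index is)"
proof (induction "is" arbitrary: \<alpha>)
  case (Cons i "is")
  have "dcoefs (i # is) c \<alpha> = (real (Poly_Mapping.lookup \<alpha> i) + 1) *
     (mfact (\<alpha> + unit_index i + list_index is) / mfact (\<alpha> + unit_index i) * c (\<alpha> + unit_index i + list_index is))"
    by (simp only: dcoefs.simps dcoef_def Cons)
  also have "mfact (\<alpha> + unit_index i) = (real (Poly_Mapping.lookup \<alpha> i) + 1) * mfact \<alpha>"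
    by (rule mfact_add_unit)
  finally show ?case by (simp add: add.assoc)
qed simp

lemma mfact_mono: "mfact \<alpha> \<le> mfact (\<alpha> + \<beta>)"
proof (induction \<beta> rule: multi_index_induct)
  case (add \<beta> i)
  have "mfact (\<alpha> + \<beta>) * 1 \<le> mfact (\<alpha> + \<beta>) * (real (Poly_Mapping.lookup (\<alpha> + \<beta>) i) + 1)"
    by (intro mult_left_mono) auto
  also have "\<dots> = mfact (\<alpha> + \<beta> + unit_index i)" by (simp only: mfact_add_unit mult.commute)
  finally show ?case using add by (simp add: add.assoc)
qed simp

text \<open>The factorial quotient of \<open>dcoefs_eq\<close> is at least 1; hence a series divided
  by a monomial inherits convergence from a derivative.\<close>

lemma abs_shift_le_dcoefs: "\<bar>c (\<alpha> + list_index is)\<bar> \<le> \<bar>dcoefs is c \<alpha>\<bar>"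
proof -
  have "1 * \<bar>c (\<alpha> + list_index is)\<bar> \<le> mfact (\<alpha> + list_index is) / mfact \<alpha> * \<bar>c (\<alpha> + list_index is)\<bar>"
    using mfact_mono[of \<alpha> "list_index is"] by (intro mult_right_mono) (auto simp: le_divide_eq)
  then show ?thesis by (simp add: dcoefs_eq abs_mult)
qed

text \<open>Cauchy's estimate, monomial by monomial: \<open>h\<close> times a partial derivative is
  the derivative in direction \<open>h\<close> times the unit vector, which \<open>dpow_le\<close>
  bounds by the monomial at the point moved outwards by \<open>h\<close>.\<close>

lemma ball_bounded_dcoef:
  fixes c :: "('i \<Rightarrow>\<^sub>0 nat) \<Rightarrow> real"
  assumes q: "1 \<le> q" and c: "ball_bounded q c R K" and h: "0 < h"
  shows "ball_bounded q (dcoef i c) (R - h) (K / h)"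
  unfolding ball_bounded_def
proof
  fix y :: "'i \<Rightarrow> real" assume y: "y \<in> lq_ball q UNIV (R - h)"
  let ?H = "\<lambda>j. if j = i then h else 0"
  define Y where "Y = (\<lambda>j. \<bar>y j\<bar> + ?H j)"
  have Y: "Y \<in> lq_ball q UNIV R"
    unfolding Y_def using y lq_unit(2)[OF q, of i h] h
    by (intro lq_abs_add_ball[OF q _ lq_unit(1)[OF q]]) (auto simp: lq_ball_iff)
  have "\<bar>dcoef i c \<alpha> * mpow y \<alpha>\<bar> \<le> (1 / h) * \<bar>c (\<alpha> + unit_index i) * mpow Y (\<alpha> + unit_index i)\<bar>" for \<alpha>
  proof -
    have dir: "dpow (\<lambda>j. \<bar>y j\<bar>) ?H (\<alpha> + unit_index i) = h * (real (Poly_Mapping.lookup \<alpha> i) + 1) * mpow (\<lambda>j. \<bar>y j\<bar>) \<alpha>"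
    proof -
      have H: "?H = (\<lambda>j. h * (if j = i then 1 else 0))" by auto
      show ?thesis unfolding H dpow_scale_dir dpow_unit_dir by (simp add: lookup_add)
    qed
    have "\<bar>dpow (\<lambda>j. \<bar>y j\<bar>) ?H (\<alpha> + unit_index i)\<bar> \<le> 1 * mpow Y (\<alpha> + unit_index i)"
      by (rule dpow_le[where H="?H"]) (use h in \<open>auto simp: Y_def\<close>)
    then have "h * ((real (Poly_Mapping.lookup \<alpha> i) + 1) * \<bar>mpow y \<alpha>\<bar>) \<le> \<bar>mpow Y (\<alpha> + unit_index i)\<bar>"
      unfolding dir using h order_trans[OF _ abs_ge_self[of "mpow Y (\<alpha> + unit_index i)"]]
      by (simp add: abs_mult abs_mpow[of y] mult.assoc mpow_nonneg)
    then have "(real (Poly_Mapping.lookup \<alpha> i) + 1) * \<bar>mpow y \<alpha>\<bar> \<le> (1 / h) * \<bar>mpow Y (\<alpha> + unit_index i)\<bar>"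
      using h by (simp add: field_simps)
    then have "\<bar>c (\<alpha> + unit_index i)\<bar> * ((real (Poly_Mapping.lookup \<alpha> i) + 1) * \<bar>mpow y \<alpha>\<bar>)
        \<le> \<bar>c (\<alpha> + unit_index i)\<bar> * ((1 / h) * \<bar>mpow Y (\<alpha> + unit_index i)\<bar>)"
      by (rule mult_left_mono) simp
    then show ?thesis by (simp add: dcoef_def abs_mult mult_ac)
  qed
  then have "sums_bounded (\<lambda>\<alpha>. \<bar>dcoef i c \<alpha> * mpow y \<alpha>\<bar>) UNIV ((1 / h) * K)"
    using h by (intro sums_bounded_comparison[OF ball_boundedD[OF c Y], where \<pi>="\<lambda>\<alpha>. \<alpha> + unit_index i" and A'=UNIV])
      (auto simp: inj_on_def)
  then show "sums_bounded (\<lambda>\<alpha>. \<bar>dcoef i c \<alpha> * mpow y \<alpha>\<bar>) UNIV (K / h)" by simp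
qed

lemma ball_bounded_dcoefs:
  fixes h :: real
  assumes q: "1 \<le> q" and c: "ball_bounded q c R K" and h: "0 < h"
  shows "ball_bounded q (dcoefs is c) (R - h * length is) (K / h ^ length is)"
proof (induction "is")
  case (Cons i "is")
  have eq: "R - h * length (i # is) = (R - h * length is) - h" by (simp add: algebra_simps)
  show ?case unfolding eq using ball_bounded_dcoef[OF q Cons h, of i] by (simp add: mult.commute)
qed (use c in simp)

lemma ball_convergent_dcoef:
  assumes q: "1 \<le> q" and c: "ball_convergent q c R"
  shows "ball_convergent q (dcoef i c) R"
  unfolding ball_convergent_def
proof (intro allI impI)
  fix R' assume "R' < R"
  define h where "h = (R - R') / 2"
  have h: "0 < h" "R' + h < R" using \<open>R' < R\<close> by (auto simp: h_def field_simps)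
  then obtain K where "ball_bounded q c (R' + h) K" using c by (auto simp: ball_convergent_def)
  from ball_bounded_dcoef[OF q this h(1)] show "\<exists>K. ball_bounded q (dcoef i c) R' K" by auto
qed

lemma ball_convergent_dcoefs:
  assumes "1 \<le> q" and "ball_convergent q c R" shows "ball_convergent q (dcoefs is c) R"
  using assms by (induction "is") (auto intro: ball_convergent_dcoef)

lemma ball_convergent_shift:
  assumes "1 \<le> q" and "ball_convergent q c R" shows "ball_convergent q (\<lambda>\<alpha>. c (\<alpha> + \<beta>)) R"
proof -
  obtain "is" where "list_index is = \<beta>" using list_index_surj by blast
  then show ?thesis
    using ball_convergent_le[OF ball_convergent_dcoefs[OF assms, of "is"]] abs_shift_le_dcoefs[of c _ "is"]
    by simp
qed

lemma DERIV_quadratic_remainder: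
  fixes f :: "real \<Rightarrow> real"
  assumes \<rho>: "0 < \<rho>" and le: "\<And>t. \<bar>t\<bar> \<le> \<rho> \<Longrightarrow> \<bar>f (x + t) - f x - t * D\<bar> \<le> K * t\<^sup>2"
  shows "(f has_field_derivative D) (at x)"
proof -
  have "((\<lambda>t. (f (x + t) - f x) / t - D) \<longlongrightarrow> 0) (at 0)"
  proof (rule Lim_null_comparison)
    show "\<forall>\<^sub>F t in at 0. norm ((f (x + t) - f x) / t - D) \<le> K * \<bar>t\<bar>"
      unfolding eventually_at
    proof (intro exI[of _ \<rho>] conjI ballI impI)
      fix t :: real assume t: "t \<noteq> 0 \<and> dist t 0 < \<rho>"
      then have "\<bar>(f (x + t) - f x) / t - D\<bar> = \<bar>f (x + t) - f x - t * D\<bar> / \<bar>t\<bar>"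
        by (simp add: abs_divide[symmetric] diff_divide_distrib)
      also have "\<dots> \<le> K * t\<^sup>2 / \<bar>t\<bar>" using t by (intro divide_right_mono le) auto
      also have "\<dots> = K * \<bar>t\<bar>" using t by (simp add: power2_eq_square abs_if)
      finally show "norm ((f (x + t) - f x) / t - D) \<le> K * \<bar>t\<bar>" by simp
    qed (use \<rho> in auto)
    show "((\<lambda>t. K * \<bar>t\<bar>) \<longlongrightarrow> 0) (at 0)" by (auto intro!: tendsto_eq_intros)
  qed
  then have "((\<lambda>t. (f (x + t) - f x) / t) \<longlongrightarrow> D) (at 0)" by (simp add: LIM_zero_iff)
  then show ?thesis by (simp add: DERIV_def)
qed

lemma dsum_unit:
  "dsum c y (\<lambda>j. if j = i then 1 else 0) = msum (dcoef i c) y"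
proof -
  let ?f = "\<lambda>\<alpha>. c \<alpha> * (real (Poly_Mapping.lookup \<alpha> i) * mpow y (\<alpha> - unit_index i))"
  have "dsum c y (\<lambda>j. if j = i then 1 else 0) = infsum ?f UNIV"
    by (simp add: dsum_def dpow_unit_dir)
  also have "\<dots> = infsum ?f (range (\<lambda>\<alpha>. \<alpha> + unit_index i))"
  proof (rule infsum_cong_neutral)
    fix \<alpha> assume "\<alpha> \<in> UNIV - range (\<lambda>\<alpha>. \<alpha> + unit_index i)"
    then have "Poly_Mapping.lookup \<alpha> i = 0" using add_diff_unit[of \<alpha> i] by (metis Diff_iff not_gr_zero rangeI)
    then show "?f \<alpha> = 0" by simp
  qed auto
  also have "\<dots> = infsum (?f \<circ> (\<lambda>\<alpha>. \<alpha> + unit_index i)) UNIV"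
    by (rule infsum_reindex) (auto simp: inj_on_def)
  also have "\<dots> = msum (dcoef i c) y"
    by (simp add: monomial_sum_def dcoef_def o_def lookup_add mult_ac add.commute)
  finally show ?thesis .
qed

text \<open>In direction of a unit vector the Taylor estimate of the series becomes a quadratic
  remainder in one real variable.\<close>

lemma msum_has_partial_derivative:
  fixes c :: "('i \<Rightarrow>\<^sub>0 nat) \<Rightarrow> real"
  assumes q: "1 \<le> q" and c: "ball_convergent q c R" and y: "y \<in> lq_ball q UNIV R"
  shows "((\<lambda>s. msum c (y(i := s))) has_field_derivative msum (dcoef i c) y) (at (y i))"
proof -
  obtain R' K where RR: "R' < R" and R': "y \<in> lq_ball q UNIV R'" and K: "ball_bounded q c R' K"
    using c y by (rule ball_convergentE)
  have K0: "0 \<le> K" using sums_bounded_nonneg[OF ball_boundedD[OF K R']] .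
  define \<rho> where "\<rho> = (R' - lq_norm q UNIV y) / 2"
  have \<rho>: "0 < \<rho>" "lq_norm q UNIV y + \<rho> < R'" and ys: "y \<in> lq_space q UNIV"
    using R' by (auto simp: \<rho>_def lq_ball_iff field_simps)
  let ?e = "\<lambda>j. if j = i then 1 else (0::real)"
  show ?thesis
  proof (rule DERIV_quadratic_remainder[OF \<rho>(1)])
    fix t :: real assume t: "\<bar>t\<bar> \<le> \<rho>"
    let ?h = "\<lambda>j. if j = i then t else 0"
    have h: "?h \<in> lq_space q UNIV" "lq_norm q UNIV ?h \<le> \<bar>t\<bar>"
      using lq_unit[OF q, of i t] by auto
    have upd: "y(i := y i + t) = (\<lambda>j. y j + ?h j)" by auto
    have "?h = (\<lambda>j. t * ?e j)" by auto
    then have d: "dsum c y ?h = t * msum (dcoef i c) y"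
      unfolding dsum_unit[symmetric]
      by (simp only: dsum_def dpow_scale_dir mult.left_commute[of _ t] infsum_cmult_right')
    have "\<bar>msum c (\<lambda>j. y j + ?h j) - msum c y - dsum c y ?h\<bar> \<le> K / \<rho>\<^sup>2 * (lq_norm q UNIV ?h)\<^sup>2"
      using h t by (intro msum_taylor[OF q K ys \<rho>]) auto
    also have "\<dots> \<le> K / \<rho>\<^sup>2 * \<bar>t\<bar>\<^sup>2"
      using h K0 lq_norm_nonneg[OF h(1)] by (intro mult_left_mono power_mono) auto
    finally show "\<bar>msum c (y(i := y i + t)) - msum c (y(i := y i)) - t * msum (dcoef i c) y\<bar> \<le> K / \<rho>\<^sup>2 * t\<^sup>2"
      unfolding upd d by simp
  qed
qed

lemma iter_pderiv_msum:
  fixes c :: "('i \<Rightarrow>\<^sub>0 nat) \<Rightarrow> real"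
  assumes q: "1 \<le> q" and c: "ball_convergent q c R" and g: "\<And>y. y \<in> lq_ball q UNIV R \<Longrightarrow> g y = msum c y"
  shows "y \<in> lq_ball q UNIV R \<Longrightarrow> iter_pderiv is g y = msum (dcoefs is c) y"
    and "iter_pderiv_exists (lq_ball q UNIV R) is g"
proof (induction "is" arbitrary: y)
  case Nil
  { case 1 then show ?case using g by simp }
  { case 2 then show ?case by simp }
next
  case (Cons i "is")
  have D: "((\<lambda>s. iter_pderiv is g (y(i := s))) has_field_derivative msum (dcoefs (i # is) c) y) (at (y i))"
    if y: "y \<in> lq_ball q UNIV R" for y
  proof -
    \<comment> \<open>The induction hypothesis identifies the functions only inside the ball;
      openness of the ball in each coordinate makes this an identity near \<open>y i\<close>, which
      determines the derivative.\<close>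
    have "\<forall>\<^sub>F s in nhds (y i). iter_pderiv is g (y(i := s)) = msum (dcoefs is c) (y(i := s))"
      using lq_ball_upd_eventually[OF q y, of i] by eventually_elim (rule Cons.IH(1))
    then show ?thesis
      using msum_has_partial_derivative[OF q ball_convergent_dcoefs[OF q c] y]
      by (simp add: DERIV_cong_ev)
  qed
  { case 1 then show ?case using D[of y] by (simp add: pderiv_at_def DERIV_imp_deriv) }
  { case 2 show ?case using Cons.IH(2) D by (auto simp: field_differentiable_def) }
qed

text \<open>The coefficients are read off from the iterated derivatives at the origin.\<close>
theorem msum_identity:
  fixes c :: "('i \<Rightarrow>\<^sub>0 nat) \<Rightarrow> real"
  assumes q: "1 \<le> q" and R: "0 < R" and c: "ball_convergent q c R" and d: "ball_convergent q d R"
    and eq: "\<And>y. y \<in> lq_ball q UNIV R \<Longrightarrow> msum c y = msum d y"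
  shows "c = d"
proof
  fix \<alpha> :: "'i \<Rightarrow>\<^sub>0 nat"
  obtain "is" where "is": "list_index is = \<alpha>" using list_index_surj by blast
  have z: "(\<lambda>_. 0) \<in> lq_ball q UNIV R" by (rule lq_ball_zero[OF q R])
  have "msum (dcoefs is c) (\<lambda>_. 0) = msum (dcoefs is d) (\<lambda>_. 0)"
    using iter_pderiv_msum(1)[OF q c refl z, of "is"] iter_pderiv_msum(1)[OF q d eq z, of "is"] by simp
  then show "c \<alpha> = d \<alpha>" by (simp add: msum_at_zero dcoefs_eq "is")
qed

lemma iter_pderiv_at_zero:
  assumes "1 \<le> q" "0 < R" "ball_convergent q c R" "\<And>y. y \<in> lq_ball q UNIV R \<Longrightarrow> g y = msum c y"
  shows "iter_pderiv is g (\<lambda>_. 0) = mfact (list_index is) * c (list_index is)"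
  using iter_pderiv_msum(1)[OF assms(1,3,4) lq_ball_zero[OF assms(1,2)], of "is"]
  by (simp add: msum_at_zero dcoefs_eq)

section \<open>Vanishing to a given order in one variable\<close>

lemma msum_factor:
  assumes "\<And>\<alpha>. c \<alpha> \<noteq> 0 \<Longrightarrow> \<exists>\<gamma>. \<alpha> = \<gamma> + \<beta>"
  shows "msum c y = mpow y \<beta> * msum (\<lambda>\<alpha>. c (\<alpha> + \<beta>)) y"
proof -
  have "msum c y = infsum (\<lambda>\<alpha>. c \<alpha> * mpow y \<alpha>) (range (\<lambda>\<alpha>. \<alpha> + \<beta>))"
    unfolding monomial_sum_def multi_indices_UNIV
    by (rule infsum_cong_neutral) (use assms in auto)
  also have "\<dots> = infsum ((\<lambda>\<alpha>. c \<alpha> * mpow y \<alpha>) \<circ> (\<lambda>\<alpha>. \<alpha> + \<beta>)) UNIV"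
    by (rule infsum_reindex) (auto simp: inj_on_def)
  also have "\<dots> = mpow y \<beta> * msum (\<lambda>\<alpha>. c (\<alpha> + \<beta>)) y"
    unfolding monomial_sum_def by (simp add: o_def mpow_add mult_ac infsum_cmult_right'[symmetric])
  finally show ?thesis .
qed

lemma split_single:
  assumes "l \<le> Poly_Mapping.lookup \<alpha> i"
  shows "\<exists>\<gamma>. \<alpha> = \<gamma> + Poly_Mapping.single i (l::nat)"
  using assms
  by (intro exI[of _ "\<alpha> - Poly_Mapping.single i l"] poly_mapping_eqI)
    (auto simp: lookup_add lookup_minus lookup_single when_def)

lemma mpow_upd: "mpow (y(i := s)) \<alpha> = s ^ Poly_Mapping.lookup \<alpha> i * mpow (y(i := 1)) \<alpha>"
  by (induction \<alpha> rule: multi_index_induct) (auto simp: mpow_add lookup_add lookup_single when_def)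

text \<open>Strong induction on the exponent \<open>l\<close> of the variable \<open>i\<close>. The
  coefficients with smaller exponent vanish, so \<open>y i ^ l\<close> can be divided out; the
  quotient is O(|y i|^(N - l)) and therefore vanishes on the hyperplane \<open>y i = 0\<close>,
  where the identity theorem applies.\<close>

lemma coeff_zero_of_order:
  fixes c :: "('i \<Rightarrow>\<^sub>0 nat) \<Rightarrow> real"
  assumes q: "1 \<le> q" and R: "0 < R" and c: "ball_convergent q c R"
    and le: "\<And>y. y \<in> lq_ball q UNIV R \<Longrightarrow> \<bar>msum c y\<bar> \<le> K * \<bar>y i\<bar> ^ N"
  shows "Poly_Mapping.lookup \<alpha> i < N \<Longrightarrow> c \<alpha> = 0"
proof (induction "Poly_Mapping.lookup \<alpha> i" arbitrary: \<alpha> rule: less_induct)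
  case less
  define l where "l = Poly_Mapping.lookup \<alpha> i"
  have l: "l < N" using less.prems by (simp add: l_def)
  have low: "c \<beta> = 0" if "Poly_Mapping.lookup \<beta> i < l" for \<beta>
    using less.hyps[of \<beta>] that l by (simp add: l_def)
  \<comment> \<open>\<open>c'\<close> is the series divided by \<open>y i ^ l\<close>, and
    \<open>c0\<close> is the part of it that does not involve the variable \<open>i\<close>, that
    is, its restriction to \<open>y i = 0\<close>.\<close>
  define c' where "c' = (\<lambda>\<gamma>. c (\<gamma> + Poly_Mapping.single i l))"
  define c0 where "c0 = (\<lambda>\<gamma>. if Poly_Mapping.lookup \<gamma> i = 0 then c' \<gamma> else 0)"
  have c': "ball_convergent q c' R" unfolding c'_def by (rule ball_convergent_shift[OF q c])
  have c0: "ball_convergent q c0 R" by (rule ball_convergent_le[OF c']) (simp add: c0_def)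
  have fac: "msum c y = y i ^ l * msum c' y" for y
    unfolding c'_def
    by (subst msum_factor[where \<beta>="Poly_Mapping.single i l"])
      (metis low split_single not_less, simp)
  have "msum c0 y = 0" if y: "y \<in> lq_ball q UNIV R" for y
  proof -
    let ?y = "y(i := 0)"
    have y0: "?y \<in> lq_ball q UNIV R" by (rule lq_ball_solid[OF q y]) auto
    have "msum c0 y = msum c' ?y"
      unfolding monomial_sum_def
    proof (rule infsum_cong)
      fix \<gamma>
      have "mpow y \<gamma> = mpow ?y \<gamma>" if "Poly_Mapping.lookup \<gamma> i = 0"
        using that by (intro mpow_cong) (auto simp: in_keys_iff)
      then show "c0 \<gamma> * mpow y \<gamma> = c' \<gamma> * mpow ?y \<gamma>"
        using mpow_upd[of y i 0 \<gamma>] by (auto simp: c0_def)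
    qed
    also have "msum c' ?y = 0"
    proof (rule tendsto_unique)
      have "((\<lambda>s. msum c' (?y(i := s))) has_field_derivative msum (dcoef i c') ?y) (at (?y i))"
        by (rule msum_has_partial_derivative[OF q c' y0])
      then have "isCont (\<lambda>s. msum c' (?y(i := s))) (?y i)" by (rule DERIV_isCont)
      then show "((\<lambda>s. msum c' (y(i := s))) \<longlongrightarrow> msum c' ?y) (at 0)"
        by (simp add: isCont_def)
      show "((\<lambda>s. msum c' (y(i := s))) \<longlongrightarrow> 0) (at 0)"
      proof (rule Lim_null_comparison)
        have "\<forall>\<^sub>F s in nhds (?y i). ?y(i := s) \<in> lq_ball q UNIV R"
          by (rule lq_ball_upd_eventually[OF q y0])
        then have ev: "\<forall>\<^sub>F s in at 0. y(i := s) \<in> lq_ball q UNIV R"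
          by (simp add: eventually_at_filter) (erule eventually_mono, simp)
        have "\<forall>\<^sub>F s :: real in at 0. s \<noteq> 0" by (simp add: eventually_at_filter)
        with ev show "\<forall>\<^sub>F s in at 0. norm (msum c' (y(i := s))) \<le> K * \<bar>s\<bar> ^ (N - l)"
        proof eventually_elim
          case (elim s)
          have "\<bar>s\<bar> ^ l * \<bar>msum c' (y(i := s))\<bar> \<le> K * \<bar>s\<bar> ^ N"
            using le[OF elim(1)] fac[of "y(i := s)"] by (simp add: abs_mult power_abs)
          also have "\<bar>s\<bar> ^ N = \<bar>s\<bar> ^ l * \<bar>s\<bar> ^ (N - l)" using l by (simp flip: power_add)
          also have "K * (\<bar>s\<bar> ^ l * \<bar>s\<bar> ^ (N - l)) = \<bar>s\<bar> ^ l * (K * \<bar>s\<bar> ^ (N - l))" by simp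
          finally show ?case using elim(2) by (simp add: fun_upd_def)
        qed
        have "((\<lambda>s. K * \<bar>s\<bar> ^ (N - l)) \<longlongrightarrow> K * \<bar>0\<bar> ^ (N - l)) (at 0)"
          by (intro tendsto_intros)
        then show "((\<lambda>s. K * \<bar>s\<bar> ^ (N - l)) \<longlongrightarrow> 0) (at 0)" using l by (simp add: power_0_left)
      qed
    qed simp
    finally show ?thesis .
  qed
  moreover have "msum (\<lambda>_. 0) y = 0" for y :: "'i \<Rightarrow> real" by (simp add: monomial_sum_def)
  moreover have "ball_convergent q (\<lambda>_ :: 'i \<Rightarrow>\<^sub>0 nat. 0) R" by (rule ball_convergent_le[OF c]) simp
  ultimately have z: "c0 = (\<lambda>_. 0)" by (intro msum_identity[OF q R c0]) auto
  obtain \<gamma> where \<gamma>: "\<alpha> = \<gamma> + Poly_Mapping.single i l" using split_single[of l \<alpha> i] by (auto simp: l_def)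
  have "Poly_Mapping.lookup \<alpha> i = Poly_Mapping.lookup \<gamma> i + l" by (subst \<gamma>) (simp add: lookup_add)
  then have "Poly_Mapping.lookup \<gamma> i = 0" by (simp add: l_def)
  then show ?case using fun_cong[OF z, of \<gamma>] \<gamma> by (simp add: c0_def c'_def)
qed


section \<open>Weighted \<open>\<ell>\<^sup>1\<close> algebras of monomial series\<close>

lemma sums_bounded_fibers:
  assumes f: "sums_bounded f A K" and f0: "\<And>x. x \<in> A \<Longrightarrow> 0 \<le> f x"
  shows "sums_bounded (\<lambda>\<gamma>. infsum f {x\<in>A. \<pi> x = \<gamma>}) UNIV K"
proof (rule sums_boundedI)
  fix S :: "'b set" assume S: "finite S"
  have sm: "f summable_on B" if "B \<subseteq> A" for B
    using summable_on_subset[OF sums_bounded_summable[OF f f0] that] .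
  have "(\<Sum>\<gamma>\<in>S. infsum f {x\<in>A. \<pi> x = \<gamma>}) = infsum f (\<Union>\<gamma>\<in>S. {x\<in>A. \<pi> x = \<gamma>})"
    by (rule sum_infsum[OF S sm]) auto
  also have "\<dots> \<le> infsum f A" by (rule infsum_mono_neutral[OF sm sm]) (use f0 in auto)
  also have "\<dots> \<le> K" using f f0 by (rule sums_bounded_infsum)
  finally show "(\<Sum>\<gamma>\<in>S. infsum f {x\<in>A. \<pi> x = \<gamma>}) \<le> K" .
qed

lemma infsum_fibers:
  fixes f :: "'a \<Rightarrow> real"
  assumes "f summable_on A"
  shows "infsum f A = (\<Sum>\<^sub>\<infinity>\<gamma>. infsum f {x\<in>A. \<pi> x = \<gamma>})"
proof -
  have bij: "bij_betw snd (Sigma UNIV (\<lambda>\<gamma>. {x\<in>A. \<pi> x = \<gamma>})) A"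
    by (rule bij_betwI[of _ _ _ "\<lambda>x. (\<pi> x, x)"]) auto
  have "(\<lambda>z. f (snd z)) summable_on Sigma UNIV (\<lambda>\<gamma>. {x\<in>A. \<pi> x = \<gamma>})"
    using summable_on_reindex_bij_betw[OF bij, of f] assms by simp
  then have "infsum (\<lambda>z. f (snd z)) (Sigma UNIV (\<lambda>\<gamma>. {x\<in>A. \<pi> x = \<gamma>}))
      = (\<Sum>\<^sub>\<infinity>\<gamma>. infsum f {x\<in>A. \<pi> x = \<gamma>})"
    using infsum_Sigma_banach[of "\<lambda>z. f (snd z)" UNIV "\<lambda>\<gamma>. {x\<in>A. \<pi> x = \<gamma>}"] by simp
  then show ?thesis using infsum_reindex_bij_betw[OF bij, of f] by simp
qed

lemma sums_bounded_Times:
  assumes f0: "\<And>x y. x \<in> A \<Longrightarrow> y \<in> B \<Longrightarrow> 0 \<le> f (x, y)"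
    and f: "\<And>x. x \<in> A \<Longrightarrow> sums_bounded (\<lambda>y. f (x, y)) B (L x)" and L: "sums_bounded L A M"
  shows "sums_bounded f (A \<times> B) M"
proof (rule sums_boundedI)
  fix S assume S: "S \<subseteq> A \<times> B" "finite S"
  have fin: "finite (fst ` S)" "finite (snd ` S)" "fst ` S \<subseteq> A" "snd ` S \<subseteq> B" using S by auto
  have "sum f S \<le> sum f (fst ` S \<times> snd ` S)"
  proof (rule sum_mono2)
    show "S \<subseteq> fst ` S \<times> snd ` S" by force
    show "0 \<le> f b" if "b \<in> fst ` S \<times> snd ` S - S" for b using that fin f0 by auto
  qed (use fin in auto)
  also have "\<dots> = (\<Sum>x\<in>fst ` S. \<Sum>y\<in>snd ` S. f (x, y))" by (simp add: sum.cartesian_product)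
  also have "\<dots> \<le> (\<Sum>x\<in>fst ` S. L x)"
    using fin by (intro sum_mono sums_boundedD[OF f]) auto
  also have "\<dots> \<le> M" using fin by (intro sums_boundedD[OF L])
  finally show "sum f S \<le> M" .
qed

section \<open>Products and substitution of weighted series\<close>

definition submult_weight :: "(('i \<Rightarrow>\<^sub>0 nat) \<Rightarrow> real) \<Rightarrow> bool" where
  "submult_weight \<omega> \<longleftrightarrow> (\<forall>\<alpha>. 0 < \<omega> \<alpha>) \<and> \<omega> 0 = 1 \<and> (\<forall>\<alpha> \<beta>. \<omega> (\<alpha> + \<beta>) \<le> \<omega> \<alpha> * \<omega> \<beta>)"

definition wnorm_le :: "(('i \<Rightarrow>\<^sub>0 nat) \<Rightarrow> real) \<Rightarrow> (('i \<Rightarrow>\<^sub>0 nat) \<Rightarrow> real) \<Rightarrow> real \<Rightarrow> bool" where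
  "wnorm_le \<omega> c M \<longleftrightarrow> sums_bounded (\<lambda>\<alpha>. \<bar>c \<alpha>\<bar> * \<omega> \<alpha>) UNIV M"

text \<open>At such points evaluation is bounded by the weighted norm; identities for products and
  compositions are asserted there only.\<close>

definition dominated_by :: "(('i \<Rightarrow>\<^sub>0 nat) \<Rightarrow> real) \<Rightarrow> ('i \<Rightarrow> real) \<Rightarrow> bool" where
  "dominated_by \<omega> y \<longleftrightarrow> (\<forall>\<alpha>. \<bar>mpow y \<alpha>\<bar> \<le> \<omega> \<alpha>)"

lemma wnorm_le_dominated:
  assumes "wnorm_le \<omega> c M" "dominated_by \<omega> y"
  shows "sums_bounded (\<lambda>\<alpha>. \<bar>c \<alpha> * mpow y \<alpha>\<bar>) UNIV M"
  by (rule sums_bounded_le[OF assms(1)[unfolded wnorm_le_def]])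
    (use assms(2) in \<open>auto simp: abs_mult dominated_by_def intro: mult_left_mono\<close>)

lemma wnorm_le_msum:
  assumes "wnorm_le \<omega> c M" "dominated_by \<omega> y" shows "\<bar>msum c y\<bar> \<le> M"
  using sums_bounded_abs_infsum(2)[OF wnorm_le_dominated[OF assms]] by (simp add: monomial_sum_def)

text \<open>\<open>e\<close> is the Cauchy product, written as a sum over the fibres of addition.
  Submultiplicativity of the weight bounds the double family by a product of two norms, which
  justifies every rearrangement.\<close>

lemma wnorm_mult:
  fixes \<omega> :: "('i \<Rightarrow>\<^sub>0 nat) \<Rightarrow> real"
  assumes \<omega>: "submult_weight \<omega>" and c: "wnorm_le \<omega> c M" and d: "wnorm_le \<omega> d N"
  shows "\<exists>e. wnorm_le \<omega> e (M * N) \<and> (\<forall>y. dominated_by \<omega> y \<longrightarrow> msum e y = msum c y * msum d y)"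
proof -
  let ?P = "UNIV \<times> UNIV :: (('i \<Rightarrow>\<^sub>0 nat) \<times> ('i \<Rightarrow>\<^sub>0 nat)) set"
  let ?fib = "\<lambda>\<gamma>. {x \<in> ?P. fst x + snd x = \<gamma>}"
  define e where "e = (\<lambda>\<gamma>. infsum (\<lambda>x. c (fst x) * d (snd x)) (?fib \<gamma>))"
  have \<omega>0: "0 < \<omega> \<alpha>" for \<alpha> using \<omega> by (simp add: submult_weight_def)
  define f where "f = (\<lambda>x. \<bar>c (fst x)\<bar> * \<omega> (fst x) * (\<bar>d (snd x)\<bar> * \<omega> (snd x)))"
  have f0: "0 \<le> f x" for x using \<omega>0 by (simp add: f_def less_imp_le)
  have fb: "sums_bounded f ?P (M * N)"
  proof (rule sums_bounded_Times[where L="\<lambda>\<alpha>. N * (\<bar>c \<alpha>\<bar> * \<omega> \<alpha>)"])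
    fix \<alpha>
    show "sums_bounded (\<lambda>\<beta>. f (\<alpha>, \<beta>)) UNIV (N * (\<bar>c \<alpha>\<bar> * \<omega> \<alpha>))"
      using sums_bounded_scale[OF d[unfolded wnorm_le_def], of "\<lambda>\<beta>. f (\<alpha>, \<beta>)" "\<bar>c \<alpha>\<bar> * \<omega> \<alpha>"] \<omega>0
      by (simp add: f_def less_imp_le mult.commute)
  next
    have "0 \<le> N" using d by (auto simp: wnorm_le_def intro: sums_bounded_nonneg)
    then show "sums_bounded (\<lambda>\<alpha>. N * (\<bar>c \<alpha>\<bar> * \<omega> \<alpha>)) UNIV (M * N)"
      using sums_bounded_scale[OF c[unfolded wnorm_le_def], of "\<lambda>\<alpha>. N * (\<bar>c \<alpha>\<bar> * \<omega> \<alpha>)" N]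
      by (simp add: mult.commute)
  qed (rule f0)
  have fs: "f summable_on B" if "B \<subseteq> ?P" for B
    using summable_on_subset[OF sums_bounded_summable[OF fb f0] that] .
  have le: "\<bar>c (fst x) * d (snd x)\<bar> * \<omega> \<gamma> \<le> f x" if "fst x + snd x = \<gamma>" for x \<gamma>
  proof -
    have "\<bar>c (fst x) * d (snd x)\<bar> * \<omega> \<gamma> \<le> \<bar>c (fst x) * d (snd x)\<bar> * (\<omega> (fst x) * \<omega> (snd x))"
      using \<omega> that by (intro mult_left_mono) (auto simp: submult_weight_def)
    then show ?thesis by (simp add: f_def abs_mult mult_ac)
  qed
  have eb: "\<bar>e \<gamma>\<bar> * \<omega> \<gamma> \<le> infsum f (?fib \<gamma>)" for \<gamma>
  proof -
    have sm: "(\<lambda>x. norm (c (fst x) * d (snd x) * \<omega> \<gamma>)) summable_on ?fib \<gamma>"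
      by (rule summable_on_comparison_test[OF fs]) (use le \<omega>0 in \<open>auto simp: abs_mult less_imp_le\<close>)
    have "\<bar>e \<gamma>\<bar> * \<omega> \<gamma> = \<bar>infsum (\<lambda>x. c (fst x) * d (snd x) * \<omega> \<gamma>) (?fib \<gamma>)\<bar>"
      unfolding infsum_cmult_left' e_def using \<omega>0[of \<gamma>] by (simp add: abs_mult)
    also have "\<dots> \<le> infsum (\<lambda>x. norm (c (fst x) * d (snd x) * \<omega> \<gamma>)) (?fib \<gamma>)"
      using norm_infsum_bound[OF sm] by simp
    also have "\<dots> \<le> infsum f (?fib \<gamma>)"
      by (rule infsum_mono[OF sm fs]) (use le \<omega>0 in \<open>auto simp: abs_mult less_imp_le\<close>)
    finally show ?thesis .
  qed
  have "wnorm_le \<omega> e (M * N)"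
    unfolding wnorm_le_def
    by (rule sums_bounded_le[OF sums_bounded_fibers[OF fb f0]]) (use eb in auto)
  moreover have "msum e y = msum c y * msum d y" if y: "dominated_by \<omega> y" for y
  proof -
    let ?g = "\<lambda>x. c (fst x) * mpow y (fst x) * (d (snd x) * mpow y (snd x))"
    have gs: "?g summable_on ?P"
    proof (rule sums_bounded_abs_infsum(1)[OF sums_bounded_le[OF fb]])
      fix x
      show "\<bar>?g x\<bar> \<le> f x"
        using y \<omega>0 unfolding f_def abs_mult dominated_by_def
        by (intro mult_mono mult_left_mono) (auto simp: less_imp_le)
    qed
    have "msum c y * msum d y = (\<Sum>\<^sub>\<infinity>\<alpha>. \<Sum>\<^sub>\<infinity>\<beta>. c \<alpha> * mpow y \<alpha> * (d \<beta> * mpow y \<beta>))"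
      unfolding monomial_sum_def multi_indices_UNIV infsum_cmult_right' infsum_cmult_left' ..
    also have "\<dots> = infsum ?g ?P"
      using infsum_Sigma_banach[OF gs] by simp
    also have "\<dots> = (\<Sum>\<^sub>\<infinity>\<gamma>. infsum ?g (?fib \<gamma>))" by (rule infsum_fibers[OF gs])
    also have "\<dots> = msum e y"
      unfolding monomial_sum_def multi_indices_UNIV
    proof (rule infsum_cong)
      fix \<gamma>
      have "infsum ?g (?fib \<gamma>) = infsum (\<lambda>x. c (fst x) * d (snd x) * mpow y \<gamma>) (?fib \<gamma>)"
        by (rule infsum_cong) (auto simp: mpow_add)
      then show "infsum ?g (?fib \<gamma>) = e \<gamma> * mpow y \<gamma>" unfolding infsum_cmult_left' e_def .
    qed
    finally show ?thesis ..
  qed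
  ultimately show ?thesis by blast
qed

lemma wnorm_mpow:
  fixes \<omega> :: "('i \<Rightarrow>\<^sub>0 nat) \<Rightarrow> real" and z :: "'j \<Rightarrow> ('i \<Rightarrow>\<^sub>0 nat) \<Rightarrow> real"
  assumes \<omega>: "submult_weight \<omega>" and z: "\<And>j. j \<in> I \<Longrightarrow> wnorm_le \<omega> (z j) (\<rho> j)"
  shows "\<alpha> \<in> multi_indices I \<Longrightarrow> \<exists>e. wnorm_le \<omega> e (mpow \<rho> \<alpha>) \<and>
     (\<forall>y. dominated_by \<omega> y \<longrightarrow> msum e y = mpow (\<lambda>j. msum (z j) y) \<alpha>)"
proof (induction \<alpha> rule: multi_index_induct)
  case zero
  let ?e = "\<lambda>\<gamma>. if \<gamma> = 0 then 1 else (0::real)"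
  have "wnorm_le \<omega> ?e 1"
    unfolding wnorm_le_def
  proof (rule sums_boundedI)
    fix S :: "('i \<Rightarrow>\<^sub>0 nat) set" assume "finite S"
    have "(\<Sum>\<alpha>\<in>S. \<bar>?e \<alpha>\<bar> * \<omega> \<alpha>) = (\<Sum>\<alpha>\<in>S. if \<alpha> = 0 then 1 else 0)"
      using \<omega> by (intro sum.cong) (auto simp: submult_weight_def)
    then show "(\<Sum>\<alpha>\<in>S. \<bar>?e \<alpha>\<bar> * \<omega> \<alpha>) \<le> 1" using \<open>finite S\<close> by simp
  qed
  moreover have "msum ?e y = 1" for y
  proof -
    have "msum ?e y = (\<Sum>\<^sub>\<infinity>\<gamma>\<in>{0}. ?e \<gamma> * mpow y \<gamma>)"
      unfolding monomial_sum_def by (rule infsum_cong_neutral) auto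
    then show ?thesis by simp
  qed
  ultimately show ?case by auto
next
  case (add \<alpha> i)
  then have "\<alpha> \<in> multi_indices I" and i: "i \<in> I" by (auto simp: multi_indices_def keys_add_nat)
  then obtain e where e: "wnorm_le \<omega> e (mpow \<rho> \<alpha>)"
    "\<And>y. dominated_by \<omega> y \<Longrightarrow> msum e y = mpow (\<lambda>j. msum (z j) y) \<alpha>" using add.IH by blast
  from wnorm_mult[OF \<omega> e(1) z[OF i]] show ?case
    unfolding mpow_add using e(2) by auto
qed

text \<open>Absolute convergence of the outer series at the norms \<rho> of the inner series
  controls the double family indexed by outer and inner monomials; regrouping it by inner monomials
  gives the coefficients. There may be infinitely many inner series.\<close>

lemma wnorm_composition:
  fixes \<omega> :: "('i \<Rightarrow>\<^sub>0 nat) \<Rightarrow> real" and z :: "'j \<Rightarrow> ('i \<Rightarrow>\<^sub>0 nat) \<Rightarrow> real"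
  assumes \<omega>: "submult_weight \<omega>" and z: "\<And>j. j \<in> I \<Longrightarrow> wnorm_le \<omega> (z j) (\<rho> j)"
    and C: "sums_bounded (\<lambda>\<alpha>. \<bar>C \<alpha>\<bar> * mpow \<rho> \<alpha>) (multi_indices I) M"
  shows "\<exists>e. wnorm_le \<omega> e M \<and>
     (\<forall>y. dominated_by \<omega> y \<longrightarrow> msum e y = monomial_sum I C (\<lambda>j. msum (z j) y))"
proof -
  let ?A = "multi_indices I" and ?U = "UNIV :: ('i \<Rightarrow>\<^sub>0 nat) set"
  have "\<forall>\<alpha>\<in>?A. \<exists>e. wnorm_le \<omega> e (mpow \<rho> \<alpha>) \<and>
     (\<forall>y. dominated_by \<omega> y \<longrightarrow> msum e y = mpow (\<lambda>j. msum (z j) y) \<alpha>)"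
    using wnorm_mpow[of \<omega> I z \<rho>, OF \<omega> z] by blast
  then obtain E where E: "\<And>\<alpha>. \<alpha> \<in> ?A \<Longrightarrow> wnorm_le \<omega> (E \<alpha>) (mpow \<rho> \<alpha>)"
    "\<And>\<alpha> y. \<alpha> \<in> ?A \<Longrightarrow> dominated_by \<omega> y \<Longrightarrow> msum (E \<alpha>) y = mpow (\<lambda>j. msum (z j) y) \<alpha>" by metis
  have \<omega>0: "0 < \<omega> \<alpha>" for \<alpha> using \<omega> by (simp add: submult_weight_def)
  define e where "e = (\<lambda>\<gamma>. \<Sum>\<^sub>\<infinity>\<alpha>\<in>?A. C \<alpha> * E \<alpha> \<gamma>)"
  define f where "f = (\<lambda>x. \<bar>C (fst x) * E (fst x) (snd x)\<bar> * \<omega> (snd x))"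
  have f0: "0 \<le> f x" for x using \<omega>0 by (simp add: f_def less_imp_le)
  have fb: "sums_bounded f (?A \<times> ?U) M"
  proof (rule sums_bounded_Times[OF _ _ C])
    fix \<alpha> assume "\<alpha> \<in> ?A"
    from sums_bounded_scale[OF E(1)[OF this, unfolded wnorm_le_def], of "\<lambda>\<gamma>. f (\<alpha>, \<gamma>)" "\<bar>C \<alpha>\<bar>"]
    show "sums_bounded (\<lambda>\<gamma>. f (\<alpha>, \<gamma>)) UNIV (\<bar>C \<alpha>\<bar> * mpow \<rho> \<alpha>)"
      by (simp add: f_def abs_mult mult.assoc)
  qed (rule f0)
  have eb: "\<bar>e \<gamma>\<bar> * \<omega> \<gamma> \<le> infsum f {x \<in> ?A \<times> ?U. snd x = \<gamma>}" for \<gamma>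
  proof -
    have bij: "bij_betw (\<lambda>\<alpha>. (\<alpha>, \<gamma>)) ?A {x \<in> ?A \<times> ?U. snd x = \<gamma>}"
      by (rule bij_betwI[of _ _ _ fst]) auto
    have "f summable_on {x \<in> ?A \<times> ?U. snd x = \<gamma>}"
      by (rule summable_on_subset[OF sums_bounded_summable[OF fb f0]]) auto
    then have sm: "(\<lambda>\<alpha>. f (\<alpha>, \<gamma>)) summable_on ?A"
      using summable_on_reindex_bij_betw[OF bij, of f] by simp
    have fe: "f (\<alpha>, \<gamma>) = norm (C \<alpha> * E \<alpha> \<gamma> * \<omega> \<gamma>)" for \<alpha>
      using \<omega>0[of \<gamma>] by (simp add: f_def abs_mult)
    have "\<bar>e \<gamma>\<bar> * \<omega> \<gamma> = norm (\<Sum>\<^sub>\<infinity>\<alpha>\<in>?A. C \<alpha> * E \<alpha> \<gamma> * \<omega> \<gamma>)"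
      unfolding infsum_cmult_left' e_def using \<omega>0[of \<gamma>] by (simp add: abs_mult)
    also have "\<dots> \<le> (\<Sum>\<^sub>\<infinity>\<alpha>\<in>?A. f (\<alpha>, \<gamma>))"
      using norm_infsum_bound[of "\<lambda>\<alpha>. C \<alpha> * E \<alpha> \<gamma> * \<omega> \<gamma>" ?A] sm by (simp add: fe)
    also have "\<dots> = infsum f {x \<in> ?A \<times> ?U. snd x = \<gamma>}" by (rule infsum_reindex_bij_betw[OF bij])
    finally show ?thesis .
  qed
  have "wnorm_le \<omega> e M"
    unfolding wnorm_le_def
    by (rule sums_bounded_le[OF sums_bounded_fibers[OF fb f0]]) (use eb in auto)
  moreover have "msum e y = monomial_sum I C (\<lambda>j. msum (z j) y)" if y: "dominated_by \<omega> y" for y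
  proof -
    let ?g = "\<lambda>(\<alpha>, \<gamma>). C \<alpha> * E \<alpha> \<gamma> * mpow y \<gamma>"
    have gs: "?g summable_on ?A \<times> ?U"
    proof (rule sums_bounded_abs_infsum(1)[OF sums_bounded_le[OF fb]])
      fix x
      show "\<bar>?g x\<bar> \<le> f x"
        using y by (cases x) (auto simp: f_def abs_mult dominated_by_def intro!: mult_left_mono)
    qed
    have "msum e y = (\<Sum>\<^sub>\<infinity>\<gamma>. \<Sum>\<^sub>\<infinity>\<alpha>\<in>?A. C \<alpha> * E \<alpha> \<gamma> * mpow y \<gamma>)"
      unfolding monomial_sum_def multi_indices_UNIV e_def infsum_cmult_left' ..
    also have "\<dots> = (\<Sum>\<^sub>\<infinity>\<alpha>\<in>?A. \<Sum>\<^sub>\<infinity>\<gamma>. C \<alpha> * E \<alpha> \<gamma> * mpow y \<gamma>)"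
      by (rule infsum_swap_banach[OF gs, symmetric])
    also have "\<dots> = (\<Sum>\<^sub>\<infinity>\<alpha>\<in>?A. C \<alpha> * mpow (\<lambda>j. msum (z j) y) \<alpha>)"
    proof (rule infsum_cong)
      fix \<alpha> assume "\<alpha> \<in> ?A"
      then show "(\<Sum>\<^sub>\<infinity>\<gamma>. C \<alpha> * E \<alpha> \<gamma> * mpow y \<gamma>) = C \<alpha> * mpow (\<lambda>j. msum (z j) y) \<alpha>"
        using E(2)[OF _ y, of \<alpha>] by (simp add: mult.assoc infsum_cmult_right' monomial_sum_def)
    qed
    finally show ?thesis by (simp add: monomial_sum_def)
  qed
  ultimately show ?thesis by blast
qed

subsection \<open>The weight of a geometric majorant\<close>

text \<open>
  \<open>1 / geo_weight r \<kappa> \<alpha>\<close> is the coefficient of \<open>y\<^sup>\<alpha>\<close> in the geometric series of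
  \<open>(\<Sum>i. \<kappa> i * y i) / r\<close>.
\<close>
definition geo_weight :: "real \<Rightarrow> ('i \<Rightarrow> real) \<Rightarrow> ('i \<Rightarrow>\<^sub>0 nat) \<Rightarrow> real" where
  "geo_weight r \<kappa> \<alpha> = mfact \<alpha> / fact (mdeg \<alpha>) * r ^ mdeg \<alpha> / mpow \<kappa> \<alpha>"

text \<open>The weight contains inverse multinomial coefficients, so \<open>mfact_add_le\<close>
  gives submultiplicativity.\<close>

lemma submult_geo_weight:
  fixes \<kappa> :: "'i \<Rightarrow> real"
  assumes r: "0 < r" and \<kappa>: "\<And>i. 0 < \<kappa> i" shows "submult_weight (geo_weight r \<kappa>)"
  unfolding submult_weight_def
proof (intro conjI allI)
  show "0 < geo_weight r \<kappa> \<alpha>" for \<alpha>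
    using r mpow_pos[of \<kappa> \<alpha>] \<kappa> by (simp add: geo_weight_def)
  show "geo_weight r \<kappa> 0 = 1" by (simp add: geo_weight_def)
  fix \<alpha> \<beta> :: "'i \<Rightarrow>\<^sub>0 nat"
  have "mfact (\<alpha> + \<beta>) / fact (mdeg (\<alpha> + \<beta>)) \<le> mfact \<alpha> / fact (mdeg \<alpha>) * (mfact \<beta> / fact (mdeg \<beta>))"
    using mfact_add_le[of \<alpha> \<beta>] by (simp add: field_simps)
  then have "mfact (\<alpha> + \<beta>) / fact (mdeg (\<alpha> + \<beta>)) * (r ^ mdeg (\<alpha> + \<beta>) / mpow \<kappa> (\<alpha> + \<beta>))
      \<le> mfact \<alpha> / fact (mdeg \<alpha>) * (mfact \<beta> / fact (mdeg \<beta>)) * (r ^ mdeg (\<alpha> + \<beta>) / mpow \<kappa> (\<alpha> + \<beta>))"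
    using r mpow_pos[of \<kappa> "\<alpha> + \<beta>"] \<kappa> by (intro mult_right_mono) auto
  then show "geo_weight r \<kappa> (\<alpha> + \<beta>) \<le> geo_weight r \<kappa> \<alpha> * geo_weight r \<kappa> \<beta>"
    by (simp add: geo_weight_def mdeg_add mpow_add power_add mult_ac)
qed

text \<open>The multinomial theorem for the power \<open>mdeg \<alpha>\<close> of the sum of the
  \<open>\<kappa> i * \<bar>y i\<bar>\<close>, of which a single term is retained.\<close>

lemma dominated_by_geo_weight:
  assumes \<kappa>: "\<And>i. 0 < \<kappa> i" and y: "sums_bounded (\<lambda>i. \<kappa> i * \<bar>y i\<bar>) UNIV r"
  shows "dominated_by (geo_weight r \<kappa>) y"
  unfolding dominated_by_def
proof
  fix \<alpha>
  have "fact (mdeg \<alpha>) * mpow (\<lambda>i. \<kappa> i * \<bar>y i\<bar>) \<alpha> \<le> mfact \<alpha> * r ^ mdeg \<alpha>"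
    using \<kappa> y by (intro mpow_fact_le) (auto simp: less_imp_le sums_bounded_def)
  then have "fact (mdeg \<alpha>) * (mpow \<kappa> \<alpha> * \<bar>mpow y \<alpha>\<bar>) \<le> mfact \<alpha> * r ^ mdeg \<alpha>"
    by (simp add: mpow_mult abs_mpow)
  then show "\<bar>mpow y \<alpha>\<bar> \<le> geo_weight r \<kappa> \<alpha>"
    using mpow_pos[of \<kappa> \<alpha>] \<kappa> by (simp add: geo_weight_def field_simps)
qed

subsection \<open>A Lipschitz estimate\<close>

lemma mpow_lipschitz:
  assumes "\<And>i. i \<in> I \<Longrightarrow> \<bar>a i\<bar> \<le> \<rho> i / 2" "\<And>i. i \<in> I \<Longrightarrow> \<bar>b i\<bar> \<le> \<rho> i / 2"
    and "\<And>i. i \<in> I \<Longrightarrow> \<bar>a i - b i\<bar> \<le> \<eta> * (\<rho> i / 2)" and \<eta>: "0 \<le> \<eta>"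
  shows "\<alpha> \<in> multi_indices I \<Longrightarrow>
    \<bar>mpow a \<alpha> - mpow b \<alpha>\<bar> \<le> real (mdeg \<alpha>) * \<eta> * mpow (\<lambda>i. \<rho> i / 2) \<alpha>"
proof (induction \<alpha> rule: multi_index_induct)
  case (add \<alpha> i)
  then have \<alpha>: "\<alpha> \<in> multi_indices I" and i: "i \<in> I" by (auto simp: multi_indices_def keys_add_nat)
  let ?Q = "mpow (\<lambda>i. \<rho> i / 2) \<alpha>"
  have b: "\<bar>mpow b \<alpha>\<bar> \<le> ?Q"
    unfolding abs_mpow using assms(2) \<alpha> by (intro mpow_mono_on) (auto simp: multi_indices_def)
  have Q: "0 \<le> ?Q" using b abs_ge_zero order_trans by blast
  have "mpow a (\<alpha> + unit_index i) - mpow b (\<alpha> + unit_index i)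
      = a i * (mpow a \<alpha> - mpow b \<alpha>) + (a i - b i) * mpow b \<alpha>" by (simp add: mpow_add algebra_simps)
  then have "\<bar>mpow a (\<alpha> + unit_index i) - mpow b (\<alpha> + unit_index i)\<bar>
      \<le> \<bar>a i\<bar> * \<bar>mpow a \<alpha> - mpow b \<alpha>\<bar> + \<bar>a i - b i\<bar> * \<bar>mpow b \<alpha>\<bar>"
    unfolding abs_mult[symmetric] by linarith
  also have "\<dots> \<le> (\<rho> i / 2) * (real (mdeg \<alpha>) * \<eta> * ?Q) + (\<eta> * (\<rho> i / 2)) * ?Q"
    using assms(1,3)[OF i] add.IH[OF \<alpha>] b Q \<eta> by (intro add_mono mult_mono) (auto intro: order_trans[OF abs_ge_zero])
  also have "\<dots> = real (mdeg (\<alpha> + unit_index i)) * \<eta> * mpow (\<lambda>i. \<rho> i / 2) (\<alpha> + unit_index i)"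
    by (simp add: mpow_add mdeg_add algebra_simps)
  finally show ?case .
qed simp

text \<open>Replacing the factors one by one costs a factor \<open>mdeg \<alpha>\<close>; staying in
  half of the polydisc gains \<open>(1 / 2) ^ mdeg \<alpha>\<close>, which absorbs it. Differences
  are measured relative to \<rho>, so the estimate is uniform in infinitely many variables.\<close>

lemma monomial_sum_lipschitz:
  assumes C: "sums_bounded (\<lambda>\<alpha>. \<bar>C \<alpha>\<bar> * mpow \<rho> \<alpha>) (multi_indices I) M"
    and a: "\<And>i. i \<in> I \<Longrightarrow> \<bar>a i\<bar> \<le> \<rho> i / 2" and b: "\<And>i. i \<in> I \<Longrightarrow> \<bar>b i\<bar> \<le> \<rho> i / 2"
    and ab: "\<And>i. i \<in> I \<Longrightarrow> \<bar>a i - b i\<bar> \<le> \<eta> * (\<rho> i / 2)" and \<eta>: "0 \<le> \<eta>"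
  shows "\<bar>monomial_sum I C a - monomial_sum I C b\<bar> \<le> \<eta> * M"
proof -
  have \<rho>: "\<rho> i / 2 \<le> \<rho> i" "0 \<le> \<rho> i" if "i \<in> I" for i
    using a[OF that] order_trans[OF abs_ge_zero a[OF that]] by auto
  have half: "\<bar>mpow v \<alpha>\<bar> \<le> mpow \<rho> \<alpha>" if v: "\<And>i. i \<in> I \<Longrightarrow> \<bar>v i\<bar> \<le> \<rho> i / 2" and \<alpha>: "\<alpha> \<in> multi_indices I" for v \<alpha>
    unfolding abs_mpow using \<alpha> v \<rho> by (intro mpow_mono_on) (fastforce simp: multi_indices_def)
  have sm: "(\<lambda>\<alpha>. C \<alpha> * mpow v \<alpha>) summable_on multi_indices I" if v: "\<And>i. i \<in> I \<Longrightarrow> \<bar>v i\<bar> \<le> \<rho> i / 2" for v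
    by (rule sums_bounded_abs_infsum(1)[OF sums_bounded_le[OF C]])
      (use half[OF v] in \<open>auto simp: abs_mult intro: mult_left_mono\<close>)
  have "\<bar>C \<alpha> * (mpow a \<alpha> - mpow b \<alpha>)\<bar> \<le> \<eta> * (\<bar>C \<alpha>\<bar> * mpow \<rho> \<alpha>)" if \<alpha>: "\<alpha> \<in> multi_indices I" for \<alpha>
  proof -
    have "\<bar>mpow a \<alpha> - mpow b \<alpha>\<bar> \<le> real (mdeg \<alpha>) * \<eta> * mpow (\<lambda>i. (1 / 2) * \<rho> i) \<alpha>"
      using mpow_lipschitz[OF a b ab \<eta> \<alpha>] by simp
    also have "\<dots> = (real (mdeg \<alpha>) * (1 / 2) ^ mdeg \<alpha>) * (\<eta> * mpow \<rho> \<alpha>)"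
      unfolding mpow_scale by simp
    also have "\<dots> \<le> 1 * (\<eta> * mpow \<rho> \<alpha>)"
    proof (rule mult_right_mono)
      have "real (mdeg \<alpha>) \<le> 2 ^ mdeg \<alpha>" using of_nat_mono[OF less_imp_le[OF less_exp[of "mdeg \<alpha>"]]] by simp
      then show "real (mdeg \<alpha>) * (1 / 2) ^ mdeg \<alpha> \<le> 1" by (simp add: power_divide divide_le_eq)
      show "0 \<le> \<eta> * mpow \<rho> \<alpha>" using \<eta> half[OF a \<alpha>] abs_ge_zero order_trans by (metis mult_nonneg_nonneg)
    qed
    finally have "\<bar>C \<alpha>\<bar> * \<bar>mpow a \<alpha> - mpow b \<alpha>\<bar> \<le> \<bar>C \<alpha>\<bar> * (1 * (\<eta> * mpow \<rho> \<alpha>))"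
      by (rule mult_left_mono) simp
    then show ?thesis by (simp add: abs_mult mult_ac)
  qed
  then have bb: "sums_bounded (\<lambda>\<alpha>. \<bar>C \<alpha> * (mpow a \<alpha> - mpow b \<alpha>)\<bar>) (multi_indices I) (\<eta> * M)"
    using \<eta> by (intro sums_bounded_scale[OF C])
  have "((\<lambda>\<alpha>. C \<alpha> * mpow a \<alpha> + - (C \<alpha> * mpow b \<alpha>)) has_sum (monomial_sum I C a + - monomial_sum I C b)) (multi_indices I)"
    unfolding monomial_sum_def using has_sum_infsum[OF sm[OF a]] has_sum_infsum[OF sm[OF b]]
    by (intro has_sum_add) (simp_all add: has_sum_uminus)
  then have "monomial_sum I C a - monomial_sum I C b = (\<Sum>\<^sub>\<infinity>\<alpha>\<in>multi_indices I. C \<alpha> * (mpow a \<alpha> - mpow b \<alpha>))"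
    by (subst infsumI[symmetric]) (auto simp: algebra_simps)
  then show ?thesis using sums_bounded_abs_infsum(2)[OF bb] by simp
qed


section \<open>Space-time multi-indices\<close>

definition tx_multi :: "nat \<Rightarrow> (nat \<Rightarrow>\<^sub>0 nat) \<Rightarrow> tx_index \<Rightarrow>\<^sub>0 nat" where
  "tx_multi j \<beta> = (\<Sum>i\<in>Poly_Mapping.keys \<beta>. Poly_Mapping.single (Space i) (Poly_Mapping.lookup \<beta> i))
     + Poly_Mapping.single Time j"

definition space_part :: "(tx_index \<Rightarrow>\<^sub>0 nat) \<Rightarrow> nat \<Rightarrow>\<^sub>0 nat" where
  "space_part \<gamma> = Poly_Mapping.map_key Space \<gamma>"

abbreviation time_part :: "(tx_index \<Rightarrow>\<^sub>0 nat) \<Rightarrow> nat" where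
  "time_part \<gamma> \<equiv> Poly_Mapping.lookup \<gamma> Time"

lemma lookup_tx_multi [simp]:
  "Poly_Mapping.lookup (tx_multi j \<beta>) Time = j"
  "Poly_Mapping.lookup (tx_multi j \<beta>) (Space i) = Poly_Mapping.lookup \<beta> i"
proof -
  have "(\<Sum>k\<in>Poly_Mapping.keys \<beta>. Poly_Mapping.lookup \<beta> k when Space k = Space i)
      = (\<Sum>k\<in>Poly_Mapping.keys \<beta>. if k = i then Poly_Mapping.lookup \<beta> k else 0)"
    by (rule sum.cong) (auto simp: when_def)
  then show "Poly_Mapping.lookup (tx_multi j \<beta>) (Space i) = Poly_Mapping.lookup \<beta> i"
    by (simp add: tx_multi_def lookup_add lookup_sum lookup_single in_keys_iff)
qed (simp add: tx_multi_def lookup_add lookup_sum lookup_single)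

lemma lookup_space_part [simp]:
  "Poly_Mapping.lookup (space_part \<gamma>) i = Poly_Mapping.lookup \<gamma> (Space i)"
  unfolding space_part_def by (simp add: map_key.rep_eq inj_def)

lemma tx_multi_eqI:
  "Poly_Mapping.lookup \<gamma> Time = Poly_Mapping.lookup \<delta> Time \<Longrightarrow>
   (\<And>i. Poly_Mapping.lookup \<gamma> (Space i) = Poly_Mapping.lookup \<delta> (Space i)) \<Longrightarrow> \<gamma> = \<delta>"
  by (rule poly_mapping_eqI) (metis tx_index.exhaust)

lemma tx_multi_parts [simp]: "tx_multi (time_part \<gamma>) (space_part \<gamma>) = \<gamma>"
  by (rule tx_multi_eqI) auto

lemma space_part_tx_multi [simp]: "space_part (tx_multi j \<beta>) = \<beta>"
  by (rule poly_mapping_eqI) simp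

lemma tx_multi_add: "tx_multi j \<beta> + tx_multi k \<delta> = tx_multi (j + k) (\<beta> + \<delta>)"
  by (rule tx_multi_eqI) (auto simp: lookup_add)

lemma tx_multi_zero: "tx_multi j 0 = Poly_Mapping.single Time j"
  by (simp add: tx_multi_def)

lemma tx_multi_zero_zero [simp]: "tx_multi 0 0 = 0"
  by (simp add: tx_multi_def)

lemma tx_multi_add_unit: "tx_multi j (\<beta> + unit_index i) = tx_multi j \<beta> + unit_index (Space i)"
  by (rule tx_multi_eqI) (auto simp: lookup_add lookup_single when_def)

lemma mdeg_tx_multi [simp]: "mdeg (tx_multi j \<beta>) = j + mdeg \<beta>"
proof (induction \<beta> rule: multi_index_induct)
  case (add \<beta> i)
  then show ?case unfolding tx_multi_add_unit mdeg_add by simp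
qed (simp add: tx_multi_zero)

lemma mpow_tx_multi: "mpow y (tx_multi j \<beta>) = y Time ^ j * mpow (\<lambda>i. y (Space i)) \<beta>"
proof (induction \<beta> rule: multi_index_induct)
  case (add \<beta> i)
  then show ?case unfolding tx_multi_add_unit mpow_add by simp
qed (simp add: tx_multi_zero)

lemma mfact_tx_multi: "mfact (tx_multi j \<beta>) = fact j * mfact \<beta>"
proof (induction \<beta> rule: multi_index_induct)
  case (add \<beta> i)
  then show ?case unfolding tx_multi_add_unit mfact_add_unit by simp
qed (simp add: tx_multi_zero)

lemma list_index_concat: "list_index (concat xss) = (\<Sum>xs\<leftarrow>xss. list_index xs)"
  by (induction xss) auto

lemma list_index_mlist [simp]: "list_index (mlist \<beta>) = \<beta>"
proof -
  have "list_index (mlist \<beta>) = (\<Sum>i\<in>Poly_Mapping.keys \<beta>. Poly_Mapping.single i (Poly_Mapping.lookup \<beta> i))"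
    by (simp add: mlist_def list_index_concat o_def sum_list_distinct_conv_sum_set)
  also have "\<dots> = \<beta>"
    by (rule poly_mapping_eqI)
      (simp add: lookup_sum lookup_single when_def sum.delta in_keys_iff)
  finally show ?thesis .
qed

lemma list_index_tx_derivs [simp]: "list_index (tx_derivs \<beta> j) = tx_multi j \<beta>"
proof -
  have "list_index (map Space (mlist \<beta>))
      = (\<Sum>i\<in>Poly_Mapping.keys \<beta>. Poly_Mapping.single (Space i) (Poly_Mapping.lookup \<beta> i))"
    by (simp add: mlist_def map_concat list_index_concat o_def sum_list_distinct_conv_sum_set)
  then show ?thesis by (simp add: tx_derivs_def tx_multi_def)
qed

lemma length_tx_derivs: "length (tx_derivs \<beta> j) = mdeg \<beta> + j"
  using mdeg_list_index[of "tx_derivs \<beta> j"] by simp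

section \<open>Coefficients of the jets\<close>

text \<open>
  \<open>jet_coef m v i\<close> are the coefficients of the jet coordinate \<open>i\<close> of \<open>msum v\<close>, minus its value at
  the origin.
\<close>
definition jet_coef :: "nat \<Rightarrow> ((tx_index \<Rightarrow>\<^sub>0 nat) \<Rightarrow> real) \<Rightarrow> jet_index \<Rightarrow> (tx_index \<Rightarrow>\<^sub>0 nat) \<Rightarrow> real" where
  "jet_coef m v i \<gamma> = (case i of
      Indep a \<Rightarrow> if \<gamma> = unit_index a then 1 else 0
    | Unknown \<Rightarrow> if \<gamma> = 0 then 0 else v \<gamma>
    | Jet \<beta> j \<Rightarrow> if (\<beta>, j) \<in> jet_orders m \<and> \<gamma> \<noteq> 0 then dcoefs (tx_derivs \<beta> j) v \<gamma> else 0)"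

lemma tx_derivs_zero [simp]: "tx_derivs 0 0 = []"
  by (simp add: tx_derivs_def mlist_def)

text \<open>The unknown itself is treated as the derivative of order \<open>\<beta> = 0\<close>,
  \<open>j = 0\<close>, which \<open>0 < m\<close> admits, so that only coordinate functions and
  derivatives remain.\<close>

lemma jet_coef_cases:
  assumes "i \<in> jet_indices m" "0 < m"
  obtains a where "i = Indep a"
  | \<beta> j where "j < m" "mdeg \<beta> + j \<le> m"
      "\<And>v \<gamma>. jet_coef m v i \<gamma> = (if \<gamma> = 0 then 0 else dcoefs (tx_derivs \<beta> j) v \<gamma>)"
proof (cases i)
  case Unknown
  then show ?thesis using that(2)[of 0 0] assms(2) by (simp add: jet_coef_def)
next
  case (Jet \<beta> j)
  then have "(\<beta>, j) \<in> jet_orders m" using assms by (auto simp: jet_indices_def)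
  then show ?thesis using that(2)[of j \<beta>] Jet by (simp add: jet_coef_def jet_orders_def)
qed (use that(1) in blast)

lemma msum_unit: "msum (\<lambda>\<gamma>. if \<gamma> = unit_index a then 1 else 0) y = y a"
proof -
  have "msum (\<lambda>\<gamma>. if \<gamma> = unit_index a then 1 else 0) y
      = (\<Sum>\<^sub>\<infinity>\<gamma>\<in>{unit_index a}. (if \<gamma> = unit_index a then 1 else 0) * mpow y \<gamma>)"
    unfolding monomial_sum_def by (rule infsum_cong_neutral) auto
  then show ?thesis by simp
qed

lemma msum_remove_zero:
  assumes "ball_convergent q c R" "y \<in> lq_ball q UNIV R"
  shows "msum c y = c 0 + msum (\<lambda>\<gamma>. if \<gamma> = 0 then 0 else c \<gamma>) y"
proof -
  let ?c = "\<lambda>\<gamma>. if \<gamma> = 0 then 0 else c \<gamma>"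
  have "ball_convergent q ?c R" by (rule ball_convergent_le[OF assms(1)]) simp
  then have "msum c y - msum ?c y = msum (\<lambda>\<gamma>. c \<gamma> - ?c \<gamma>) y"
    using msum_diff[OF assms(1) _ assms(2)] by simp
  also have "\<dots> = (\<Sum>\<^sub>\<infinity>\<gamma>\<in>{0}. (c \<gamma> - ?c \<gamma>) * mpow y \<gamma>)"
    unfolding monomial_sum_def by (rule infsum_cong_neutral) auto
  finally show ?thesis by simp
qed

text \<open>By \<open>init\<close> the coefficients of time order below \<open>m\<close> carry the
  Cauchy data; this identifies the constant terms of the jets with
  \<open>initial_jet\<close>.\<close>

lemma jet_msum:
  assumes q: "1 \<le> q" and R: "0 < R" and v: "ball_convergent q v R"
    and u: "\<And>y. y \<in> lq_ball q UNIV R \<Longrightarrow> u y = msum v y" and y: "y \<in> lq_ball q UNIV R"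
    and init: "\<And>j \<beta>. j < m \<Longrightarrow> mfact (tx_multi j \<beta>) * v (tx_multi j \<beta>) = iter_pderiv (mlist \<beta>) (\<phi> j) (\<lambda>_. 0)"
    and m: "0 < m"
  shows "jet m u y = (\<lambda>i. initial_jet m \<phi> i + msum (jet_coef m v i) y)"
proof
  fix i
  show "jet m u y i = initial_jet m \<phi> i + msum (jet_coef m v i) y"
  proof (cases i)
    case (Indep a)
    then have "jet_coef m v i = (\<lambda>\<gamma>. if \<gamma> = unit_index a then 1 else 0)" by (auto simp: jet_coef_def)
    then show ?thesis using Indep by (simp add: jet_def initial_jet_def msum_unit[unfolded One_nat_def])
  next
    case Unknown
    have "v 0 = \<phi> 0 (\<lambda>_. 0)" using init[OF m, of 0] by (simp add: mlist_def)
    moreover have "jet_coef m v i = (\<lambda>\<gamma>. if \<gamma> = 0 then 0 else v \<gamma>)"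
      using Unknown by (auto simp: jet_coef_def)
    ultimately show ?thesis
      using Unknown u[OF y] msum_remove_zero[OF v y] by (simp add: jet_def initial_jet_def)
  next
    case (Jet \<beta> j)
    show ?thesis
    proof (cases "(\<beta>, j) \<in> jet_orders m")
      case True
      then have j: "j < m" by (simp add: jet_orders_def)
      let ?d = "dcoefs (tx_derivs \<beta> j) v"
      have "?d 0 = iter_pderiv (mlist \<beta>) (\<phi> j) (\<lambda>_. 0)"
        using init[OF j, of \<beta>] by (simp add: dcoefs_eq)
      moreover have "jet_coef m v i = (\<lambda>\<gamma>. if \<gamma> = 0 then 0 else ?d \<gamma>)"
        using Jet True by (auto simp: jet_coef_def)
      ultimately show ?thesis
        using Jet True iter_pderiv_msum(1)[OF q v u y, of "tx_derivs \<beta> j"]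
          msum_remove_zero[OF ball_convergent_dcoefs[OF q v] y, of "tx_derivs \<beta> j"]
        by (simp add: jet_def initial_jet_def)
    next
      case False
      then have "jet_coef m v i = (\<lambda>_. 0)" using Jet by (auto simp: jet_coef_def)
      then show ?thesis using Jet False by (simp add: jet_def initial_jet_def monomial_sum_def)
    qed
  qed
qed

lemma msum_jet_coef_Rprod: "(\<lambda>i. msum (jet_coef m v i) y) \<in> Rprod (jet_indices m)"
  unfolding Rprod_def
proof (intro CollectI allI impI)
  fix i assume "i \<notin> jet_indices m"
  then have "jet_coef m v i = (\<lambda>_. 0)"
    by (cases i) (auto simp: jet_indices_def jet_coef_def)
  then show "msum (jet_coef m v i) y = 0" by (simp add: monomial_sum_def)
qed

section \<open>Dependence of the right-hand side on the order in \<open>t\<close>\<close>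

lemma ball_bounded_dcoefs_uniform:
  fixes d :: "('i \<Rightarrow>\<^sub>0 nat) \<Rightarrow> real"
  assumes q: "1 \<le> q" and R: "0 < R" and K: "ball_bounded q d R K"
  shows "\<exists>K'\<ge>0. \<forall>is. length is \<le> m \<longrightarrow> ball_bounded q (dcoefs is d) (R / 2) K'"
proof -
  have K0: "0 \<le> K" using sums_bounded_nonneg[OF ball_boundedD[OF K lq_ball_zero[OF q R]]] .
  \<comment> \<open>Each derivative costs \<open>h\<close> of the radius, so \<open>m\<close> of
    them leave at least \<open>R / 2\<close>; and \<open>h \<le> 1\<close> makes the bound for
    \<open>m\<close> derivatives the largest. It depends on the number of derivatives only, hence is
    uniform over the infinitely many jets.\<close>
  define h where "h = min 1 (R / (2 * real (Suc m)))"
  have h: "0 < h" "h \<le> 1" "h * real m \<le> R / 2"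
  proof -
    have "h * real m \<le> R / (2 * real (Suc m)) * real (Suc m)"
      unfolding h_def using R by (intro mult_mono) auto
    also have "\<dots> = R / 2" by (simp del: of_nat_Suc)
    finally show "h * real m \<le> R / 2" .
  qed (use R in \<open>auto simp: h_def\<close>)
  show ?thesis
  proof (intro exI[of _ "K / h ^ m"] conjI allI impI)
    show "0 \<le> K / h ^ m" using K0 h by simp
    fix "is" :: "'i list" assume len: "length is \<le> m"
    have "h * length is \<le> h * real m" using len h by (intro mult_left_mono) auto
    then have "ball_bounded q (dcoefs is d) (R / 2) (K / h ^ length is)"
      using h(3) by (intro ball_bounded_mono[OF ball_bounded_dcoefs[OF q K h(1)]]) linarith
    moreover have "K / h ^ length is \<le> K / h ^ m"
      using K0 h len by (intro divide_left_mono power_decreasing) auto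
    ultimately show "ball_bounded q (dcoefs is d) (R / 2) (K / h ^ m)"
      unfolding ball_bounded_def using sums_bounded_mono by blast
  qed
qed

text \<open>A Schwarz-type estimate: moving the coordinate \<open>i\<close> from \<open>y i\<close>
  out to \<tau> magnifies every monomial of exponent at least \<open>N\<close> in it by at least the
  \<open>N\<close>-th power of \<tau> / |y i|.\<close>

lemma ball_bounded_order:
  assumes b: "ball_bounded q b R K" and zero: "\<And>\<gamma>. Poly_Mapping.lookup \<gamma> i < N \<Longrightarrow> b \<gamma> = 0"
    and \<tau>: "0 < \<tau>" and y: "\<bar>y i\<bar> \<le> \<tau>" and Y: "y(i := \<tau>) \<in> lq_ball q UNIV R"
  shows "\<bar>msum b y\<bar> \<le> (\<bar>y i\<bar> / \<tau>) ^ N * K"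
proof -
  let ?s = "\<bar>y i\<bar> / \<tau>"
  have s: "0 \<le> ?s" "?s \<le> 1" using \<tau> y by auto
  have "\<bar>b \<gamma> * mpow y \<gamma>\<bar> \<le> ?s ^ N * \<bar>b \<gamma> * mpow (y(i := \<tau>)) \<gamma>\<bar>" for \<gamma>
  proof (cases "Poly_Mapping.lookup \<gamma> i < N")
    case False
    let ?n = "Poly_Mapping.lookup \<gamma> i"
    have "\<bar>mpow y \<gamma>\<bar> = \<bar>y i\<bar> ^ ?n * \<bar>mpow (y(i := 1)) \<gamma>\<bar>"
      using mpow_upd[of y i "y i" \<gamma>] by (simp add: abs_mult power_abs)
    moreover have "\<bar>mpow (y(i := \<tau>)) \<gamma>\<bar> = \<tau> ^ ?n * \<bar>mpow (y(i := 1)) \<gamma>\<bar>"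
      using mpow_upd[of y i \<tau> \<gamma>] \<tau> by (simp add: abs_mult power_abs)
    ultimately have "\<bar>mpow y \<gamma>\<bar> = ?s ^ ?n * \<bar>mpow (y(i := \<tau>)) \<gamma>\<bar>"
      using \<tau> by (simp add: power_divide)
    also have "\<dots> \<le> ?s ^ N * \<bar>mpow (y(i := \<tau>)) \<gamma>\<bar>"
      using s False by (intro mult_right_mono power_decreasing) auto
    finally have "\<bar>b \<gamma>\<bar> * \<bar>mpow y \<gamma>\<bar> \<le> \<bar>b \<gamma>\<bar> * (?s ^ N * \<bar>mpow (y(i := \<tau>)) \<gamma>\<bar>)"
      by (rule mult_left_mono) simp
    then show ?thesis by (simp add: abs_mult mult_ac)
  qed (simp add: zero)
  then have "sums_bounded (\<lambda>\<gamma>. \<bar>b \<gamma> * mpow y \<gamma>\<bar>) UNIV (?s ^ N * K)"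
    using s by (intro sums_bounded_scale[OF ball_boundedD[OF b Y]]) auto
  from sums_bounded_abs_infsum(2)[OF this] show ?thesis by (simp add: monomial_sum_def)
qed

text \<open>The jets of the two series differ by O(|t|^N), with a constant independent of the jet
  coordinate. The Lipschitz estimate carries this over to the right-hand sides, and
  \<open>coeff_zero_of_order\<close> turns it into equality of coefficients.\<close>

lemma right_hand_side_order:
  assumes q: "1 \<le> q" and R: "0 < R" and m: "0 < m" "m \<le> n"
    and v: "ball_convergent q v R" and v': "ball_convergent q v' R"
    and agree: "\<And>\<gamma>. time_part \<gamma> < n \<Longrightarrow> v \<gamma> = v' \<gamma>"
    and \<mu>: "0 < \<mu>" and \<rho>: "\<And>i. i \<in> jet_indices m \<Longrightarrow> \<mu> \<le> \<rho> i"
    and C: "sums_bounded (\<lambda>\<alpha>. \<bar>C \<alpha>\<bar> * mpow \<rho> \<alpha>) (multi_indices (jet_indices m)) M"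
    and small: "\<And>y i. y \<in> lq_ball q UNIV R \<Longrightarrow> i \<in> jet_indices m \<Longrightarrow> \<bar>msum (jet_coef m v i) y\<bar> \<le> \<rho> i / 2"
    and small': "\<And>y i. y \<in> lq_ball q UNIV R \<Longrightarrow> i \<in> jet_indices m \<Longrightarrow> \<bar>msum (jet_coef m v' i) y\<bar> \<le> \<rho> i / 2"
    and e: "ball_convergent q e R" and e': "ball_convergent q e' R"
    and ee: "\<And>y. y \<in> lq_ball q UNIV R \<Longrightarrow>
        msum e y = monomial_sum (jet_indices m) C (\<lambda>i. msum (jet_coef m v i) y)"
    and ee': "\<And>y. y \<in> lq_ball q UNIV R \<Longrightarrow>
        msum e' y = monomial_sum (jet_indices m) C (\<lambda>i. msum (jet_coef m v' i) y)"
  shows "time_part \<gamma> + m \<le> n \<Longrightarrow> e \<gamma> = e' \<gamma>"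
proof -
  define d where "d = (\<lambda>\<gamma>. v \<gamma> - v' \<gamma>)"
  define R1 where "R1 = R / 2"
  have R1: "0 < R1" "R1 < R" using R by (auto simp: R1_def)
  have "ball_convergent q d R" unfolding d_def by (rule ball_convergent_diff[OF v v'])
  then obtain K where K: "ball_bounded q d R1 K" using R1 by (auto simp: ball_convergent_def)
  obtain K' where K'0: "0 \<le> K'"
    and dK: "\<And>is. length is \<le> m \<Longrightarrow> ball_bounded q (dcoefs is d) (R1 / 2) K'"
    using ball_bounded_dcoefs_uniform[OF q R1(1) K] by metis
  \<comment> \<open>Replacing the time coordinate by \<tau> changes it by at most
    \<open>2 * \<tau>\<close>, so the modified point has norm below \<open>3 * \<tau>\<close> and
    stays in the ball of radius \<open>R1 / 2 = 4 * \<tau>\<close>, where the derivatives are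
    bounded.\<close>
  define \<tau> where "\<tau> = R1 / 8"
  \<comment> \<open>At most \<open>m - 1\<close> time derivatives are taken, so agreement below
    order \<open>n\<close> survives below order \<open>n - (m - 1)\<close>.\<close>
  define N where "N = Suc (n - m)"
  have \<tau>: "0 < \<tau>" using R1 by (simp add: \<tau>_def)
  have sub: "y \<in> lq_ball q UNIV R" if "y \<in> lq_ball q UNIV \<tau>" for y :: "tx_index \<Rightarrow> real"
    using lq_ball_mono[OF _ that] R1 by (simp add: \<tau>_def)
  have jets: "\<bar>msum (jet_coef m v i) y - msum (jet_coef m v' i) y\<bar> \<le> (\<bar>y Time\<bar> / \<tau>) ^ N * K'"
    if i: "i \<in> jet_indices m" and y: "y \<in> lq_ball q UNIV \<tau>" for i y
    using i m(1)
  proof (cases rule: jet_coef_cases)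
    case (1 a)
    then have "jet_coef m v i = jet_coef m v' i" by (auto simp: jet_coef_def)
    then show ?thesis using K'0 \<tau> by simp
  next
    case (2 \<beta> j)
    let ?is = "tx_derivs \<beta> j"
    define b where "b = (\<lambda>\<gamma>. jet_coef m v i \<gamma> - jet_coef m v' i \<gamma>)"
    have bd: "\<bar>b \<gamma>\<bar> \<le> \<bar>dcoefs ?is d \<gamma>\<bar>" for \<gamma>
      by (simp add: b_def 2(3) dcoefs_eq d_def right_diff_distrib)
    have bb: "ball_bounded q b (R1 / 2) K'"
      by (rule ball_bounded_le[OF dK bd]) (use 2(2) in \<open>simp add: length_tx_derivs\<close>)
    have zero: "b \<gamma> = 0" if "time_part \<gamma> < N" for \<gamma>
    proof -
      have "d (\<gamma> + tx_multi j \<beta>) = 0"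
        unfolding d_def using agree[of "\<gamma> + tx_multi j \<beta>"] that 2(1) m by (simp add: lookup_add N_def)
      then show ?thesis using bd[of \<gamma>] by (simp add: dcoefs_eq)
    qed
    have ys: "y \<in> lq_space q UNIV" "lq_norm q UNIV y < \<tau>" using y by (auto simp: lq_ball_iff)
    have yt: "\<bar>y Time\<bar> \<le> \<tau>" using lq_coord_le_norm[OF q ys(1), of Time] ys(2) by simp
    have "y(Time := \<tau>) \<in> lq_ball q UNIV (R1 / 2)"
      using lq_ball_upd[OF q ys(1), of Time \<tau>] ys(2) yt R1 by (auto simp: lq_ball_iff \<tau>_def)
    from ball_bounded_order[OF bb zero \<tau> yt this]
    have "\<bar>msum b y\<bar> \<le> (\<bar>y Time\<bar> / \<tau>) ^ N * K'" .
    moreover have "msum b y = msum (jet_coef m v i) y - msum (jet_coef m v' i) y"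
      unfolding b_def
      by (rule msum_diff[OF ball_convergent_le[OF ball_convergent_dcoefs[OF q v, of ?is]]
            ball_convergent_le[OF ball_convergent_dcoefs[OF q v', of ?is]] sub[OF y]])
        (auto simp: 2(3))
    ultimately show ?thesis by simp
  qed
  have M0: "0 \<le> M" using C by (rule sums_bounded_nonneg)
  have le: "\<bar>msum (\<lambda>\<gamma>. e \<gamma> - e' \<gamma>) y\<bar> \<le> (2 * K' * M / (\<mu> * \<tau> ^ N)) * \<bar>y Time\<bar> ^ N"
    if y: "y \<in> lq_ball q UNIV \<tau>" for y
  proof -
    define D where "D = (\<bar>y Time\<bar> / \<tau>) ^ N * K'"
    have D0: "0 \<le> D" using K'0 \<tau> by (simp add: D_def)
    have "\<bar>msum (jet_coef m v i) y - msum (jet_coef m v' i) y\<bar> \<le> (2 * D / \<mu>) * (\<rho> i / 2)"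
      if i: "i \<in> jet_indices m" for i
    proof -
      \<comment> \<open>The common lower bound \<mu> of the radii converts the absolute difference
        \<open>D\<close> into a relative one, the same for all jet coordinates.\<close>
      have "D = (2 * D / \<mu>) * (\<mu> / 2)" using \<mu> by simp
      also have "\<dots> \<le> (2 * D / \<mu>) * (\<rho> i / 2)" using \<mu> D0 \<rho>[OF i] by (intro mult_left_mono) auto
      finally show ?thesis using jets[OF i y] by (simp add: D_def)
    qed
    then have "\<bar>monomial_sum (jet_indices m) C (\<lambda>i. msum (jet_coef m v i) y)
        - monomial_sum (jet_indices m) C (\<lambda>i. msum (jet_coef m v' i) y)\<bar> \<le> (2 * D / \<mu>) * M"
      using small[OF sub[OF y]] small'[OF sub[OF y]] D0 \<mu>
      by (intro monomial_sum_lipschitz[OF C]) auto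
    also have "(2 * D / \<mu>) * M = (2 * K' * M / (\<mu> * \<tau> ^ N)) * \<bar>y Time\<bar> ^ N"
      using \<mu> \<tau> by (simp add: D_def power_divide mult_ac)
    finally show ?thesis using msum_diff[OF e e' sub[OF y]] ee[OF sub[OF y]] ee'[OF sub[OF y]] by simp
  qed
  assume "time_part \<gamma> + m \<le> n"
  then have "time_part \<gamma> < N" by (simp add: N_def)
  moreover have "ball_convergent q (\<lambda>\<gamma>. e \<gamma> - e' \<gamma>) \<tau>"
    using ball_convergent_mono[OF ball_convergent_diff[OF e e'], of \<tau>] R1 by (simp add: \<tau>_def)
  ultimately have "e \<gamma> - e' \<gamma> = 0" using coeff_zero_of_order[OF q \<tau> _ le] by blast
  then show "e \<gamma> = e' \<gamma>" by simp
qed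


section \<open>The formal solution\<close>

text \<open>The coefficients of the polynomial in \<open>t\<close> with terms
  \<open>t^k * \<phi>_k / k!\<close>, \<open>k < m\<close>.\<close>

definition data_coef :: "nat \<Rightarrow> (nat \<Rightarrow> (nat \<Rightarrow>\<^sub>0 nat) \<Rightarrow> real) \<Rightarrow> (tx_index \<Rightarrow>\<^sub>0 nat) \<Rightarrow> real" where
  "data_coef m c \<gamma> = (if time_part \<gamma> < m then c (time_part \<gamma>) (space_part \<gamma>) / fact (time_part \<gamma>) else 0)"

text \<open>The coefficients of the function with initial data \<open>c\<close> whose derivative \<open>\<partial>\<^sub>t\<^sup>m\<close> has coefficients \<open>w\<close>.\<close>
definition sol_coef :: "nat \<Rightarrow> (nat \<Rightarrow> (nat \<Rightarrow>\<^sub>0 nat) \<Rightarrow> real) \<Rightarrow> ((tx_index \<Rightarrow>\<^sub>0 nat) \<Rightarrow> real)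
    \<Rightarrow> (tx_index \<Rightarrow>\<^sub>0 nat) \<Rightarrow> real" where
  "sol_coef m c w \<gamma> = (if time_part \<gamma> < m then data_coef m c \<gamma>
     else w (\<gamma> - Poly_Mapping.single Time m) * mfact (\<gamma> - Poly_Mapping.single Time m) / mfact \<gamma>)"

lemma sol_coef_low: "time_part \<gamma> < m \<Longrightarrow> sol_coef m c w \<gamma> = data_coef m c \<gamma>"
  by (simp add: sol_coef_def)

lemma sol_coef_high:
  "sol_coef m c w (\<gamma> + Poly_Mapping.single Time m) = w \<gamma> * mfact \<gamma> / mfact (\<gamma> + Poly_Mapping.single Time m)"
  by (simp add: sol_coef_def lookup_add)

lemma dcoefs_sol_coef: "dcoefs (replicate m Time) (sol_coef m c w) = w"
  by (rule ext) (simp add: dcoefs_eq sol_coef_high)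

definition tx_weights :: "real \<Rightarrow> (nat \<Rightarrow> real) \<Rightarrow> tx_index \<Rightarrow> real" where
  "tx_weights \<epsilon> a v = (case v of Time \<Rightarrow> 1 / \<epsilon> | Space i \<Rightarrow> a i)"

lemma tx_weights_simps [simp]: "tx_weights \<epsilon> a Time = 1 / \<epsilon>" "tx_weights \<epsilon> a (Space i) = a i"
  by (simp_all add: tx_weights_def)

lemma tx_weights_pos: "0 < \<epsilon> \<Longrightarrow> (\<And>i. 0 < a i) \<Longrightarrow> 0 < tx_weights \<epsilon> a v"
  by (cases v) auto

lemma geo_weight_tx:
  "geo_weight r (tx_weights \<epsilon> a) (tx_multi l \<delta>)
     = fact l * mfact \<delta> / fact (l + mdeg \<delta>) * r ^ (l + mdeg \<delta>) * \<epsilon> ^ l / mpow a \<delta>"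
  by (simp add: geo_weight_def mpow_tx_multi mfact_tx_multi power_divide)

section \<open>Weighted norms of the jets\<close>

lemma fact_add_le: "fact (n + m) \<le> fact n * (fact m * 2 ^ m * 2 ^ n :: real)"
proof -
  have "(n + m choose n) \<le> 2 ^ (n + m)" by (rule binomial_le_pow2)
  then have "real (n + m choose n) \<le> 2 ^ (n + m)"
    by (metis of_nat_le_iff of_nat_numeral of_nat_power)
  then show ?thesis by (simp add: binomial_fact power_add field_simps)
qed

text \<open>With \<open>n\<close> the total degree, \<open>mfact (\<delta> + \<beta>)\<close> is at
  most \<open>fact (n + m)\<close>, hence at most \<open>fact n * fact m * 2 ^ (m + n)\<close>. The
  weight cancels \<open>fact n\<close>, and \<open>(2 * r) ^ n\<close> absorbs the power
  \<open>2 ^ n\<close>; since the exponent is nonzero, one factor \<open>2 * r\<close> survives. The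
  power of \<open>A\<close> pays for the shift by \<beta>.\<close>

lemma jet_coef_data_bound:
  assumes r: "0 < r" "r \<le> 1 / 2" and \<epsilon>: "0 < \<epsilon>" "\<epsilon> \<le> 1"
    and a: "\<And>i. 0 < a i" and A: "1 \<le> A" "\<And>i. a i \<le> A" and \<beta>: "mdeg \<beta> + j \<le> m"
    and R: "\<And>i. 1 / a i \<le> R i" and \<gamma>: "tx_multi l \<delta> \<noteq> 0"
  shows "fact (l + j) * mfact (\<delta> + \<beta>) / (fact l * mfact \<delta>) * (1 / fact (l + j))
      * geo_weight r (tx_weights \<epsilon> a) (tx_multi l \<delta>)
    \<le> 2 * r * (fact m * 2 ^ m) * A ^ m * mpow R (\<delta> + \<beta>)"
proof -
  define n where "n = l + mdeg \<delta>"
  have "n \<noteq> 0" using \<gamma> mdeg_eq_0_iff[of "tx_multi l \<delta>"] by (simp add: n_def)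
  then have n: "1 \<le> n" by simp
  have pa: "0 < mpow a \<alpha>" for \<alpha> using mpow_pos[of a \<alpha>] a by simp
  have R0: "0 < R i" for i using R[of i] a[of i] by (meson divide_pos_pos less_le_trans zero_less_one)
  have "mfact (\<delta> + \<beta>) \<le> fact (mdeg (\<delta> + \<beta>))" by (rule mfact_le)
  also have "\<dots> \<le> fact (n + m)" using \<beta> by (intro fact_mono) (simp add: mdeg_add n_def)
  also have "\<dots> \<le> fact n * (fact m * 2 ^ m * 2 ^ n)" by (rule fact_add_le)
  finally have 1: "mfact (\<delta> + \<beta>) / fact n \<le> fact m * 2 ^ m * 2 ^ n" by (simp add: divide_le_eq mult.commute)
  have "(2 * r) ^ n \<le> (2 * r) ^ 1" using r n by (intro power_decreasing) auto
  then have 2: "2 ^ n * r ^ n \<le> 2 * r" by (simp add: power_mult_distrib)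
  have 3: "1 / mpow a \<delta> \<le> A ^ m * mpow R (\<delta> + \<beta>)"
  proof -
    have "mpow a \<beta> \<le> mpow (\<lambda>_. A) \<beta>" using a A by (intro mpow_mono) (auto intro: less_imp_le)
    also have "\<dots> \<le> A ^ m" unfolding mpow_const using A \<beta> by (intro power_increasing) auto
    finally have ab: "mpow a \<beta> \<le> A ^ m" .
    have "inverse (mpow a (\<delta> + \<beta>)) = mpow (\<lambda>i. inverse (a i)) (\<delta> + \<beta>)" by (rule mpow_inverse[symmetric])
    also have "\<dots> \<le> mpow R (\<delta> + \<beta>)"
      using R a by (intro mpow_mono) (auto simp: inverse_eq_divide intro: less_imp_le)
    finally have Ra: "inverse (mpow a (\<delta> + \<beta>)) \<le> mpow R (\<delta> + \<beta>)" .
    have "1 / mpow a \<delta> = mpow a \<beta> * inverse (mpow a (\<delta> + \<beta>))"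
      using pa[of \<beta>] pa[of \<delta>] by (simp add: mpow_add field_simps)
    also have "\<dots> \<le> A ^ m * mpow R (\<delta> + \<beta>)"
      using ab Ra pa[of "\<delta> + \<beta>"] A by (intro mult_mono) auto
    finally show ?thesis .
  qed
  have "fact (l + j) * mfact (\<delta> + \<beta>) / (fact l * mfact \<delta>) * (1 / fact (l + j))
      * geo_weight r (tx_weights \<epsilon> a) (tx_multi l \<delta>)
    = mfact (\<delta> + \<beta>) / fact n * r ^ n * \<epsilon> ^ l * (1 / mpow a \<delta>)"
    by (simp add: geo_weight_tx n_def)
  also have "\<dots> \<le> (fact m * 2 ^ m * 2 ^ n) * r ^ n * 1 * (A ^ m * mpow R (\<delta> + \<beta>))"
    using 1 3 r \<epsilon> pa[of \<delta>] by (intro mult_mono) (auto intro!: power_le_one)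
  also have "\<dots> = (2 ^ n * r ^ n) * ((fact m * 2 ^ m) * (A ^ m * mpow R (\<delta> + \<beta>)))" by simp
  also have "\<dots> \<le> (2 * r) * ((fact m * 2 ^ m) * (A ^ m * mpow R (\<delta> + \<beta>)))"
    using 2 A mpow_pos[of R "\<delta> + \<beta>"] R0 by (intro mult_right_mono) auto
  finally show ?thesis by (simp add: mult_ac)
qed

text \<open>The order \<open>t^l\<close> of the jet stems from the order \<open>t^k\<close> of
  \<open>w\<close>, where \<open>l + j = k + m\<close>. Because
  \<open>mdeg \<beta> + j \<le> m\<close>, the total degree on the left is at least that on the
  right, so the inverse factorial and the power of \<open>r\<close> both help; because
  \<open>j < m\<close>, one has \<open>k < l\<close>, which leaves one factor \<epsilon>.\<close>

lemma jet_coef_integral_bound: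
  assumes r: "0 < r" "r \<le> 1 / 2" and \<epsilon>: "0 < \<epsilon>" "\<epsilon> \<le> 1"
    and a: "\<And>i. 0 < a i" and A: "1 \<le> A" "\<And>i. a i \<le> A" and \<beta>: "mdeg \<beta> + j \<le> m" and j: "j < m"
    and l: "l + j = k + m"
  shows "fact k * mfact (\<delta> + \<beta>) / (fact l * mfact \<delta>) * geo_weight r (tx_weights \<epsilon> a) (tx_multi l \<delta>)
    \<le> A ^ m * \<epsilon> * geo_weight r (tx_weights \<epsilon> a) (tx_multi k (\<delta> + \<beta>))"
proof -
  have pa: "0 < mpow a \<alpha>" for \<alpha> using mpow_pos[of a \<alpha>] a by simp
  have deg: "k + mdeg (\<delta> + \<beta>) \<le> l + mdeg \<delta>" using l \<beta> by (simp add: mdeg_add)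
  have ab: "mpow a \<beta> \<le> A ^ m"
  proof -
    have "mpow a \<beta> \<le> mpow (\<lambda>_. A) \<beta>" using a A by (intro mpow_mono) (auto intro: less_imp_le)
    also have "\<dots> \<le> A ^ m" unfolding mpow_const using A \<beta> by (intro power_increasing) auto
    finally show ?thesis .
  qed
  have ek: "\<epsilon> ^ l \<le> \<epsilon> * \<epsilon> ^ k"
  proof -
    have "\<epsilon> ^ l \<le> \<epsilon> ^ (Suc k)" using \<epsilon> l j by (intro power_decreasing) auto
    then show ?thesis by simp
  qed
  have rk: "r ^ (l + mdeg \<delta>) / fact (l + mdeg \<delta>) \<le> r ^ (k + mdeg (\<delta> + \<beta>)) / fact (k + mdeg (\<delta> + \<beta>))"
    using r deg by (intro frac_le power_decreasing fact_mono) auto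
  have "fact k * mfact (\<delta> + \<beta>) / (fact l * mfact \<delta>) * geo_weight r (tx_weights \<epsilon> a) (tx_multi l \<delta>)
     = fact k * mfact (\<delta> + \<beta>) * (r ^ (l + mdeg \<delta>) / fact (l + mdeg \<delta>)) * \<epsilon> ^ l * (mpow a \<beta> / mpow a (\<delta> + \<beta>))"
    using pa[of \<beta>] pa[of \<delta>] by (simp add: geo_weight_tx mpow_add)
  also have "\<dots> \<le> fact k * mfact (\<delta> + \<beta>) * (r ^ (k + mdeg (\<delta> + \<beta>)) / fact (k + mdeg (\<delta> + \<beta>)))
      * (\<epsilon> * \<epsilon> ^ k) * (A ^ m / mpow a (\<delta> + \<beta>))"
    using rk ek ab pa[of "\<delta> + \<beta>"] pa[of \<beta>] r \<epsilon> A
    by (intro mult_mono divide_right_mono mult_nonneg_nonneg) (auto intro: less_imp_le)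
  also have "\<dots> = A ^ m * \<epsilon> * geo_weight r (tx_weights \<epsilon> a) (tx_multi k (\<delta> + \<beta>))"
    by (simp add: geo_weight_tx)
  finally show ?thesis .
qed

lemma sums_bounded_data:
  assumes L: "\<And>k. k < m \<Longrightarrow> sums_bounded (\<lambda>\<beta>. \<bar>c k \<beta>\<bar> * mpow (R k) \<beta>) UNIV (L k)"
  shows "sums_bounded (\<lambda>\<gamma>. if time_part \<gamma> < m
      then \<bar>c (time_part \<gamma>) (space_part \<gamma>)\<bar> * mpow (R (time_part \<gamma>)) (space_part \<gamma>) else 0) UNIV (sum L {..<m})"
    (is "sums_bounded ?f UNIV _")
proof (rule sums_boundedI)
  fix S :: "(tx_index \<Rightarrow>\<^sub>0 nat) set" assume S: "finite S"
  let ?S = "\<lambda>k. {\<gamma>\<in>S. time_part \<gamma> = k}"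
  have "sum ?f S = sum ?f {\<gamma>\<in>S. time_part \<gamma> < m}"
    using S by (intro sum.mono_neutral_right) auto
  also have "{\<gamma>\<in>S. time_part \<gamma> < m} = (\<Union>k<m. ?S k)" by auto
  also have "sum ?f (\<Union>k<m. ?S k) = (\<Sum>k<m. sum ?f (?S k))"
    using S by (intro sum.UNION_disjoint) auto
  also have "\<dots> \<le> sum L {..<m}"
  proof (rule sum_mono)
    fix k assume k: "k \<in> {..<m}"
    have inj: "inj_on space_part (?S k)"
      by (rule inj_onI) (metis (mono_tags, lifting) mem_Collect_eq tx_multi_parts)
    have "sum ?f (?S k) = (\<Sum>\<gamma>\<in>?S k. \<bar>c k (space_part \<gamma>)\<bar> * mpow (R k) (space_part \<gamma>))"
      using k by (intro sum.cong) auto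
    also have "\<dots> = (\<Sum>\<beta>\<in>space_part ` ?S k. \<bar>c k \<beta>\<bar> * mpow (R k) \<beta>)"
      using sum.reindex[OF inj, of "\<lambda>\<beta>. \<bar>c k \<beta>\<bar> * mpow (R k) \<beta>"] by simp
    also have "\<dots> \<le> L k" using k S by (intro sums_boundedD[OF L]) auto
    finally show "sum ?f (?S k) \<le> L k" .
  qed
  finally show "sum ?f S \<le> sum L {..<m}" .
qed

text \<open>
  The data contribute a factor \<open>r\<close>, because the constant term has been removed; the \<open>m\<close>-fold time
  integral contributes a factor \<open>\<epsilon>\<close>, because at most \<open>m - 1\<close> time derivatives are taken.
\<close>
lemma wnorm_jet_coef:
  assumes r: "0 < r" "r \<le> 1 / 2" and \<epsilon>: "0 < \<epsilon>" "\<epsilon> \<le> 1"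
    and a: "\<And>i. 0 < a i" and A: "1 \<le> A" "\<And>i. a i \<le> A" and \<beta>: "mdeg \<beta> + j \<le> m" and j: "j < m"
    and R: "\<And>k i. k < m \<Longrightarrow> 1 / a i \<le> R k i"
    and L: "\<And>k. k < m \<Longrightarrow> sums_bounded (\<lambda>\<beta>. \<bar>c k \<beta>\<bar> * mpow (R k) \<beta>) UNIV (L k)"
    and w: "wnorm_le (geo_weight r (tx_weights \<epsilon> a)) w B"
  shows "wnorm_le (geo_weight r (tx_weights \<epsilon> a))
      (\<lambda>\<gamma>. if \<gamma> = 0 then 0 else dcoefs (tx_derivs \<beta> j) (sol_coef m c w) \<gamma>)
      (2 * r * (fact m * 2 ^ m) * A ^ m * sum L {..<m} + A ^ m * \<epsilon> * B)"
proof -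
  let ?\<omega> = "geo_weight r (tx_weights \<epsilon> a)" and ?\<mu> = "tx_multi j \<beta>" and ?e = "Poly_Mapping.single Time m"
  let ?f = "\<lambda>\<gamma>. if time_part \<gamma> < m
      then \<bar>c (time_part \<gamma>) (space_part \<gamma>)\<bar> * mpow (R (time_part \<gamma>)) (space_part \<gamma>) else 0"
  define g where "g = (\<lambda>\<gamma>. \<bar>if \<gamma> = 0 then 0 else dcoefs (tx_derivs \<beta> j) (sol_coef m c w) \<gamma>\<bar> * ?\<omega> \<gamma>)"
  have \<omega>0: "0 < ?\<omega> \<gamma>" for \<gamma>
    using submult_geo_weight[of r "tx_weights \<epsilon> a"] tx_weights_pos[of \<epsilon> a] r \<epsilon> a
    by (simp add: submult_weight_def)
  \<comment> \<open>The split is by the exponent before differentiation: \<open>g1\<close> stems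
    from the Cauchy data, \<open>g2\<close> from the \<open>m\<close>-fold integral.\<close>
  define g1 where "g1 = (\<lambda>\<gamma>. if time_part (\<gamma> + ?\<mu>) < m then g \<gamma> else 0)"
  define g2 where "g2 = (\<lambda>\<gamma>. if time_part (\<gamma> + ?\<mu>) < m then 0 else g \<gamma>)"
  have R0: "0 \<le> R k i" if "k < m" for k i
    using R[OF that, of i] a[of i] by (meson divide_nonneg_pos le_less order_trans zero_le_one)
  have "sums_bounded g1 UNIV ((2 * r * (fact m * 2 ^ m) * A ^ m) * sum L {..<m})"
  proof (rule sums_bounded_comparison[OF sums_bounded_data[OF L], where \<pi>="\<lambda>\<gamma>. \<gamma> + ?\<mu>" and A'=UNIV])
    show "inj_on (\<lambda>\<gamma>. \<gamma> + ?\<mu>) UNIV" by (auto simp: inj_on_def)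
    show "0 \<le> ?f \<gamma>" for \<gamma> by (auto intro!: mult_nonneg_nonneg mpow_nonneg R0)
    show "0 \<le> 2 * r * (fact m * 2 ^ m) * A ^ m" using r A by simp
    fix \<gamma> :: "tx_index \<Rightarrow>\<^sub>0 nat"
    have "g1 \<gamma> \<le> 2 * r * (fact m * 2 ^ m) * A ^ m * ?f (\<gamma> + ?\<mu>)"
    proof (cases "time_part (\<gamma> + ?\<mu>) < m \<and> \<gamma> \<noteq> 0")
      case True
      obtain l \<delta> where \<gamma>: "\<gamma> = tx_multi l \<delta>" using tx_multi_parts[of \<gamma>] by metis
      have lj: "l + j < m" using True by (simp add: \<gamma> tx_multi_add)
      have "g1 \<gamma> = (fact (l + j) * mfact (\<delta> + \<beta>) / (fact l * mfact \<delta>) * (1 / fact (l + j)) * ?\<omega> (tx_multi l \<delta>))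
          * \<bar>c (l + j) (\<delta> + \<beta>)\<bar>"
        using True lj \<omega>0[of "tx_multi l \<delta>"]
        by (simp add: g1_def g_def dcoefs_eq \<gamma> tx_multi_add mfact_tx_multi sol_coef_low data_coef_def
            abs_mult abs_divide)
      also have "\<dots> \<le> (2 * r * (fact m * 2 ^ m) * A ^ m * mpow (R (l + j)) (\<delta> + \<beta>)) * \<bar>c (l + j) (\<delta> + \<beta>)\<bar>"
        using True \<gamma> lj by (intro mult_right_mono jet_coef_data_bound r \<epsilon> a A \<beta> R) auto
      finally show ?thesis using lj by (simp add: \<gamma> tx_multi_add mult_ac)
    next
      case False
      then have "g1 \<gamma> = 0" by (auto simp: g1_def g_def)
      moreover have "0 \<le> ?f (\<gamma> + ?\<mu>)" by (auto intro!: mult_nonneg_nonneg mpow_nonneg R0)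
      ultimately show ?thesis using r A by (auto intro!: mult_nonneg_nonneg)
    qed
    then show "\<gamma> + ?\<mu> \<in> UNIV \<and> g1 \<gamma> \<le> 2 * r * (fact m * 2 ^ m) * A ^ m * ?f (\<gamma> + ?\<mu>)" by simp
  qed auto
  moreover have "sums_bounded g2 UNIV ((A ^ m * \<epsilon>) * B)"
  \<comment> \<open>The comparison map undoes the differentiation and then the integration; its
    subtraction is truncated, hence injectivity is claimed only where the time exponent is at least
    \<open>m\<close>.\<close>
  proof (rule sums_bounded_comparison[OF w[unfolded wnorm_le_def], where \<pi>="\<lambda>\<gamma>. \<gamma> + ?\<mu> - ?e"
        and A'="{\<gamma>. m \<le> time_part (\<gamma> + ?\<mu>)}"])
    show "inj_on (\<lambda>\<gamma>. \<gamma> + ?\<mu> - ?e) {\<gamma>. m \<le> time_part (\<gamma> + ?\<mu>)}"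
    proof (rule inj_onI)
      fix \<gamma> \<gamma>' assume h: "\<gamma> \<in> {\<gamma>. m \<le> time_part (\<gamma> + ?\<mu>)}" "\<gamma>' \<in> {\<gamma>. m \<le> time_part (\<gamma> + ?\<mu>)}"
        and eq: "\<gamma> + ?\<mu> - ?e = \<gamma>' + ?\<mu> - ?e"
      obtain z z' where z: "\<gamma> + ?\<mu> = z + ?e" "\<gamma>' + ?\<mu> = z' + ?e"
        using split_single[of m "\<gamma> + ?\<mu>" Time] split_single[of m "\<gamma>' + ?\<mu>" Time] h by auto
      then have "\<gamma> + ?\<mu> = \<gamma>' + ?\<mu>" using eq by simp
      then show "\<gamma> = \<gamma>'" by simp
    qed
    show "0 \<le> \<bar>w \<gamma>\<bar> * ?\<omega> \<gamma>" for \<gamma> using \<omega>0[of \<gamma>] by simp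
    show "g2 \<gamma> \<le> 0" if "\<gamma> \<in> UNIV - {\<gamma>. m \<le> time_part (\<gamma> + ?\<mu>)}" for \<gamma>
      using that by (simp add: g2_def)
    show "0 \<le> A ^ m * \<epsilon>" using \<epsilon> A by simp
    fix \<gamma> assume "\<gamma> \<in> {\<gamma>. m \<le> time_part (\<gamma> + ?\<mu>)}"
    then have m': "m \<le> time_part (\<gamma> + ?\<mu>)" by simp
    obtain l \<delta> where \<gamma>: "\<gamma> = tx_multi l \<delta>" using tx_multi_parts[of \<gamma>] by metis
    define k where "k = l + j - m"
    have k: "l + j = k + m" using m' by (simp add: k_def \<gamma> tx_multi_add)
    have sum: "\<gamma> + ?\<mu> = tx_multi k (\<delta> + \<beta>) + ?e"
      unfolding \<gamma> tx_multi_add k tx_multi_zero[symmetric] by simp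
    have "g2 \<gamma> \<le> \<bar>dcoefs (tx_derivs \<beta> j) (sol_coef m c w) \<gamma>\<bar> * ?\<omega> \<gamma>"
      using m' \<omega>0[of \<gamma>] by (simp add: g2_def g_def)
    also have "dcoefs (tx_derivs \<beta> j) (sol_coef m c w) \<gamma>
        = mfact (\<gamma> + ?\<mu>) / mfact \<gamma> * sol_coef m c w (tx_multi k (\<delta> + \<beta>) + ?e)"
      unfolding dcoefs_eq list_index_tx_derivs sum ..
    also have "\<dots> = fact k * mfact (\<delta> + \<beta>) / (fact l * mfact \<delta>) * w (tx_multi k (\<delta> + \<beta>))"
      unfolding sol_coef_high sum by (simp add: \<gamma> mfact_tx_multi)
    also have "\<bar>\<dots>\<bar> * ?\<omega> \<gamma>
        = (fact k * mfact (\<delta> + \<beta>) / (fact l * mfact \<delta>) * ?\<omega> (tx_multi l \<delta>)) * \<bar>w (tx_multi k (\<delta> + \<beta>))\<bar>"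
      by (simp add: \<gamma> abs_mult abs_divide)
    also have "\<dots> \<le> (A ^ m * \<epsilon> * ?\<omega> (tx_multi k (\<delta> + \<beta>))) * \<bar>w (tx_multi k (\<delta> + \<beta>))\<bar>"
      by (rule mult_right_mono[OF jet_coef_integral_bound[OF r \<epsilon> a A \<beta> j k]]) simp
    finally have "g2 \<gamma> \<le> A ^ m * \<epsilon> * (\<bar>w (tx_multi k (\<delta> + \<beta>))\<bar> * ?\<omega> (tx_multi k (\<delta> + \<beta>)))"
      by (simp add: mult_ac)
    then show "\<gamma> + ?\<mu> - ?e \<in> UNIV \<and> g2 \<gamma> \<le> A ^ m * \<epsilon> * (\<bar>w (\<gamma> + ?\<mu> - ?e)\<bar> * ?\<omega> (\<gamma> + ?\<mu> - ?e))"
      unfolding sum by simp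
  qed simp
  ultimately have "sums_bounded (\<lambda>\<gamma>. g1 \<gamma> + g2 \<gamma>) UNIV
      (2 * r * (fact m * 2 ^ m) * A ^ m * sum L {..<m} + A ^ m * \<epsilon> * B)"
    by (rule sums_bounded_add)
  moreover have "(\<lambda>\<gamma>. g1 \<gamma> + g2 \<gamma>) = g" by (auto simp: g1_def g2_def)
  ultimately show ?thesis by (simp add: wnorm_le_def g_def)
qed


lemma wnorm_le_mono: "wnorm_le \<omega> c M \<Longrightarrow> M \<le> N \<Longrightarrow> wnorm_le \<omega> c N"
  unfolding wnorm_le_def by (rule sums_bounded_mono)

lemma wnorm_le_ball_bounded:
  assumes "wnorm_le \<omega> c M" "\<And>y. y \<in> lq_ball q UNIV R \<Longrightarrow> dominated_by \<omega> y"
  shows "ball_bounded q c R M"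
  unfolding ball_bounded_def using wnorm_le_dominated[OF assms(1)] assms(2) by blast

lemma ball_bounded_add_const:
  assumes "ball_bounded q (\<lambda>\<gamma>. if \<gamma> = 0 then 0 else c \<gamma>) R K"
  shows "ball_bounded q c R (K + \<bar>c 0\<bar>)"
  unfolding ball_bounded_def
proof
  fix y :: "'a \<Rightarrow> real" assume y: "y \<in> lq_ball q UNIV R"
  have "sums_bounded (\<lambda>\<gamma> :: 'a \<Rightarrow>\<^sub>0 nat. if \<gamma> = 0 then \<bar>c 0\<bar> else 0) UNIV \<bar>c 0\<bar>"
    by (rule sums_boundedI) auto
  from sums_bounded_add[OF ball_boundedD[OF assms y] this]
  show "sums_bounded (\<lambda>\<gamma>. \<bar>c \<gamma> * mpow y \<gamma>\<bar>) UNIV (K + \<bar>c 0\<bar>)"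
    by (rule sums_bounded_le) auto
qed

text \<open>Integration gains \<open>m\<close> orders in \<open>t\<close>, since \<open>w\<close>
  enters with its time exponent lowered by \<open>m\<close>.\<close>

lemma sol_coef_agree:
  assumes "\<And>\<gamma>. time_part \<gamma> < k \<Longrightarrow> w \<gamma> = w' \<gamma>" "time_part \<gamma> < m + k"
  shows "sol_coef m c w \<gamma> = sol_coef m c w' \<gamma>"
  using assms(1)[of "\<gamma> - Poly_Mapping.single Time m"] assms(2)
  by (auto simp: sol_coef_def lookup_minus)

text \<open>
  Picard iteration. The \<open>k\<close>-th iterate is exact up to order \<open>t\<^sup>k\<close>, so the iterates converge
  coefficientwise to a solution with the same norm bound.
\<close>
lemma formal_solution_exists:
  assumes q: "1 \<le> q" and R: "0 < R" and m: "0 < m"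
    and \<omega>: "submult_weight \<omega>" and dom: "\<And>y. y \<in> lq_ball q UNIV R \<Longrightarrow> dominated_by \<omega> y"
    and \<mu>: "0 < \<mu>" and \<rho>: "\<And>i. i \<in> jet_indices m \<Longrightarrow> \<mu> \<le> \<rho> i"
    and C: "sums_bounded (\<lambda>\<alpha>. \<bar>C \<alpha>\<bar> * mpow \<rho> \<alpha>) (multi_indices (jet_indices m)) M"
    and norm: "\<And>w i. wnorm_le \<omega> w M \<Longrightarrow> i \<in> jet_indices m \<Longrightarrow>
        wnorm_le \<omega> (jet_coef m (sol_coef m c w) i) (\<rho> i / 2)"
    and conv: "\<And>w. wnorm_le \<omega> w M \<Longrightarrow> ball_convergent q (sol_coef m c w) R"
  shows "\<exists>w. wnorm_le \<omega> w M \<and> (\<forall>y\<in>lq_ball q UNIV R.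
      msum w y = monomial_sum (jet_indices m) C (\<lambda>i. msum (jet_coef m (sol_coef m c w) i) y))"
proof -
  let ?G = "\<lambda>w y. monomial_sum (jet_indices m) C (\<lambda>i. msum (jet_coef m (sol_coef m c w) i) y)"
  have \<rho>2: "\<rho> i / 2 \<le> \<rho> i" if "i \<in> jet_indices m" for i using \<rho>[OF that] \<mu> by simp
  have "\<exists>e. wnorm_le \<omega> e M \<and> (\<forall>y. dominated_by \<omega> y \<longrightarrow> msum e y = ?G w y)" if "wnorm_le \<omega> w M" for w
    by (rule wnorm_composition[OF \<omega> wnorm_le_mono[OF norm[OF that] \<rho>2] C])
  then obtain next_w where nxt: "\<And>w. wnorm_le \<omega> w M \<Longrightarrow> wnorm_le \<omega> (next_w w) M"
    and nxt_eq: "\<And>w y. wnorm_le \<omega> w M \<Longrightarrow> dominated_by \<omega> y \<Longrightarrow> msum (next_w w) y = ?G w y" by metis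
  \<comment> \<open>Integration gains \<open>m\<close> orders in \<open>t\<close> and the jets lose
    at most \<open>m - 1\<close>, so agreement below order \<open>k\<close> improves to agreement at
    order \<open>k\<close> as well.\<close>
  have step: "next_w w \<gamma> = next_w w' \<gamma>"
    if w: "wnorm_le \<omega> w M" and w': "wnorm_le \<omega> w' M"
      and agree: "\<And>\<gamma>. time_part \<gamma> < k \<Longrightarrow> w \<gamma> = w' \<gamma>" and \<gamma>: "time_part \<gamma> \<le> k" for w w' k \<gamma>
  proof (rule right_hand_side_order[OF q R m le_add1 conv[OF w] conv[OF w'] _ \<mu> \<rho> C])
    show "sol_coef m c w \<gamma> = sol_coef m c w' \<gamma>" if "time_part \<gamma> < m + k" for \<gamma>
      using agree that by (rule sol_coef_agree)
    show "ball_convergent q (next_w w) R" "ball_convergent q (next_w w') R"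
      using wnorm_le_ball_bounded[OF nxt dom] w w' by (auto intro: ball_bounded_convergent)
    show "msum (next_w w) y = ?G w y" "msum (next_w w') y = ?G w' y" if "y \<in> lq_ball q UNIV R" for y
      using nxt_eq[OF _ dom[OF that]] w w' by auto
    show "\<bar>msum (jet_coef m (sol_coef m c w) i) y\<bar> \<le> \<rho> i / 2"
      "\<bar>msum (jet_coef m (sol_coef m c w') i) y\<bar> \<le> \<rho> i / 2"
      if "y \<in> lq_ball q UNIV R" "i \<in> jet_indices m" for y i
      using wnorm_le_msum[OF norm[OF _ that(2)] dom[OF that(1)]] w w' by auto
    show "time_part \<gamma> + m \<le> m + k" using \<gamma> by simp
  qed
  define W where "W = (\<lambda>k. (next_w ^^ k) (\<lambda>_. 0))"
  have W_Suc: "W (Suc k) = next_w (W k)" for k by (simp add: W_def)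
  have W_norm: "wnorm_le \<omega> (W k) M" for k
  proof (induction k)
    case 0
    have "0 \<le> M" using C by (rule sums_bounded_nonneg)
    then show ?case by (simp add: W_def wnorm_le_def sums_bounded_def)
  qed (simp add: W_Suc nxt)
  have agree: "time_part \<gamma> < k \<Longrightarrow> W (Suc k) \<gamma> = W k \<gamma>" for k \<gamma>
  proof (induction k arbitrary: \<gamma>)
    case (Suc k)
    then show ?case
      unfolding W_Suc[of "Suc k"] W_Suc[of k] using step[OF W_norm W_norm, of k "Suc k" k] by (simp add: W_Suc)
  qed simp
  have agree': "time_part \<gamma> < k \<Longrightarrow> W (k + n) \<gamma> = W k \<gamma>" for k n \<gamma>
    by (induction n) (auto simp: agree)
  \<comment> \<open>The iterate with index one above the time exponent is the first at which
    \<open>agree\<close> makes this coefficient final.\<close>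
  define w where "w = (\<lambda>\<gamma>. W (Suc (time_part \<gamma>)) \<gamma>)"
  have w_W: "w \<gamma> = W k \<gamma>" if "time_part \<gamma> < k" for \<gamma> k
    using agree'[of \<gamma> "Suc (time_part \<gamma>)" "k - Suc (time_part \<gamma>)"] that by (simp add: w_def)
  have w: "wnorm_le \<omega> w M"
    unfolding wnorm_le_def
  proof (rule sums_boundedI)
    fix S :: "(tx_index \<Rightarrow>\<^sub>0 nat) set" assume S: "finite S"
    \<comment> \<open>On finitely many exponents the limit coincides with a single iterate, so the
      norm bound is inherited without convergence in norm.\<close>
    define k where "k = Suc (Max (time_part ` S))"
    have "time_part \<gamma> < k" if "\<gamma> \<in> S" for \<gamma>
      using S that by (simp add: k_def less_Suc_eq_le)
    then have "(\<Sum>\<gamma>\<in>S. \<bar>w \<gamma>\<bar> * \<omega> \<gamma>) = (\<Sum>\<gamma>\<in>S. \<bar>W k \<gamma>\<bar> * \<omega> \<gamma>)"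
      by (intro sum.cong refl) (simp only: w_W[of _ k])
    also have "\<dots> \<le> M" using W_norm[of k] S by (auto simp: wnorm_le_def sums_bounded_def)
    finally show "(\<Sum>\<gamma>\<in>S. \<bar>w \<gamma>\<bar> * \<omega> \<gamma>) \<le> M" .
  qed
  have "next_w w = w"
  proof
    fix \<gamma>
    have "next_w w \<gamma> = next_w (W (time_part \<gamma>)) \<gamma>"
      by (rule step[OF w W_norm, of "time_part \<gamma>"]) (auto simp: w_W)
    then show "next_w w \<gamma> = w \<gamma>" by (simp add: w_def W_Suc)
  qed
  then have "msum w y = ?G w y" if "y \<in> lq_ball q UNIV R" for y
    using nxt_eq[OF w dom[OF that]] by simp
  then show ?thesis using w by blast
qed

section \<open>Passing between space and space-time\<close>

lemma lq_le_inj: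
  assumes "lq_le q y r" "inj g" shows "lq_le q (\<lambda>i. y (g i)) r"
proof (cases "q = \<infinity>")
  case False
  have "(\<Sum>i\<in>S. \<bar>y (g i)\<bar> powr enn2real q) \<le> r powr enn2real q" if "finite S" for S
  proof -
    have "(\<Sum>i\<in>S. \<bar>y (g i)\<bar> powr enn2real q) = (\<Sum>v\<in>g ` S. \<bar>y v\<bar> powr enn2real q)"
      using assms(2) by (subst sum.reindex) (auto simp: inj_on_def)
    then show ?thesis using assms(1) False that by (simp add: lq_le_def)
  qed
  then show ?thesis using False by (simp add: lq_le_def)
qed (use assms in \<open>simp add: lq_le_def\<close>)

lemma tx_point_simps [simp]: "tx_point t x Time = t" "tx_point t x (Space i) = x i"
  by (simp_all add: tx_point_def)

lemma lq_le_tx_point: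
  assumes r: "0 \<le> r" and x: "lq_le q x r" shows "lq_le q (tx_point 0 x) r"
proof (cases "q = \<infinity>")
  case True
  then have "\<bar>tx_point 0 x v\<bar> \<le> r" for v using x r by (cases v) (auto simp: lq_le_def)
  then show ?thesis using True by (simp add: lq_le_def)
next
  case False
  have "(\<Sum>v\<in>S. \<bar>tx_point 0 x v\<bar> powr enn2real q) \<le> r powr enn2real q" if S: "finite S" for S
  proof -
    have "(\<Sum>v\<in>S. \<bar>tx_point 0 x v\<bar> powr enn2real q) = (\<Sum>v\<in>Space ` (Space -` S). \<bar>tx_point 0 x v\<bar> powr enn2real q)"
    proof (rule sum.mono_neutral_right[OF S])
      show "\<forall>v\<in>S - Space ` (Space -` S). \<bar>tx_point 0 x v\<bar> powr enn2real q = 0"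
      proof
        fix v assume v: "v \<in> S - Space ` (Space -` S)"
        then have "v = Time" by (cases v) auto
        then show "\<bar>tx_point 0 x v\<bar> powr enn2real q = 0" by simp
      qed
    qed auto
    also have "\<dots> = (\<Sum>i\<in>Space -` S. \<bar>x i\<bar> powr enn2real q)"
      by (subst sum.reindex) (auto simp: inj_on_def)
    also have "\<dots> \<le> r powr enn2real q"
      using x False S finite_vimageI[OF S, of Space] by (auto simp: lq_le_def inj_def)
    finally show ?thesis .
  qed
  then show ?thesis using False by (simp add: lq_le_def)
qed

lemma tx_point_ball_iff:
  assumes q: "1 \<le> q"
  shows "tx_point 0 x \<in> lq_ball q UNIV R \<longleftrightarrow> x \<in> lq_ball q UNIV R"
proof
  assume "tx_point 0 x \<in> lq_ball q UNIV R"
  then have t: "tx_point 0 x \<in> lq_space q UNIV" "lq_norm q UNIV (tx_point 0 x) < R" by (auto simp: lq_ball_iff)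
  have *: "lq_le q x (lq_norm q UNIV (tx_point 0 x))"
    using lq_le_inj[OF lq_le_norm[OF q t(1)], of Space] by (simp add: inj_def)
  show "x \<in> lq_ball q UNIV R"
    using lq_memI[OF q lq_norm_nonneg[OF t(1)] *] lq_norm_leI[OF q lq_norm_nonneg[OF t(1)] *] t(2)
    by (simp add: lq_ball_iff)
next
  assume "x \<in> lq_ball q UNIV R"
  then have t: "x \<in> lq_space q UNIV" "lq_norm q UNIV x < R" by (auto simp: lq_ball_iff)
  have *: "lq_le q (tx_point 0 x) (lq_norm q UNIV x)"
    by (rule lq_le_tx_point[OF lq_norm_nonneg[OF t(1)] lq_le_norm[OF q t(1)]])
  show "tx_point 0 x \<in> lq_ball q UNIV R"
    using lq_memI[OF q lq_norm_nonneg[OF t(1)] *] lq_norm_leI[OF q lq_norm_nonneg[OF t(1)] *] t(2)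
    by (simp add: lq_ball_iff)
qed

lemma mpow_tx_point: "mpow (tx_point 0 x) (tx_multi j \<beta>) = 0 ^ j * mpow x \<beta>"
  by (simp add: mpow_tx_multi)

lemma inj_tx_multi: "inj (tx_multi j)"
  by (rule injI) (metis space_part_tx_multi)

lemma msum_tx_point: "msum b (tx_point 0 x) = msum (\<lambda>\<beta>. b (tx_multi 0 \<beta>)) x"
proof -
  let ?f = "\<lambda>\<gamma>. b \<gamma> * mpow (tx_point 0 x) \<gamma>"
  have "infsum ?f UNIV = infsum ?f (range (tx_multi 0))"
  proof (rule infsum_cong_neutral)
    fix \<gamma> assume "\<gamma> \<in> UNIV - range (tx_multi 0)"
    then have "time_part \<gamma> \<noteq> 0" by (metis DiffD2 rangeI tx_multi_parts)
    then show "?f \<gamma> = 0" using mpow_tx_point[of x "time_part \<gamma>" "space_part \<gamma>"] by simp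
  qed auto
  also have "\<dots> = infsum (?f \<circ> tx_multi 0) UNIV" by (rule infsum_reindex[OF inj_tx_multi])
  finally show ?thesis by (simp add: monomial_sum_def o_def mpow_tx_point)
qed

lemma ball_convergent_tx_point:
  fixes b :: "(tx_index \<Rightarrow>\<^sub>0 nat) \<Rightarrow> real"
  assumes q: "1 \<le> q" and b: "ball_convergent q b R"
  shows "ball_convergent q (\<lambda>\<beta>. b (tx_multi 0 \<beta>)) R"
  unfolding ball_convergent_def
proof (intro allI impI)
  fix R' assume "R' < R"
  then obtain K where K: "ball_bounded q b R' K" using b by (auto simp: ball_convergent_def)
  have "ball_bounded q (\<lambda>\<beta>. b (tx_multi 0 \<beta>)) R' (1 * K)"
    unfolding ball_bounded_def
  proof
    fix x :: "nat \<Rightarrow> real" assume "x \<in> lq_ball q UNIV R'"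
    then have "tx_point 0 x \<in> lq_ball q UNIV R'" using tx_point_ball_iff[OF q] by blast
    from sums_bounded_comparison[OF ball_boundedD[OF K this], of "tx_multi 0" UNIV UNIV _ 1]
    show "sums_bounded (\<lambda>\<beta>. \<bar>b (tx_multi 0 \<beta>) * mpow x \<beta>\<bar>) UNIV (1 * K)"
      using inj_tx_multi by (simp add: mpow_tx_point)
  qed
  then show "\<exists>K. ball_bounded q (\<lambda>\<beta>. b (tx_multi 0 \<beta>)) R' K" by blast
qed

lemma dcoefs_time: "dcoefs (replicate k Time) v (tx_multi 0 \<beta>) = fact k * v (tx_multi k \<beta>)"
proof -
  have "tx_multi 0 \<beta> + Poly_Mapping.single Time k = tx_multi k \<beta>"
    unfolding tx_multi_zero[symmetric] tx_multi_add by simp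
  then show ?thesis by (simp add: dcoefs_eq mfact_tx_multi)
qed

text \<open>Together with \<open>dcoefs_sol_coef\<close>: on series with prescribed data,
  \<open>\<partial>_t^m\<close> and \<open>sol_coef\<close> are inverse to each other, so the
  problem may be posed for \<open>w\<close> alone.\<close>

lemma sol_coef_dcoefs:
  assumes "\<And>\<gamma>. time_part \<gamma> < m \<Longrightarrow> v \<gamma> = data_coef m c \<gamma>"
  shows "sol_coef m c (dcoefs (replicate m Time) v) = v"
proof
  fix \<gamma>
  show "sol_coef m c (dcoefs (replicate m Time) v) \<gamma> = v \<gamma>"
  proof (cases "time_part \<gamma> < m")
    case False
    then obtain z where "\<gamma> = z + Poly_Mapping.single Time m" using split_single[of m \<gamma> Time] by auto
    then show ?thesis by (simp add: sol_coef_high dcoefs_eq)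
  qed (simp add: sol_coef_low assms)
qed

text \<open>Analyticity demands a point of absolute convergence with no zero coordinate; geometric
  decay along an enumeration of the countable index set supplies one inside any ball.\<close>

lemma lq_positive_point:
  fixes g :: "'i \<Rightarrow> nat"
  assumes q: "1 \<le> q" and R: "0 < R" and g: "inj g"
  shows "\<exists>y\<in>lq_ball q UNIV R. \<forall>i :: 'i. 0 < y i"
proof -
  define y where "y = (\<lambda>i. R / 2 * (1 / 2) ^ Suc (g i))"
  have le1: "(1 / 2 :: real) ^ Suc n \<le> 1" for n by (rule power_le_one) auto
  have "lq_le q y (R / 2)"
  proof (cases "q = \<infinity>")
    case True
    have "\<bar>y i\<bar> \<le> R / 2" for i using mult_left_mono[OF le1[of "g i"], of "R / 2"] R by (simp add: y_def)
    then show ?thesis using True by (simp add: lq_le_def)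
  next
    case False
    define e where "e = enn2real q"
    have e: "1 \<le> e" unfolding e_def using q False by (rule enn2real_ge_1)
    have "(\<Sum>i\<in>S. \<bar>y i\<bar> powr e) \<le> (R / 2) powr e" if S: "finite S" for S
    proof -
      have "\<bar>y i\<bar> powr e \<le> (R / 2) powr e * (1 / 2) ^ Suc (g i)" for i
      proof -
        have "\<bar>y i\<bar> = R / 2 * (1 / 2) ^ Suc (g i)" using R by (simp add: y_def)
        also have "\<dots> powr e = (R / 2) powr e * ((1 / 2) ^ Suc (g i)) powr e"
          by (rule powr_mult)
        also have "\<dots> \<le> (R / 2) powr e * ((1 / 2) ^ Suc (g i)) powr 1"
          using e le1 by (intro mult_left_mono powr_mono') auto
        finally show ?thesis by simp
      qed
      then have "(\<Sum>i\<in>S. \<bar>y i\<bar> powr e) \<le> (\<Sum>i\<in>S. (R / 2) powr e * (1 / 2) ^ Suc (g i))" by (rule sum_mono)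
      also have "\<dots> = (R / 2) powr e * (\<Sum>n\<in>g ` S. (1 / 2) ^ Suc n)"
        using g by (subst sum.reindex) (auto simp: sum_distrib_left inj_on_def)
      also have "\<dots> \<le> (R / 2) powr e * 1"
      proof (rule mult_left_mono)
        have "(\<Sum>n\<in>g ` S. (1 / 2) ^ Suc n) \<le> suminf (\<lambda>n. (1 / 2 :: real) ^ Suc n)"
          using S by (intro sum_le_suminf sums_summable[OF power_half_series]) auto
        then show "(\<Sum>n\<in>g ` S. (1 / 2 :: real) ^ Suc n) \<le> 1"
          using sums_unique[OF power_half_series] by simp
      qed simp
      finally show ?thesis by simp
    qed
    then show ?thesis using False by (simp add: lq_le_def e_def)
  qed
  then have "y \<in> lq_ball q UNIV R"
    using lq_memI[OF q, of "R / 2" y] lq_norm_leI[OF q, of "R / 2" y] R by (simp add: lq_ball_iff)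
  moreover have "\<forall>i. 0 < y i" using R by (simp add: y_def)
  ultimately show ?thesis by blast
qed

lemma msum_analytic_near_under:
  fixes v :: "('i \<Rightarrow>\<^sub>0 nat) \<Rightarrow> real" and g :: "'i \<Rightarrow> nat"
  assumes q: "1 \<le> q" and R: "0 < R" and v: "ball_convergent q v R" and g: "inj g"
  shows "analytic_near_under q UNIV (lq_ball q UNIV R) (msum v) (\<lambda>_. 0)"
proof -
  obtain \<rho> :: "'i \<Rightarrow> real" where \<rho>: "\<rho> \<in> lq_ball q UNIV R" "\<And>i. 0 < \<rho> i"
    using lq_positive_point[OF q R g] by blast
  have "analytic_near_at UNIV (lq_ball q UNIV R) (msum v) (\<lambda>_. 0) v \<rho>"
    unfolding analytic_near_at_def
    using \<rho> lq_ball_zero[OF q R] ball_convergent_conv(1)[OF v \<rho>(1)] lq_ball_solid[OF q \<rho>(1)]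
    by (auto simp: Rprod_def less_imp_neq[THEN not_sym])
  then show ?thesis
    unfolding analytic_near_under_def analytic_near_with_def
    using openin_lq_ball[OF R] lq_ball_zero[OF q R] ball_convergent_conv(1)[OF v]
    by (intro exI[of _ v] conjI exI[of _ \<rho>] exI[of _ "lq_ball q UNIV R"]) auto
qed


section \<open>Solutions of the Cauchy problem\<close>

lemma sums_bounded_powr_le:
  fixes x :: "'a \<Rightarrow> real"
  assumes p: "1 \<le> p" and S: "sums_bounded (\<lambda>i. \<bar>x i\<bar> powr p) I S" and i: "i \<in> I"
  shows "\<bar>x i\<bar> \<le> max 1 S"
proof (cases "\<bar>x i\<bar> \<le> 1")
  case False
  then have "\<bar>x i\<bar> powr 1 \<le> \<bar>x i\<bar> powr p" using p by (intro powr_mono) auto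
  also have "\<dots> \<le> S" using S i by (rule sums_bounded_member)
  finally show ?thesis by simp
qed simp

lemma sums_bounded_sum:
  assumes "\<And>k. k \<in> K \<Longrightarrow> sums_bounded (f k) A (B k)"
  shows "sums_bounded (\<lambda>x. \<Sum>k\<in>K. f k x) A (sum B K)"
proof (rule sums_boundedI)
  fix S assume S: "S \<subseteq> A" "finite S"
  have "(\<Sum>x\<in>S. \<Sum>k\<in>K. f k x) = (\<Sum>k\<in>K. \<Sum>x\<in>S. f k x)" by (rule sum.swap)
  also have "\<dots> \<le> sum B K" using assms S by (intro sum_mono sums_boundedD[of "f _"]) auto
  finally show "(\<Sum>x\<in>S. \<Sum>k\<in>K. f k x) \<le> sum B K" .
qed

lemma analytic_near_at_bounded:
  assumes "analytic_near_at I D f x\<^sub>0 C \<rho>"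
  shows "\<exists>M. sums_bounded (\<lambda>\<alpha>. \<bar>C \<alpha>\<bar> * mpow (\<lambda>i. \<bar>\<rho> i\<bar>) \<alpha>) (multi_indices I) M"
proof -
  have s: "(\<lambda>\<alpha>. \<bar>C \<alpha> * mpow \<rho> \<alpha>\<bar>) summable_on multi_indices I"
    using assms by (simp add: analytic_near_at_def monomial_conv_def)
  have "sums_bounded (\<lambda>\<alpha>. \<bar>C \<alpha> * mpow \<rho> \<alpha>\<bar>) (multi_indices I) (\<Sum>\<^sub>\<infinity>\<alpha>\<in>multi_indices I. \<bar>C \<alpha> * mpow \<rho> \<alpha>\<bar>)"
    by (rule summable_sums_bounded[OF s]) auto
  then show ?thesis by (auto simp: abs_mult abs_mpow)
qed

lemma abs_conv_near_infinityE:
  assumes "abs_conv_near_infinity p I D f x\<^sub>0 C"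
  obtains \<rho> M S where "analytic_near_at I D f x\<^sub>0 C \<rho>"
    "sums_bounded (\<lambda>\<alpha>. \<bar>C \<alpha>\<bar> * mpow (\<lambda>i. \<bar>\<rho> i\<bar>) \<alpha>) (multi_indices I) M"
    "sums_bounded (\<lambda>i. \<bar>1 / \<bar>\<rho> i\<bar>\<bar> powr p) I S"
proof -
  obtain \<rho> where s: "(\<lambda>i. 1 / \<bar>\<rho> i\<bar> powr p) summable_on I" and \<rho>: "analytic_near_at I D f x\<^sub>0 C \<rho>"
    using assms by (auto simp: abs_conv_near_infinity_def)
  have "sums_bounded (\<lambda>i. 1 / \<bar>\<rho> i\<bar> powr p) I (\<Sum>\<^sub>\<infinity>i\<in>I. 1 / \<bar>\<rho> i\<bar> powr p)"
    by (rule summable_sums_bounded[OF s]) auto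
  then have "sums_bounded (\<lambda>i. \<bar>1 / \<bar>\<rho> i\<bar>\<bar> powr p) I (\<Sum>\<^sub>\<infinity>i\<in>I. 1 / \<bar>\<rho> i\<bar> powr p)"
    by (simp add: powr_divide)
  then show ?thesis using that \<rho> analytic_near_at_bounded[OF \<rho>] by blast
qed

text \<open>The pointwise maximum of finitely many p-summable sequences is p-summable, its p-th
  power being at most the sum of theirs. Its inverse lies below all the given radii at once.\<close>

lemma common_weight:
  fixes b :: "nat \<Rightarrow> real" and t :: "nat \<Rightarrow> nat \<Rightarrow> real"
  assumes p: "1 \<le> p" and b: "\<And>i. 0 < b i" "sums_bounded (\<lambda>i. \<bar>b i\<bar> powr p) UNIV B"
    and t: "\<And>k. k < m \<Longrightarrow> sums_bounded (\<lambda>i. \<bar>t k i\<bar> powr p) UNIV (T k)"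
  shows "\<exists>a S. (\<forall>i. 0 < a i) \<and> (\<forall>i. b i \<le> a i) \<and> (\<forall>k<m. \<forall>i. t k i \<le> a i) \<and>
    sums_bounded (\<lambda>i. \<bar>a i\<bar> powr p) UNIV S"
proof -
  define X where "X = (\<lambda>i. insert (b i) ((\<lambda>k. t k i) ` {..<m}))"
  define a where "a = (\<lambda>i. Max (X i))"
  have fin: "finite (X i)" "X i \<noteq> {}" for i by (auto simp: X_def)
  have ge: "x \<le> a i" if "x \<in> X i" for x i unfolding a_def using fin that by simp
  have mem: "a i \<in> X i" for i unfolding a_def by (rule Max_in[OF fin])
  have b_a: "b i \<le> a i" for i by (rule ge) (simp add: X_def)
  show ?thesis
  proof (intro exI conjI allI impI)
    show "b i \<le> a i" for i by (rule b_a)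
    show "0 < a i" for i using b(1)[of i] b_a[of i] by simp
    show "t k i \<le> a i" if "k < m" for i k using that by (intro ge) (simp add: X_def)
    have le: "\<bar>a i\<bar> powr p \<le> \<bar>b i\<bar> powr p + (\<Sum>k<m. \<bar>t k i\<bar> powr p)" for i
    proof -
      have nn: "0 \<le> (\<Sum>k<m. \<bar>t k i\<bar> powr p)" by (rule sum_nonneg) simp
      consider "a i = b i" | k where "k < m" "a i = t k i" using mem[of i] by (auto simp: X_def)
      then show ?thesis
      proof cases
        case 2
        have "\<bar>t k i\<bar> powr p \<le> (\<Sum>k<m. \<bar>t k i\<bar> powr p)"
          by (rule member_le_sum[of k "{..<m}" "\<lambda>k. \<bar>t k i\<bar> powr p"]) (use 2 in auto)
        then show ?thesis using 2 by (simp add: add_increasing)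
      qed (use nn in simp)
    qed
    show "sums_bounded (\<lambda>i. \<bar>a i\<bar> powr p) UNIV (B + sum T {..<m})"
      by (rule sums_bounded_le[OF sums_bounded_add[OF b(2) sums_bounded_sum] le]) (use t in auto)
  qed
qed

lemma sums_bounded_tx_weights:
  assumes \<epsilon>: "0 < \<epsilon>" and a: "sums_bounded (\<lambda>i. \<bar>a i\<bar> powr p) UNIV S"
  shows "sums_bounded (\<lambda>v. \<bar>tx_weights \<epsilon> a v\<bar> powr p) UNIV ((1 / \<epsilon>) powr p + S)"
proof (rule sums_boundedI)
  fix V :: "tx_index set" assume V: "finite V"
  obtain N where fin: "finite N" and sub: "V \<subseteq> insert Time (Space ` N)"
  proof
    show "finite (Space -` V)" using V by (rule finite_vimageI) (auto simp: inj_def)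
    show "V \<subseteq> insert Time (Space ` (Space -` V))"
    proof
      fix v assume "v \<in> V" then show "v \<in> insert Time (Space ` (Space -` V))" by (cases v) auto
    qed
  qed
  have "(\<Sum>v\<in>V. \<bar>tx_weights \<epsilon> a v\<bar> powr p) \<le> (\<Sum>v\<in>insert Time (Space ` N). \<bar>tx_weights \<epsilon> a v\<bar> powr p)"
    using fin sub V by (intro sum_mono2) auto
  also have "\<dots> = (1 / \<epsilon>) powr p + (\<Sum>i\<in>N. \<bar>a i\<bar> powr p)"
    using fin \<epsilon> by (subst sum.insert) (auto simp: sum.reindex inj_on_def)
  also have "\<dots> \<le> (1 / \<epsilon>) powr p + S" using sums_boundedD[OF a _ fin] by simp
  finally show "(\<Sum>v\<in>V. \<bar>tx_weights \<epsilon> a v\<bar> powr p) \<le> (1 / \<epsilon>) powr p + S" .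
qed

section \<open>Choice of the parameters and existence\<close>

lemma analytic_solution_exists:
  fixes a :: "nat \<Rightarrow> real"
  assumes p: "1 \<le> p" and conj: "1 / ennreal p + 1 / q = 1" and m: "0 < m"
    and a: "\<And>i. 0 < a i" and aS: "sums_bounded (\<lambda>i. \<bar>a i\<bar> powr p) UNIV S"
    and \<mu>: "0 < \<mu>" and \<rho>: "\<And>i. i \<in> jet_indices m \<Longrightarrow> \<mu> \<le> \<rho> i"
    and a\<rho>: "\<And>i. 1 / a i \<le> \<rho> (Indep (Space i))"
    and C: "sums_bounded (\<lambda>\<alpha>. \<bar>C \<alpha>\<bar> * mpow \<rho> \<alpha>) (multi_indices (jet_indices m)) M"
    and R: "\<And>k i. k < m \<Longrightarrow> 1 / a i \<le> R k i"
    and L: "\<And>k. k < m \<Longrightarrow> sums_bounded (\<lambda>\<beta>. \<bar>c k \<beta>\<bar> * mpow (R k) \<beta>) UNIV (L k)"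
  shows "\<exists>R\<^sub>0>0. \<exists>w. ball_convergent q w R\<^sub>0 \<and> ball_convergent q (sol_coef m c w) R\<^sub>0 \<and>
      (\<forall>y\<in>lq_ball q UNIV R\<^sub>0. (\<forall>i\<in>jet_indices m. \<bar>msum (jet_coef m (sol_coef m c w) i) y\<bar> \<le> \<rho> i / 2) \<and>
        msum w y = monomial_sum (jet_indices m) C (\<lambda>i. msum (jet_coef m (sol_coef m c w) i) y))"
proof -
  have q: "1 \<le> q" using conjugate_ge_1[OF p conj] .
  have M0: "0 \<le> M" using C by (rule sums_bounded_nonneg)
  define A where "A = max 1 S"
  have A: "1 \<le> A" "a i \<le> A" for i
    using sums_bounded_powr_le[OF p aS, of i] a[of i] by (auto simp: A_def)
  have cancel: "x / (4 * z) * z = x / 4" if "z \<noteq> 0" for x z :: real using that by simp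
  define Q where "Q = 2 * (fact m * 2 ^ m) * A ^ m * sum L {..<m}"
  have Q0: "0 \<le> Q"
    unfolding Q_def using A(1) sums_bounded_nonneg[OF L] by (auto intro!: mult_nonneg_nonneg sum_nonneg)
  \<comment> \<open>Makes the contribution of the data, \<open>r * Q\<close>, at most
    \<open>\<mu> / 4\<close> in every jet.\<close>
  define r where "r = min (1 / 2) (\<mu> / (4 * (Q + 1)))"
  have r: "0 < r" "r \<le> 1 / 2" using \<mu> Q0 unfolding r_def by (simp, intro min.cobounded1)
  have rQ: "r * Q \<le> \<mu> / 4"
  proof -
    have "r * Q \<le> (\<mu> / (4 * (Q + 1))) * (Q + 1)" using \<mu> Q0 by (intro mult_mono) (auto simp: r_def)
    then show ?thesis using cancel[of "Q + 1" \<mu>] Q0 by linarith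
  qed
  \<comment> \<open>The last entry makes the contribution of the integral at most
    \<open>\<mu> / 4\<close>; \<open>\<epsilon> \<le> \<mu>\<close> is for the time coordinate,
    which is itself a jet variable of norm \<open>r * \<epsilon>\<close>.\<close>
  define \<epsilon> where "\<epsilon> = min (min 1 \<mu>) (\<mu> / (4 * (A ^ m * M + 1)))"
  have AM: "0 \<le> A ^ m * M" using A(1) M0 by simp
  have \<epsilon>: "0 < \<epsilon>" "\<epsilon> \<le> 1" "\<epsilon> \<le> \<mu>" using \<mu> AM by (auto simp: \<epsilon>_def)
  have \<epsilon>M: "A ^ m * \<epsilon> * M \<le> \<mu> / 4"
  proof -
    have "\<epsilon> * (A ^ m * M) \<le> (\<mu> / (4 * (A ^ m * M + 1))) * (A ^ m * M + 1)"
      using \<mu> AM \<epsilon> by (intro mult_mono) (auto simp: \<epsilon>_def)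
    then have "\<epsilon> * (A ^ m * M) \<le> \<mu> / 4" using cancel[of "A ^ m * M + 1" \<mu>] AM by linarith
    then show ?thesis by (simp add: mult_ac)
  qed
  define \<kappa> where "\<kappa> = tx_weights \<epsilon> a"
  define \<omega> where "\<omega> = geo_weight r \<kappa>"
  have \<kappa>: "0 < \<kappa> v" for v unfolding \<kappa>_def by (rule tx_weights_pos[OF \<epsilon>(1) a])
  have \<omega>: "submult_weight \<omega>" unfolding \<omega>_def by (rule submult_geo_weight[OF r(1) \<kappa>])
  obtain K where K: "0 < K"
    "\<And>y. y \<in> lq_space q UNIV \<Longrightarrow> sums_bounded (\<lambda>v. \<bar>\<kappa> v\<bar> * \<bar>y v\<bar>) UNIV (K * lq_norm q UNIV y)"
    using lq_holder[OF p conj sums_bounded_tx_weights[OF \<epsilon>(1) aS]] unfolding \<kappa>_def by blast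
  \<comment> \<open>On this ball Hoelder's inequality gives the weighted sum of the coordinates the
    bound \<open>r\<close>, as the geometric weight requires.\<close>
  define R\<^sub>0 where "R\<^sub>0 = r / K"
  have R0: "0 < R\<^sub>0" using r K by (simp add: R\<^sub>0_def)
  have dom: "dominated_by \<omega> y" if y: "y \<in> lq_ball q UNIV R\<^sub>0" for y
    unfolding \<omega>_def
  proof (rule dominated_by_geo_weight[OF \<kappa>])
    have "K * lq_norm q UNIV y \<le> K * R\<^sub>0" using y K by (intro mult_left_mono) (auto simp: lq_ball_iff)
    then have "K * lq_norm q UNIV y \<le> r" using K by (simp add: R\<^sub>0_def)
    moreover have "sums_bounded (\<lambda>v. \<kappa> v * \<bar>y v\<bar>) UNIV (K * lq_norm q UNIV y)"
      using K(2)[of y] y \<kappa> by (simp add: lq_ball_iff less_imp_le)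
    ultimately show "sums_bounded (\<lambda>v. \<kappa> v * \<bar>y v\<bar>) UNIV r" by (rule sums_bounded_mono[rotated])
  qed
  have jets: "wnorm_le \<omega> (\<lambda>\<gamma>. if \<gamma> = 0 then 0 else dcoefs (tx_derivs \<beta> j) (sol_coef m c w) \<gamma>) (\<mu> / 2)"
    if w: "wnorm_le \<omega> w M" and \<beta>: "mdeg \<beta> + j \<le> m" "j < m" for w \<beta> j
  proof (rule wnorm_le_mono)
    show "wnorm_le \<omega> (\<lambda>\<gamma>. if \<gamma> = 0 then 0 else dcoefs (tx_derivs \<beta> j) (sol_coef m c w) \<gamma>)
        (2 * r * (fact m * 2 ^ m) * A ^ m * sum L {..<m} + A ^ m * \<epsilon> * M)"
      using w unfolding \<omega>_def \<kappa>_def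
      by (intro wnorm_jet_coef[OF r \<epsilon>(1,2) a A \<beta> R L]) auto
    show "2 * r * (fact m * 2 ^ m) * A ^ m * sum L {..<m} + A ^ m * \<epsilon> * M \<le> \<mu> / 2"
      using rQ \<epsilon>M by (simp add: Q_def mult_ac)
  qed
  have norm: "wnorm_le \<omega> (jet_coef m (sol_coef m c w) i) (\<rho> i / 2)"
    if w: "wnorm_le \<omega> w M" and i: "i \<in> jet_indices m" for w i
    using i m
  proof (cases rule: jet_coef_cases)
    case (1 b)
    have "\<omega> (unit_index b) \<le> \<rho> i / 2"
    proof (cases b)
      case Time
      have "\<omega> (unit_index b) = r * \<epsilon>" by (simp add: \<omega>_def \<kappa>_def geo_weight_def Time)
      also have "\<dots> \<le> 1 / 2 * \<mu>" using r \<epsilon> by (intro mult_mono) auto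
      finally show ?thesis using \<rho>[OF i] by simp
    next
      case (Space n)
      have "\<omega> (unit_index b) = r * (1 / a n)" by (simp add: \<omega>_def \<kappa>_def geo_weight_def Space)
      also have "\<dots> \<le> 1 / 2 * \<rho> (Indep (Space n))" using r a\<rho>[of n] a[of n] by (intro mult_mono) auto
      finally show ?thesis by (simp add: 1 Space)
    qed
    moreover have "wnorm_le \<omega> (jet_coef m (sol_coef m c w) i) (\<omega> (unit_index b))"
      unfolding wnorm_le_def
    proof (rule sums_boundedI)
      fix T :: "(tx_index \<Rightarrow>\<^sub>0 nat) set" assume T: "finite T"
      have "0 < \<omega> (unit_index b)" using \<omega> by (simp add: submult_weight_def)
      moreover have "(\<Sum>\<gamma>\<in>T. \<bar>jet_coef m (sol_coef m c w) i \<gamma>\<bar> * \<omega> \<gamma>)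
          = (\<Sum>\<gamma>\<in>T. if \<gamma> = unit_index b then \<omega> (unit_index b) else 0)"
        by (intro sum.cong) (auto simp: 1 jet_coef_def)
      ultimately show "(\<Sum>\<gamma>\<in>T. \<bar>jet_coef m (sol_coef m c w) i \<gamma>\<bar> * \<omega> \<gamma>) \<le> \<omega> (unit_index b)"
        using T by simp
    qed
    ultimately show ?thesis by (rule wnorm_le_mono[rotated])
  next
    case (2 \<beta> j)
    have "wnorm_le \<omega> (jet_coef m (sol_coef m c w) i) (\<mu> / 2)"
      using jets[OF w 2(2,1)] unfolding 2(3) .
    then show ?thesis by (rule wnorm_le_mono) (use \<rho>[OF i] in simp)
  qed
  have conv: "ball_convergent q (sol_coef m c w) R\<^sub>0" if "wnorm_le \<omega> w M" for w
  proof -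
    \<comment> \<open>The jet estimate for \<open>\<beta> = 0\<close>, \<open>j = 0\<close> bounds
      the unknown up to its constant term, which is added back separately.\<close>
    have "wnorm_le \<omega> (\<lambda>\<gamma>. if \<gamma> = 0 then 0 else sol_coef m c w \<gamma>) (\<mu> / 2)"
      using jets[OF that, of 0 0] m by (simp add: tx_derivs_zero cong: if_cong)
    from ball_bounded_add_const[OF wnorm_le_ball_bounded[OF this dom]]
    show ?thesis by (rule ball_bounded_convergent)
  qed
  obtain w where w: "wnorm_le \<omega> w M" "\<And>y. y \<in> lq_ball q UNIV R\<^sub>0 \<Longrightarrow>
      msum w y = monomial_sum (jet_indices m) C (\<lambda>i. msum (jet_coef m (sol_coef m c w) i) y)"
    using formal_solution_exists[OF q R0 m \<omega> dom \<mu> \<rho> C norm conv] by blast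
  show ?thesis
    using R0 conv[OF w(1)] ball_bounded_convergent[OF wnorm_le_ball_bounded[OF w(1) dom]] w(2)
      wnorm_le_msum[OF norm[OF w(1)] dom]
    by (intro exI[of _ R\<^sub>0] conjI exI[of _ w] ballI) auto
qed


text \<open>What the solution theory uses once the radii are extracted: \<mu> is a common lower
  bound of the radii of the expansion of \<open>f\<close>, and \<delta> is the radius of a ball on
  which all the data are represented by their series.\<close>

locale cauchy_data =
  fixes m :: nat and q :: ennreal and D :: "(jet_index \<Rightarrow> real) set" and f :: "(jet_index \<Rightarrow> real) \<Rightarrow> real"
    and E :: "nat \<Rightarrow> (nat \<Rightarrow> real) set" and \<phi> :: "nat \<Rightarrow> (nat \<Rightarrow> real) \<Rightarrow> real"
    and C :: "(jet_index \<Rightarrow>\<^sub>0 nat) \<Rightarrow> real" and c :: "nat \<Rightarrow> (nat \<Rightarrow>\<^sub>0 nat) \<Rightarrow> real"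
    and \<rho> :: "jet_index \<Rightarrow> real" and \<mu> M \<delta> :: real
  assumes m: "0 < m" and q: "1 \<le> q" and \<mu>: "0 < \<mu>" and \<delta>: "0 < \<delta>"
    and \<rho>: "\<And>i. i \<in> jet_indices m \<Longrightarrow> \<mu> \<le> \<rho> i"
    and C: "sums_bounded (\<lambda>\<alpha>. \<bar>C \<alpha>\<bar> * mpow \<rho> \<alpha>) (multi_indices (jet_indices m)) M"
    and f: "\<And>h. h \<in> Rprod (jet_indices m) \<Longrightarrow> (\<And>i. i \<in> jet_indices m \<Longrightarrow> \<bar>h i\<bar> \<le> \<rho> i) \<Longrightarrow>
        (\<lambda>i. initial_jet m \<phi> i + h i) \<in> D \<and>
        f (\<lambda>i. initial_jet m \<phi> i + h i) = monomial_sum (jet_indices m) C h"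
    and data: "\<And>k. k < m \<Longrightarrow> ball_convergent q (c k) \<delta>"
    and \<phi>: "\<And>k x. k < m \<Longrightarrow> x \<in> lq_ball q UNIV \<delta> \<Longrightarrow> x \<in> E k \<and> \<phi> k x = msum (c k) x"
begin

lemma iter_pderiv_data:
  "k < m \<Longrightarrow> iter_pderiv (mlist \<beta>) (\<phi> k) (\<lambda>_. 0) = mfact \<beta> * c k \<beta>"
  using iter_pderiv_at_zero[OF q \<delta> data, of k "\<phi> k" "mlist \<beta>"] \<phi> by simp

lemma initial_coefs:
  assumes "k < m" "\<And>\<gamma>. time_part \<gamma> < m \<Longrightarrow> v \<gamma> = data_coef m c \<gamma>"
  shows "mfact (tx_multi k \<beta>) * v (tx_multi k \<beta>) = iter_pderiv (mlist \<beta>) (\<phi> k) (\<lambda>_. 0)"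
  using assms by (simp add: iter_pderiv_data data_coef_def mfact_tx_multi)

lemma jet_in_polydisc:
  assumes R: "0 < R" and v: "ball_convergent q v R"
    and u: "\<And>y. y \<in> lq_ball q UNIV R \<Longrightarrow> u y = msum v y"
    and low: "\<And>\<gamma>. time_part \<gamma> < m \<Longrightarrow> v \<gamma> = data_coef m c \<gamma>"
    and y: "y \<in> lq_ball q UNIV R"
    and small: "\<And>i. i \<in> jet_indices m \<Longrightarrow> \<bar>msum (jet_coef m v i) y\<bar> \<le> \<rho> i / 2"
  shows "jet m u y \<in> D"
    and "f (jet m u y) = monomial_sum (jet_indices m) C (\<lambda>i. msum (jet_coef m v i) y)"
proof -
  have jet: "jet m u y = (\<lambda>i. initial_jet m \<phi> i + msum (jet_coef m v i) y)"
    by (rule jet_msum[OF q R v u y initial_coefs[OF _ low] m])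
  have "\<bar>msum (jet_coef m v i) y\<bar> \<le> \<rho> i" if "i \<in> jet_indices m" for i
    using small[OF that] \<rho>[OF that] \<mu> by simp
  from f[OF msum_jet_coef_Rprod this]
  show "jet m u y \<in> D" "f (jet m u y) = monomial_sum (jet_indices m) C (\<lambda>i. msum (jet_coef m v i) y)"
    unfolding jet by auto
qed

lemma solution_of_coefs:
  assumes R: "0 < R" "R \<le> \<delta>" and v: "ball_convergent q (sol_coef m c w) R"
    and small: "\<And>y i. y \<in> lq_ball q UNIV R \<Longrightarrow> i \<in> jet_indices m \<Longrightarrow>
        \<bar>msum (jet_coef m (sol_coef m c w) i) y\<bar> \<le> \<rho> i / 2"
    and w: "\<And>y. y \<in> lq_ball q UNIV R \<Longrightarrow>
        msum w y = monomial_sum (jet_indices m) C (\<lambda>i. msum (jet_coef m (sol_coef m c w) i) y)"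
  shows "cauchy_solution_on m D f E \<phi> (lq_ball q UNIV R) (msum (sol_coef m c w))"
proof -
  let ?v = "sol_coef m c w" and ?B = "lq_ball q UNIV R"
  note it = iter_pderiv_msum[OF q v, of "msum ?v", OF refl]
  show ?thesis
    unfolding cauchy_solution_on_def
  proof (intro conjI ballI allI impI)
    show "iter_pderiv_exists ?B (replicate m Time) (msum ?v)" by (rule it(2))
    show "case x of (\<beta>, j) \<Rightarrow> iter_pderiv_exists ?B (tx_derivs \<beta> j) (msum ?v)" for x
      using it(2) by (cases x) simp
    fix y :: "tx_index \<Rightarrow> real" assume y: "y \<in> ?B"
    note jp = jet_in_polydisc[OF R(1) v refl sol_coef_low y small[OF y]]
    show "jet m (msum ?v) y \<in> D" by (rule jp(1))
    show "iter_pderiv (replicate m Time) (msum ?v) y = f (jet m (msum ?v) y)"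
      using it(1)[OF y, of "replicate m Time"] w[OF y] jp(2) by (simp add: dcoefs_sol_coef)
  next
    fix k x assume k: "k < m" and x: "tx_point 0 x \<in> ?B"
    then have x': "x \<in> lq_ball q UNIV \<delta>"
      using tx_point_ball_iff[OF q] lq_ball_mono[OF R(2)] by blast
    show "x \<in> E k" using \<phi>[OF k x'] by simp
    have "iter_pderiv (replicate k Time) (msum ?v) (tx_point 0 x) = msum (c k) x"
      using it(1)[OF x, of "replicate k Time"] k
      by (simp add: msum_tx_point dcoefs_time sol_coef_low data_coef_def)
    then show "iter_pderiv (replicate k Time) (msum ?v) (tx_point 0 x) = \<phi> k x"
      using \<phi>[OF k x'] by simp
  qed
qed

text \<open>For a competing solution no weighted norm bound is known. Its jets are bounded uniformly
  over all derivatives of order at most \<open>m\<close>, and since their constant terms are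
  removed, shrinking the ball makes them uniformly small.\<close>

lemma jets_small_near_zero:
  assumes R: "0 < R" and v: "ball_convergent q v R"
  shows "\<exists>R'>0. R' \<le> R \<and> (\<forall>y\<in>lq_ball q UNIV R'. \<forall>i\<in>jet_indices m. \<bar>msum (jet_coef m v i) y\<bar> \<le> \<rho> i / 2)"
proof -
  have "R / 2 < R" using R by simp
  then obtain K where "ball_bounded q v (R / 2) K" using v unfolding ball_convergent_def by blast
  from ball_bounded_dcoefs_uniform[OF q _ this] R
  obtain K' where K': "0 \<le> K'" "\<And>is. length is \<le> m \<Longrightarrow> ball_bounded q (dcoefs is v) (R / 2 / 2) K'"
    by (metis half_gt_zero)
  define l where "l = min 1 (\<mu> / (2 * (K' + 1)))"
  have l: "0 < l" "l \<le> 1" using \<mu> K' by (auto simp: l_def)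
  have lK: "l * K' \<le> \<mu> / 2"
  proof -
    have "l * K' \<le> (\<mu> / (2 * (K' + 1))) * (K' + 1)" using \<mu> K' by (intro mult_mono) (auto simp: l_def)
    moreover have "x / (2 * z) * z = x / 2" if "z \<noteq> 0" for x z :: real using that by simp
    from this[of "K' + 1" \<mu>] K' have "(\<mu> / (2 * (K' + 1))) * (K' + 1) = \<mu> / 2" by linarith
    ultimately show ?thesis by linarith
  qed
  \<comment> \<open>The first entry serves the derivatives, scaled by \<open>l\<close>; the second
    bounds the coordinate functions, whose jets are the coordinates themselves.\<close>
  define R' where "R' = min (l * (R / 4)) (\<mu> / 2)"
  have "l * (R / 4) \<le> 1 * R" using l R by (intro mult_mono) auto
  then have R': "0 < R'" "R' \<le> R"
    using l R \<mu> unfolding R'_def by (simp, intro min.coboundedI1, simp)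
  have "\<bar>msum (jet_coef m v i) y\<bar> \<le> \<rho> i / 2" if y: "y \<in> lq_ball q UNIV R'" and i: "i \<in> jet_indices m" for y i
    using i m
  proof (cases rule: jet_coef_cases)
    case (1 b)
    then have "jet_coef m v i = (\<lambda>\<gamma>. if \<gamma> = unit_index b then 1 else 0)" by (auto simp: jet_coef_def)
    then have "msum (jet_coef m v i) y = y b" by (simp only: msum_unit)
    moreover have "\<bar>y b\<bar> < \<mu> / 2"
      using lq_coord_le_norm[OF q, of y b] y by (auto simp: lq_ball_iff R'_def)
    ultimately show ?thesis using \<rho>[OF i] by simp
  next
    case (2 \<beta> j)
    have "length (tx_derivs \<beta> j) \<le> m" using 2(2) by (simp add: length_tx_derivs)
    from K'(2)[OF this] have "ball_bounded q (dcoefs (tx_derivs \<beta> j) v) (R / 4) K'" by simp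
    then have "ball_bounded q (jet_coef m v i) (R / 4) K'"
      by (rule ball_bounded_le) (simp add: 2(3))
    from ball_bounded_shrink[OF q this _ l] have "ball_bounded q (jet_coef m v i) (l * (R / 4)) (l * K')"
      by (simp add: 2(3))
    moreover have "y \<in> lq_ball q UNIV (l * (R / 4))" by (rule lq_ball_mono[OF _ y]) (simp add: R'_def)
    ultimately have "\<bar>msum (jet_coef m v i) y\<bar> \<le> l * K'" by (rule ball_bounded_msum)
    then show ?thesis using lK \<rho>[OF i] by simp
  qed
  then show ?thesis using R' by blast
qed

text \<open>The converse of \<open>solution_of_coefs\<close>. Restriction to \<open>t = 0\<close>
  and the identity theorem recover the data from the low time orders; only then are the constant
  terms of the jets known, so that the expansion of \<open>f\<close> around the initial jet
  applies.\<close>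

lemma coefs_of_solution:
  assumes sol: "cauchy_solution_on m D f E \<phi> V u"
    and R: "0 < R" "R \<le> \<delta>" and V: "lq_ball q UNIV R \<subseteq> V" and v: "ball_convergent q v R"
    and u: "\<And>y. y \<in> lq_ball q UNIV R \<Longrightarrow> u y = msum v y"
  shows "\<And>\<gamma>. time_part \<gamma> < m \<Longrightarrow> v \<gamma> = data_coef m c \<gamma>"
    and "\<And>y. y \<in> lq_ball q UNIV R \<Longrightarrow> (\<And>i. i \<in> jet_indices m \<Longrightarrow> \<bar>msum (jet_coef m v i) y\<bar> \<le> \<rho> i / 2) \<Longrightarrow>
        msum (dcoefs (replicate m Time) v) y = monomial_sum (jet_indices m) C (\<lambda>i. msum (jet_coef m v i) y)"
proof -
  note it = iter_pderiv_msum(1)[OF q v, of u, OF u]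
  show low: "v \<gamma> = data_coef m c \<gamma>" if k: "time_part \<gamma> < m" for \<gamma>
  proof -
    define k where "k = time_part \<gamma>"
    have k: "k < m" using that by (simp add: k_def)
    let ?b = "\<lambda>\<beta>. dcoefs (replicate k Time) v (tx_multi 0 \<beta>)"
    have "?b = c k"
    proof (rule msum_identity[OF q R(1)])
      show "ball_convergent q ?b R"
        by (rule ball_convergent_tx_point[OF q ball_convergent_dcoefs[OF q v]])
      show "ball_convergent q (c k) R" by (rule ball_convergent_mono[OF data[OF k] R(2)])
      fix x :: "nat \<Rightarrow> real" assume x: "x \<in> lq_ball q UNIV R"
      then have tx: "tx_point 0 x \<in> lq_ball q UNIV R" using tx_point_ball_iff[OF q] by blast
      have "msum ?b x = iter_pderiv (replicate k Time) u (tx_point 0 x)"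
        using it[OF _ tx, of "replicate k Time"] by (simp add: msum_tx_point)
      also have "\<dots> = \<phi> k x" using sol k tx V by (auto simp: cauchy_solution_on_def)
      also have "\<dots> = msum (c k) x" using \<phi>[OF k lq_ball_mono[OF R(2) x]] by simp
      finally show "msum ?b x = msum (c k) x" .
    qed
    then have "c k (space_part \<gamma>) = fact k * v (tx_multi k (space_part \<gamma>))"
      by (metis dcoefs_time)
    then show ?thesis using k by (simp add: data_coef_def k_def)
  qed
  fix y :: "tx_index \<Rightarrow> real"
  assume y: "y \<in> lq_ball q UNIV R" and small: "\<And>i. i \<in> jet_indices m \<Longrightarrow> \<bar>msum (jet_coef m v i) y\<bar> \<le> \<rho> i / 2"
  have "msum (dcoefs (replicate m Time) v) y = f (jet m u y)"
    using it[OF _ y, of "replicate m Time"] sol y V by (auto simp: cauchy_solution_on_def)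
  then show "msum (dcoefs (replicate m Time) v) y = monomial_sum (jet_indices m) C (\<lambda>i. msum (jet_coef m v i) y)"
    using jet_in_polydisc(2)[OF R(1) v u low y small] by simp
qed

text \<open>Agreement below order \<open>k\<close> in \<open>t\<close> improves by one order through
  \<open>right_hand_side_order\<close>, starting from the empty agreement at
  \<open>k = 0\<close>.\<close>

lemma fixed_point_unique:
  assumes R: "0 < R" and v: "ball_convergent q (sol_coef m c w) R" and v': "ball_convergent q (sol_coef m c w') R"
    and w: "ball_convergent q w R" and w': "ball_convergent q w' R"
    and small: "\<And>y i. y \<in> lq_ball q UNIV R \<Longrightarrow> i \<in> jet_indices m \<Longrightarrow>
        \<bar>msum (jet_coef m (sol_coef m c w) i) y\<bar> \<le> \<rho> i / 2"
    and small': "\<And>y i. y \<in> lq_ball q UNIV R \<Longrightarrow> i \<in> jet_indices m \<Longrightarrow>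
        \<bar>msum (jet_coef m (sol_coef m c w') i) y\<bar> \<le> \<rho> i / 2"
    and eq: "\<And>y. y \<in> lq_ball q UNIV R \<Longrightarrow>
        msum w y = monomial_sum (jet_indices m) C (\<lambda>i. msum (jet_coef m (sol_coef m c w) i) y)"
    and eq': "\<And>y. y \<in> lq_ball q UNIV R \<Longrightarrow>
        msum w' y = monomial_sum (jet_indices m) C (\<lambda>i. msum (jet_coef m (sol_coef m c w') i) y)"
  shows "w = w'"
proof
  have "time_part \<gamma> < k \<Longrightarrow> w \<gamma> = w' \<gamma>" for k \<gamma>
  proof (induction k arbitrary: \<gamma>)
    case (Suc k)
    have "sol_coef m c w \<gamma> = sol_coef m c w' \<gamma>" if "time_part \<gamma> < m + k" for \<gamma>
      using Suc.IH that by (rule sol_coef_agree)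
    from right_hand_side_order[OF q R m le_add1 v v' this \<mu> \<rho> C small small' w w' eq eq', of k \<gamma>]
    show ?case using Suc.prems by simp
  qed simp
  then show "w \<gamma> = w' \<gamma>" for \<gamma> by blast
qed

end

theorem theorem3p1:
  fixes m :: nat and p :: real and q :: ennreal
    and D :: "(jet_index \<Rightarrow> real) set" and f :: "(jet_index \<Rightarrow> real) \<Rightarrow> real"
    and E :: "nat \<Rightarrow> (nat \<Rightarrow> real) set" and \<phi> :: "nat \<Rightarrow> (nat \<Rightarrow> real) \<Rightarrow> real"
    and C :: "(jet_index \<Rightarrow>\<^sub>0 nat) \<Rightarrow> real" and c :: "nat \<Rightarrow> (nat \<Rightarrow>\<^sub>0 nat) \<Rightarrow> real"
  assumes m: "m > 0"
    and p: "1 \<le> p"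
    and conjugate: "1 / ennreal p + 1 / q = 1"
    and f_analytic: "analytic_near_with (jet_indices m) D f (initial_jet m \<phi>) C"
    and phi_analytic: "\<And>k. k < m \<Longrightarrow> analytic_near_with UNIV (E k) (\<phi> k) (\<lambda>_. 0) (c k)"
    and F_conv: "abs_conv_near_infinity p (jet_indices m) (F_domain m C) (F_major m C) (\<lambda>_. 0)
                   (\<lambda>\<alpha>. \<bar>C \<alpha>\<bar>)"
    and Phi_conv: "\<And>k. k < m \<Longrightarrow>
          abs_conv_near_infinity p (jet_indices m) (Phi_domain m (c k)) (Phi_major (c k)) (\<lambda>_. 0)
            (Phi_coeff (c k))"
    and f_repr: "abs_conv_near_infinity p (jet_indices m) D f (initial_jet m \<phi>) C"
    and phi_repr: "\<And>k. k < m \<Longrightarrow>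
          abs_conv_near_infinity p UNIV (E k) (\<phi> k) (\<lambda>_. 0) (c k)"
  shows "\<exists>U u. openin (lq_topology q UNIV) U \<and> (\<lambda>_. 0) \<in> U \<and>
           cauchy_solution_on m D f E \<phi> U u \<and>
           analytic_near_under q UNIV U u (\<lambda>_. 0) \<and>
           (\<forall>V v. openin (lq_topology q UNIV) V \<and> (\<lambda>_. 0) \<in> V \<and>
                  cauchy_solution_on m D f E \<phi> V v \<and>
                  analytic_near_under q UNIV V v (\<lambda>_. 0) \<longrightarrow>
              (\<exists>W. openin (lq_topology q UNIV) W \<and> (\<lambda>_. 0) \<in> W \<and> W \<subseteq> U \<inter> V \<and>
                   (\<forall>y\<in>W. v y = u y))) \<and>
           frechet_C1_near q UNIV U u (\<lambda>_. 0)"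
proof -
  have q: "1 \<le> q" using conjugate_ge_1[OF p conjugate] .
  obtain \<rho>\<^sub>0 M S where \<rho>0: "analytic_near_at (jet_indices m) D f (initial_jet m \<phi>) C \<rho>\<^sub>0"
    and C: "sums_bounded (\<lambda>\<alpha>. \<bar>C \<alpha>\<bar> * mpow (\<lambda>i. \<bar>\<rho>\<^sub>0 i\<bar>) \<alpha>) (multi_indices (jet_indices m)) M"
    and S: "sums_bounded (\<lambda>i. \<bar>1 / \<bar>\<rho>\<^sub>0 i\<bar>\<bar> powr p) (jet_indices m) S"
    using f_repr by (rule abs_conv_near_infinityE)
  define \<rho> where "\<rho> = (\<lambda>i. \<bar>\<rho>\<^sub>0 i\<bar>)"
  have \<rho>pos: "0 < \<rho> i" if "i \<in> jet_indices m" for i using \<rho>0 that by (simp add: \<rho>_def analytic_near_at_def)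
  \<comment> \<open>The sum of the p-th powers bounds every inverse radius by
    \<open>max 1 S\<close>, so infinitely many radii share one positive lower bound.\<close>
  define \<mu> where "\<mu> = 1 / max 1 S"
  have \<mu>: "0 < \<mu>" by (simp add: \<mu>_def less_max_iff_disj)
  have \<rho>: "\<mu> \<le> \<rho> i" if i: "i \<in> jet_indices m" for i
  proof -
    have "1 / \<rho> i \<le> max 1 S" using sums_bounded_powr_le[OF p S i] by (simp add: \<rho>_def)
    then have "1 \<le> max 1 S * \<rho> i" using \<rho>pos[OF i] by (simp only: divide_le_eq if_True)
    then show ?thesis unfolding \<mu>_def by (simp add: divide_le_eq less_max_iff_disj mult.commute)
  qed
  let ?P = "\<lambda>k r L T. analytic_near_at UNIV (E k) (\<phi> k) (\<lambda>_. 0) (c k) r \<and>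
      sums_bounded (\<lambda>\<beta>. \<bar>c k \<beta>\<bar> * mpow (\<lambda>i. \<bar>r i\<bar>) \<beta>) UNIV L \<and>
      sums_bounded (\<lambda>i. \<bar>1 / \<bar>r i\<bar>\<bar> powr p) UNIV T"
  have "\<forall>k\<in>{..<m}. \<exists>rLT. ?P k (fst rLT) (fst (snd rLT)) (snd (snd rLT))"
  proof
    fix k assume "k \<in> {..<m}"
    then have "abs_conv_near_infinity p UNIV (E k) (\<phi> k) (\<lambda>_. 0) (c k)" by (intro phi_repr) simp
    then obtain r L T where "?P k r L T"
      by (rule abs_conv_near_infinityE) (simp only: multi_indices_UNIV simp_thms)
    then show "\<exists>rLT. ?P k (fst rLT) (fst (snd rLT)) (snd (snd rLT))"
      by (intro exI[of _ "(r, L, T)"]) simp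
  qed
  from bchoice[OF this] obtain rLT
    where rLT: "\<And>k. k < m \<Longrightarrow> ?P k (fst (rLT k)) (fst (snd (rLT k))) (snd (snd (rLT k)))" by auto
  define r L T where "r = (\<lambda>k. fst (rLT k))" and "L = (\<lambda>k. fst (snd (rLT k)))" and "T = (\<lambda>k. snd (snd (rLT k)))"
  have r: "\<And>k. k < m \<Longrightarrow> analytic_near_at UNIV (E k) (\<phi> k) (\<lambda>_. 0) (c k) (r k)"
    and L: "\<And>k. k < m \<Longrightarrow> sums_bounded (\<lambda>\<beta>. \<bar>c k \<beta>\<bar> * mpow (\<lambda>i. \<bar>r k i\<bar>) \<beta>) UNIV (L k)"
    and T: "\<And>k. k < m \<Longrightarrow> sums_bounded (\<lambda>i. \<bar>1 / \<bar>r k i\<bar>\<bar> powr p) UNIV (T k)"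
    using rLT by (simp_all only: r_def L_def T_def)
  have rpos: "0 < \<bar>r k i\<bar>" if "k < m" for k i using r[OF that] by (simp add: analytic_near_at_def)
  have ind: "Indep v \<in> jet_indices m" for v by (simp add: jet_indices_def)
  have S': "sums_bounded (\<lambda>i. \<bar>1 / \<rho> (Indep (Space i))\<bar> powr p) UNIV (1 * S)"
    by (rule sums_bounded_comparison[OF S, where \<pi>="\<lambda>i. Indep (Space i)" and A'=UNIV])
      (use ind in \<open>auto simp: inj_def \<rho>_def\<close>)
  have bpos: "0 < 1 / \<rho> (Indep (Space i))" for i using \<rho>pos[OF ind] by simp
  \<comment> \<open>One weight sequence dominates the inverse radii of \<open>f\<close> in the space
    variables and those of all the data.\<close>
  obtain a S\<^sub>a where a: "\<And>i. 0 < a i" "\<And>i. 1 / \<rho> (Indep (Space i)) \<le> a i"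
    "\<And>i k. k < m \<Longrightarrow> 1 / \<bar>r k i\<bar> \<le> a i" and aS: "sums_bounded (\<lambda>i. \<bar>a i\<bar> powr p) UNIV S\<^sub>a"
    using common_weight[where t="\<lambda>k i. 1 / \<bar>r k i\<bar>", OF p bpos S' T] by blast
  have a\<rho>: "1 / a i \<le> \<rho> (Indep (Space i))" for i
    using a(1)[of i] a(2)[of i] \<rho>pos[OF ind, of "Space i"] by (simp add: field_simps)
  have ar: "1 / a i \<le> \<bar>r k i\<bar>" if "k < m" for i k
    using a(1)[of i] a(3)[OF that, of i] rpos[OF that, of i] by (simp add: field_simps)
  \<comment> \<open>A p-summable weight is bounded, so its inverse is at least \<delta>; the ball of
    radius \<delta> thus lies in the polydiscs of all the data.\<close>
  define \<delta> where "\<delta> = 1 / max 1 S\<^sub>a"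
  have \<delta>: "0 < \<delta>" by (simp add: \<delta>_def less_max_iff_disj)
  have \<delta>r: "\<delta> \<le> \<bar>r k i\<bar>" if "k < m" for k i
  proof -
    have "a i \<le> max 1 S\<^sub>a" using sums_bounded_powr_le[OF p aS, of i] a(1)[of i] by simp
    then have "\<delta> \<le> 1 / a i" unfolding \<delta>_def using a(1)[of i] by (intro divide_left_mono) auto
    then show ?thesis using ar[OF that, of i] by simp
  qed
  have xr: "\<bar>x i\<bar> \<le> \<bar>r k i\<bar>" if "k < m" "x \<in> lq_ball q UNIV \<delta>" for k x i
    using lq_coord_le_norm[OF q, of x i] that(2) \<delta>r[OF that(1), of i] by (auto simp: lq_ball_iff)
  interpret cauchy_data m q D f E \<phi> C c \<rho> \<mu> M \<delta>
  proof
    show "sums_bounded (\<lambda>\<alpha>. \<bar>C \<alpha>\<bar> * mpow \<rho> \<alpha>) (multi_indices (jet_indices m)) M"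
      using C unfolding \<rho>_def .
    show "(\<lambda>i. initial_jet m \<phi> i + h i) \<in> D \<and>
        f (\<lambda>i. initial_jet m \<phi> i + h i) = monomial_sum (jet_indices m) C h"
      if "h \<in> Rprod (jet_indices m)" "\<And>i. i \<in> jet_indices m \<Longrightarrow> \<bar>h i\<bar> \<le> \<rho> i" for h
      using \<rho>0 that by (simp add: analytic_near_at_def \<rho>_def)
    show "ball_convergent q (c k) \<delta>" if "k < m" for k
    proof (rule ball_bounded_convergent[of _ _ _ "L k"])
      show "ball_bounded q (c k) \<delta> (L k)"
        unfolding ball_bounded_def
      proof
        fix x :: "nat \<Rightarrow> real" assume x: "x \<in> lq_ball q UNIV \<delta>"
        have "\<bar>mpow x \<beta>\<bar> \<le> mpow (\<lambda>i. \<bar>r k i\<bar>) \<beta>" for \<beta>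
          unfolding abs_mpow using xr[OF that x] by (intro mpow_mono) auto
        then show "sums_bounded (\<lambda>\<beta>. \<bar>c k \<beta> * mpow x \<beta>\<bar>) UNIV (L k)"
          by (intro sums_bounded_le[OF L[OF that]]) (auto simp: abs_mult intro: mult_left_mono)
      qed
    qed
    show "x \<in> E k \<and> \<phi> k x = msum (c k) x" if "k < m" "x \<in> lq_ball q UNIV \<delta>" for k x
      using r[OF that(1)] xr[OF that] by (simp add: analytic_near_at_def Rprod_def)
  qed (use m q \<mu> \<delta> \<rho> in auto)
  obtain R\<^sub>1 w where R1: "0 < R\<^sub>1" and w: "ball_convergent q w R\<^sub>1" and v: "ball_convergent q (sol_coef m c w) R\<^sub>1"
    and small: "\<And>y i. y \<in> lq_ball q UNIV R\<^sub>1 \<Longrightarrow> i \<in> jet_indices m \<Longrightarrow>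
        \<bar>msum (jet_coef m (sol_coef m c w) i) y\<bar> \<le> \<rho> i / 2"
    and eq: "\<And>y. y \<in> lq_ball q UNIV R\<^sub>1 \<Longrightarrow>
        msum w y = monomial_sum (jet_indices m) C (\<lambda>i. msum (jet_coef m (sol_coef m c w) i) y)"
    using analytic_solution_exists[where c=c and R="\<lambda>k i. \<bar>r k i\<bar>" and L=L,
        OF p conjugate m a(1) aS \<mu> \<rho> a\<rho> C[folded \<rho>_def] ar L] by blast
  define R where "R = min R\<^sub>1 \<delta>"
  have R: "0 < R" "R \<le> R\<^sub>1" "R \<le> \<delta>" using R1 \<delta> by (auto simp: R_def)
  define U where "U = (lq_ball q UNIV R :: (tx_index \<Rightarrow> real) set)"
  define u where "u = msum (sol_coef m c w)"
  have vR: "ball_convergent q (sol_coef m c w) R" and wR: "ball_convergent q w R"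
    using v w R(2) by (auto intro: ball_convergent_mono)
  have inj: "inj (\<lambda>v. case v of Time \<Rightarrow> 0 | Space i \<Rightarrow> Suc i)"
    by (rule injI) (auto split: tx_index.splits)
  show ?thesis
  proof (rule exI[of _ U], rule exI[of _ u], intro conjI allI impI)
    show "openin (lq_topology q UNIV) U" unfolding U_def by (rule openin_lq_ball[OF R(1)])
    show "(\<lambda>_. 0) \<in> U" unfolding U_def by (rule lq_ball_zero[OF q R(1)])
    show "cauchy_solution_on m D f E \<phi> U u"
      unfolding U_def u_def
      by (rule solution_of_coefs[OF R(1,3) vR small eq]) (simp_all only: lq_ball_mono[OF R(2)])
    show "analytic_near_under q UNIV U u (\<lambda>_. 0)"
      unfolding U_def u_def by (rule msum_analytic_near_under[OF q R(1) vR inj])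
    show "frechet_C1_near q UNIV U u (\<lambda>_. 0)"
      unfolding U_def u_def by (rule msum_frechet_C1[OF q vR R(1) order_refl refl])
  next
    fix V g
    assume g: "openin (lq_topology q UNIV) V \<and> (\<lambda>_. 0) \<in> V \<and> cauchy_solution_on m D f E \<phi> V g \<and>
        analytic_near_under q UNIV V g (\<lambda>_. 0)"
    then obtain v' W where W: "openin (lq_topology q UNIV) W" "(\<lambda>_. 0) \<in> W" "W \<subseteq> V"
      and gW: "\<And>y. y \<in> W \<Longrightarrow> monomial_conv UNIV v' y \<and> g y = msum v' y"
      by (auto simp: analytic_near_under_def)
    obtain r\<^sub>1 where r1: "0 < r\<^sub>1" "\<And>y. y \<in> lq_ball q UNIV r\<^sub>1 \<Longrightarrow> y \<in> W"
      using openin_lq_topology_ball[OF q W(1,2)] by auto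
    \<comment> \<open>The competitor is only known to converge absolutely at each point; the
      condensation argument turns this into a uniform bound on a smaller ball, as termwise
      differentiation requires.\<close>
    obtain r\<^sub>2 K where r2: "0 < r\<^sub>2" "ball_bounded q v' r\<^sub>2 K"
      using convergent_imp_ball_bounded[OF q r1(1), of v'] gW r1(2) by blast
    define r\<^sub>3 where "r\<^sub>3 = min R (min r\<^sub>1 r\<^sub>2)"
    have r3: "0 < r\<^sub>3" "r\<^sub>3 \<le> R" "r\<^sub>3 \<le> r\<^sub>1" "r\<^sub>3 \<le> r\<^sub>2" using R r1 r2 by (auto simp: r\<^sub>3_def)
    have v'3: "ball_convergent q v' r\<^sub>3"
      using ball_bounded_convergent[OF r2(2)] r3(4) by (rule ball_convergent_mono)
    obtain R' where R': "0 < R'" "R' \<le> r\<^sub>3" and small': "\<And>y i. y \<in> lq_ball q UNIV R' \<Longrightarrow> i \<in> jet_indices m \<Longrightarrow>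
        \<bar>msum (jet_coef m v' i) y\<bar> \<le> \<rho> i / 2"
      using jets_small_near_zero[OF r3(1) v'3] by blast
    have v'R: "ball_convergent q v' R'" using v'3 R'(2) by (rule ball_convergent_mono)
    have inR: "y \<in> lq_ball q UNIV R" and inW: "y \<in> W" if "y \<in> lq_ball q UNIV R'" for y
      using lq_ball_mono[OF _ that, of R] lq_ball_mono[OF _ that, of r\<^sub>1] r1(2) r3 R' by auto
    have R'\<delta>: "R' \<le> \<delta>" using R' r3 R by simp
    have sol: "cauchy_solution_on m D f E \<phi> V g" and subV: "lq_ball q UNIV R' \<subseteq> V"
      and gv': "\<And>y. y \<in> lq_ball q UNIV R' \<Longrightarrow> g y = msum v' y"
      using g gW inW W(3) by auto
    note cs = coefs_of_solution[OF sol R'(1) R'\<delta> subV v'R gv']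
    \<comment> \<open>Both solutions are compared through their derivatives
      \<open>\<partial>_t^m\<close>, which solve the same fixed-point equation.\<close>
    define w' where "w' = dcoefs (replicate m Time) v'"
    have v'w': "sol_coef m c w' = v'" unfolding w'_def by (rule sol_coef_dcoefs[OF cs(1)])
    have "w = w'"
    proof (rule fixed_point_unique[OF R'(1)])
      show "ball_convergent q (sol_coef m c w) R'" "ball_convergent q w R'"
        using vR wR R' r3 by (auto intro: ball_convergent_mono)
      show "ball_convergent q (sol_coef m c w') R'" unfolding v'w' by (rule v'R)
      show "ball_convergent q w' R'" unfolding w'_def by (rule ball_convergent_dcoefs[OF q v'R])
      show "\<bar>msum (jet_coef m (sol_coef m c w) i) y\<bar> \<le> \<rho> i / 2"
        if "y \<in> lq_ball q UNIV R'" "i \<in> jet_indices m" for y i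
        using small[OF lq_ball_mono[OF R(2) inR[OF that(1)]] that(2)] .
      show "msum w y = monomial_sum (jet_indices m) C (\<lambda>i. msum (jet_coef m (sol_coef m c w) i) y)"
        if "y \<in> lq_ball q UNIV R'" for y
        using eq[OF lq_ball_mono[OF R(2) inR[OF that]]] .
      show "\<bar>msum (jet_coef m (sol_coef m c w') i) y\<bar> \<le> \<rho> i / 2"
        if "y \<in> lq_ball q UNIV R'" "i \<in> jet_indices m" for y i
        unfolding v'w' using small'[OF that] .
      show "msum w' y = monomial_sum (jet_indices m) C (\<lambda>i. msum (jet_coef m (sol_coef m c w') i) y)"
        if "y \<in> lq_ball q UNIV R'" for y
        unfolding v'w' unfolding w'_def by (rule cs(2)[OF _ that small'[OF that]])
    qed
    then have "g y = u y" if "y \<in> lq_ball q UNIV R'" for y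
      using gv'[OF that] v'w' by (simp add: u_def)
    then show "\<exists>W. openin (lq_topology q UNIV) W \<and> (\<lambda>_. 0) \<in> W \<and> W \<subseteq> U \<inter> V \<and> (\<forall>y\<in>W. g y = u y)"
      using openin_lq_ball[OF R'(1)] lq_ball_zero[OF q R'(1)] subV inR
      by (intro exI[of _ "lq_ball q UNIV R'"]) (auto simp: U_def)
  qed
qed

end
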